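(* Let $H\in(0,1)$ and $\alpha\in(0,1)$. The solution to the Cauchy problem $$ \begin{cases} {}^C\left(t^{1-2H}\frac{\partial}{\partial t}\right)^{\alpha} u_{\alpha}(x,t)= H^{\alpha}\,\frac{\partial^2}{\partial x^2}u_{\alpha}(x,t), & x\in\mathbb{R},\ t>0,\\ u_{\alpha}(x,0)=\delta(x), \end{cases} $$ is given by $$ u_{\alpha}(x,t)=\frac{1}{2^{1-\alpha/2}\,t^{H\alpha}}\; W_{-\alpha/2,\,1-\alpha/2}\left(-\frac{2^{\alpha/2}|x|}{t^{H\alpha}}\right). $$
   Context: $\delta$ is the Dirac delta at $0$. The Wright function is $W_{\gamma,\beta}(x)=\sum_{k=0}^\infty \frac{x^k}{k!\,\Gamma(\gamma k+\beta)}$ for $\gamma>-1$, $\beta>0$, $x\in\mathbb{R}$ (with $1/\Gamma=0$ at the poles of $\Gamma$). Erdélyi–Kober operators: for $m>0$, $\eta\in\mathbb{R}$ and $a>0$, $$(I_m^{\eta,a}f)(t)=\frac{t^{-m\eta-ma}}{\Gamma(a)}\int_0^t (t^m-s^m)^{a-1}s^{m\eta}f(s)\,\mathrm{d}(s^m),$$ and for $a\le 0$, recursively, $I_m^{\eta,a}f=(\eta+a+1)I_m^{\eta,a+1}f+\frac1m I_m^{\eta,a+1}\left(t\frac{\mathrm{d}f}{\mathrm{d}t}\right)$. The fractional power (McBride) of the operator $t^{1-2H}\frac{\mathrm d}{\mathrm dt}$ is $$\left(t^{1-2H}\frac{\mathrm d}{\mathrm dt}\right)^{\alpha}f(t)=(2H)^{\alpha}t^{-2H\alpha}\,(I_{2H}^{0,-\alpha}f)(t).$$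 Its regularized Caputo-like counterpart for $\alpha\in(0,1)$ is $${}^C\left(t^{1-2H}\frac{\mathrm d}{\mathrm dt}\right)^{\alpha}f(t)=\left(t^{1-2H}\frac{\mathrm d}{\mathrm dt}\right)^{\alpha}\bigl(f(t)-f(0^+)\bigr)=\left(t^{1-2H}\frac{\mathrm d}{\mathrm dt}\right)^{\alpha}f(t)-(2H)^{\alpha}\frac{t^{-2H\alpha}}{\Gamma(1-\alpha)}f(0^+).$$ These operators act in the variable $t$. Since the initial datum is $\delta$, the Cauchy problem is understood through the Fourier transform in $x$, $\widehat u(\beta,t)=\int_{\mathbb R}e^{i\beta x}u(x,t)\,\mathrm dx$: for every $\beta\in\mathbb{R}$, $\widehat u_\alpha(\beta,\cdot)$ satisfies ${}^C\left(t^{1-2H}\frac{\mathrm d}{\mathrm dt}\right)^{\alpha}\widehat u_\alpha=-H^\alpha\beta^2\,\widehat u_\alpha$ for $t>0$, with $\widehat u_\alpha(\beta,0)=1$. *)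

theory Defs
  imports "HOL-Analysis.Analysis"
begin

definition wright :: "real \<Rightarrow> real \<Rightarrow> real \<Rightarrow> real" where
  "wright \<gamma> b x = (\<Sum>k. x ^ k / fact k * rGamma (\<gamma> * real k + b))"

text \<open>The Stieltjes differential of \<open>s powr m\<close> is written out as \<open>m * s powr (m - 1)\<close> times
  Lebesgue measure.\<close>

definition EK_integrand ::
  "real \<Rightarrow> real \<Rightarrow> real \<Rightarrow> (real \<Rightarrow> complex) \<Rightarrow> real \<Rightarrow> real \<Rightarrow> complex" where
  "EK_integrand m \<eta> a f t s =
     ((t powr m - s powr m) powr (a - 1) * s powr (m * \<eta>) * (m * s powr (m - 1))) *\<^sub>R f s"

function erdelyi_kober ::
  "real \<Rightarrow> real \<Rightarrow> real \<Rightarrow> (real \<Rightarrow> complex) \<Rightarrow> real \<Rightarrow> complex" where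
  "erdelyi_kober m \<eta> a f t =
     (if a > 0
      then (t powr (- (m * \<eta>) - m * a) / Gamma a) *\<^sub>R
             (LINT s:{0<..<t}|lborel. EK_integrand m \<eta> a f t s)
      else (\<eta> + a + 1) *\<^sub>R erdelyi_kober m \<eta> (a + 1) f t
         + (1 / m) *\<^sub>R erdelyi_kober m \<eta> (a + 1) (\<lambda>s. s *\<^sub>R vector_derivative f (at s)) t)"
  by pat_completeness auto
termination
  by (relation "Wellfounded.measure (\<lambda>(m, \<eta>, a, f, t). nat \<lceil>1 - a\<rceil>)") (simp_all, linarith+)

declare erdelyi_kober.simps [simp del]

text \<open>Integrals and derivatives are total functions here, with arbitrary values when they do not
  exist.  The following predicate says that everything occurring in the definition of
  \<open>erdelyi_kober m \<eta> a f t\<close> does exist.\<close>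

function EK_exists ::
  "real \<Rightarrow> real \<Rightarrow> real \<Rightarrow> (real \<Rightarrow> complex) \<Rightarrow> real \<Rightarrow> bool" where
  "EK_exists m \<eta> a f t \<longleftrightarrow>
     (if a > 0
      then set_integrable lborel {0<..<t} (EK_integrand m \<eta> a f t)
      else (\<forall>s\<in>{0<..<t}. f differentiable at s)
         \<and> EK_exists m \<eta> (a + 1) f t
         \<and> EK_exists m \<eta> (a + 1) (\<lambda>s. s *\<^sub>R vector_derivative f (at s)) t)"
  by pat_completeness auto
termination
  by (relation "Wellfounded.measure (\<lambda>(m, \<eta>, a, f, t). nat \<lceil>1 - a\<rceil>)") (simp_all, linarith+)

declare EK_exists.simps [simp del]

definition mcbride_power :: "real \<Rightarrow> real \<Rightarrow> (real \<Rightarrow> complex) \<Rightarrow> real \<Rightarrow> complex" where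
  "mcbride_power H \<alpha> f t =
     ((2 * H) powr \<alpha> * t powr (- (2 * H * \<alpha>))) *\<^sub>R erdelyi_kober (2 * H) 0 (- \<alpha>) f t"

definition regularize :: "(real \<Rightarrow> complex) \<Rightarrow> real \<Rightarrow> complex" where
  "regularize f t = f t - Lim (at_right 0) f"

definition caputo_power :: "real \<Rightarrow> real \<Rightarrow> (real \<Rightarrow> complex) \<Rightarrow> real \<Rightarrow> complex" where
  "caputo_power H \<alpha> f = mcbride_power H \<alpha> (regularize f)"

definition caputo_power_exists :: "real \<Rightarrow> real \<Rightarrow> (real \<Rightarrow> complex) \<Rightarrow> real \<Rightarrow> bool" where
  "caputo_power_exists H \<alpha> f t \<longleftrightarrow>
     (\<exists>l. (f \<longlongrightarrow> l) (at_right 0)) \<and> EK_exists (2 * H) 0 (- \<alpha>) (regularize f) t"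

definition fourier :: "(real \<Rightarrow> real) \<Rightarrow> real \<Rightarrow> complex" where
  "fourier g \<beta> = (LINT x|lborel. exp (\<i> * of_real (\<beta> * x)) * of_real (g x))"

text \<open>The Cauchy problem with initial datum the Dirac delta, read through the Fourier transform
  in \<open>x\<close>.  At time \<open>0\<close> the solution is not a function of \<open>x\<close>, so the initial condition is imposed
  on the limit of the Fourier transform as \<open>t\<close> tends to \<open>0\<close> from the right; only the values
  \<open>u x t\<close> with \<open>t > 0\<close> matter.\<close>

definition solves_cauchy_problem :: "real \<Rightarrow> real \<Rightarrow> (real \<Rightarrow> real \<Rightarrow> real) \<Rightarrow> bool" where
  "solves_cauchy_problem H \<alpha> u \<longleftrightarrow>
     (\<forall>t>0. integrable lborel (\<lambda>x. u x t)) \<and>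
     (\<forall>\<beta>. let v = (\<lambda>t. fourier (\<lambda>x. u x t) \<beta>) in
        (v \<longlongrightarrow> 1) (at_right 0) \<and>
        (\<forall>t>0. caputo_power_exists H \<alpha> v t \<and>
           caputo_power H \<alpha> v t = - of_real (H powr \<alpha> * \<beta>\<^sup>2) * v t))"

end

theory Submission
  imports Defs "HOL-Probability.Probability"
begin

text \<open>
The proof represents the Wright function as an absolutely convergent integral over a vertical line,
from which its decay, its integrability and its Fourier transform can all be read off, and then
settles the resulting fractional equation in \<open>t\<close> by hand.

\<^bold>\<open>Solution.\<close>  In Hankel's formula for \<open>1/\<Gamma>\<close> substitute \<open>\<sigma> = w\<^sup>2\<close>.  The contour around the
negative half axis becomes a line \<open>Re w = a\<close> with \<open>a > 0\<close>, on which \<open>exp (w\<^sup>2)\<close> decays like a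
Gaussian:
\<open>\<integral> exp (w\<^sup>2) w\<^sup>p dy = \<pi> / \<Gamma> ((1 - p) / 2)\<close> for \<open>w = a + iy\<close> and every real \<open>p\<close>
(\<open>hankel_integral_eq_rGamma\<close>).  Summing this formula over the terms of the Wright series gives
\<open>\<pi> W(-z) = \<integral> exp (w\<^sup>2) w\<^bsup>\<alpha>-1\<^esup> exp (- z w\<^sup>\<alpha>) dy\<close> with \<open>W\<close> the Wright function of parameters
\<open>-\<alpha>/2\<close> and \<open>1 - \<alpha>/2\<close> (\<open>wright_hankel_integral\<close>).  Since \<open>\<alpha> < 1\<close>, the real part of \<open>w\<^sup>\<alpha>\<close> is bounded
below by a positive constant on the line, so \<open>W(-z)\<close> decays exponentially as \<open>z\<close> tends to
\<open>\<infinity>\<close>; Fubini's theorem and a geometric series, convergent once \<open>a\<close> is large in comparison with the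
frequency \<open>b\<close>, give the cosine transform
\<open>\<Sum>\<^sub>n (- b\<^sup>2)\<^sup>n / \<Gamma> (1 + \<alpha> n)\<close> (\<open>mainardi_cos_transform\<close>).  After rescaling, the Fourier transform
of \<open>u\<close> in \<open>x\<close> is a Mittag-Leffler function of \<open>- \<mu> t\<^bsup>2H\<alpha>\<^esup>\<close> with \<open>\<mu> = b\<^sup>2 / 2\<^sup>\<alpha>\<close>.
In the variable \<open>y = t\<^bsup>2H\<^esup>\<close> the Erdelyi-Kober integrals are Abel integrals, and integrating the
power series term by term with Beta integrals shows that this function satisfies the equation
(\<open>caputo_mittag_leffler\<close>).

\<^bold>\<open>Uniqueness.\<close>  Let \<open>G(y)\<close> be the Fourier transform, at a fixed frequency, of an arbitrary solution,
reduced by its initial value \<open>1\<close> and written in the variable \<open>y\<close>.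
The equation prescribes the Abel integral of order \<open>1 - \<alpha>\<close> of \<open>(1 - \<alpha>) G + y G'\<close>;
integrating once more with the complementary order \<open>\<alpha>\<close> removes the fractional kernel, and
integration by parts removes the derivative.  What remains is the Volterra equation
\<open>X G(X) = \<alpha> \<integral>\<^sub>0\<^sup>X G - \<nu> \<integral>\<^sub>0\<^sup>X (X - T)\<^bsup>\<alpha>-1\<^esup> T (G(T) + 1) dT\<close>
(\<open>caputo_solution_volterra\<close>).  The difference of two solutions satisfies the homogeneous equation,
which is a contraction for a sup norm with weight \<open>exp (- l X)\<close>, because \<open>\<alpha> < 1\<close> and the Abel term is
small for large \<open>l\<close> (\<open>volterra_unique_zero\<close>).  So the Fourier transforms of any two solutions agree,
and Levy's uniqueness theorem for characteristic functions identifies the solutions themselves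
almost everywhere (\<open>fourier_unique\<close>).
\<close>

section \<open>Gaussian bounds on vertical lines\<close>

text \<open>
This is the common majorant for all integrals over vertical lines below: there a power of \<open>w\<close>, and
the exponential of a power below \<open>1\<close>, grow at most like \<open>exp (c \<bar>y\<bar>)\<close>.
\<close>
lemma integrable_gauss_exp_abs:
  fixes c :: real
  shows "integrable lborel (\<lambda>y::real. exp (c * \<bar>y\<bar> - y\<^sup>2))"
proof (rule Bochner_Integration.integrable_bound)
  have "integrable lborel (\<lambda>x. sqrt (2 * pi) * exp (c\<^sup>2 / 2) * std_normal_density x)"
    by (intro integrable_mult_right integrable_normal_density) simp
  then show "integrable lborel (\<lambda>y::real. exp (c\<^sup>2 / 2) * exp (- y\<^sup>2 / 2))"
    by (simp add: std_normal_density_def mult.assoc)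
  show "AE y in lborel. norm (exp (c * \<bar>y\<bar> - y\<^sup>2)) \<le> norm (exp (c\<^sup>2 / 2) * exp (- y\<^sup>2 / 2))"
  proof (rule AE_I2)
    fix y :: real
    have "0 \<le> (c - \<bar>y\<bar>)\<^sup>2" by simp
    then have "c * \<bar>y\<bar> - y\<^sup>2 \<le> c\<^sup>2 / 2 + - y\<^sup>2 / 2"
      by (simp add: power2_diff field_simps)
    then show "norm (exp (c * \<bar>y\<bar> - y\<^sup>2)) \<le> norm (exp (c\<^sup>2 / 2) * exp (- y\<^sup>2 / 2))"
      by (simp add: exp_add [symmetric])
  qed
qed simp

text \<open>
Both signs of the exponent are covered by the crude bound \<open>\<bar>ln x\<bar> \<le> x + 1 / a\<close>.
\<close>
lemma powr_le_exp_of_ge: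
  fixes x a p :: real
  assumes "0 < a" "a \<le> x"
  shows "x powr p \<le> exp (\<bar>p\<bar> * (x + 1 / a))"
proof -
  have x: "x > 0" using assms by simp
  have 1: "ln x \<le> x + 1 / a" using ln_le_minus_one [OF x] assms(1)
    by (smt (verit) divide_pos_pos)
  have "ln (1 / x) \<le> 1 / x - 1" using ln_le_minus_one [of "1/x"] x by simp
  then have "- ln x \<le> 1 / x" using x by (simp add: ln_div)
  also have "1 / x \<le> 1 / a" using assms by (simp add: frac_le)
  finally have 2: "- ln x \<le> x + 1 / a" using x by simp
  have "\<bar>ln x\<bar> \<le> x + 1 / a" using 1 2 by linarith
  then have "p * ln x \<le> \<bar>p\<bar> * (x + 1 / a)"
    by (metis abs_ge_self abs_ge_zero abs_mult mult_left_mono order_trans)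
  then show ?thesis using x by (simp add: powr_def)
qed

text \<open>
The integrand of Hankel's contour integral for \<open>1/\<Gamma>\<close> after the substitution \<open>\<sigma> = w\<^sup>2\<close>.
\<close>
definition hankel_kernel :: "real \<Rightarrow> complex \<Rightarrow> complex" where
  "hankel_kernel p w = exp (w\<^sup>2) * w powr complex_of_real p"

lemma norm_exp_square: "norm (exp (w\<^sup>2 :: complex)) = exp ((Re w)\<^sup>2 - (Im w)\<^sup>2)"
proof -
  have "Re (w * w) = Re w * Re w - Im w * Im w" by simp
  then show ?thesis by (simp only: norm_exp_eq_Re power2_eq_square)
qed

lemma norm_powr_of_real: "norm (w powr complex_of_real p) = norm w powr p"
  by (simp add: norm_powr_real_powr')

text \<open>
Uniformity over the strip \<open>a \<le> Re w \<le> b\<close> is what permits the Fubini argument that moves the line of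
integration.
\<close>
lemma norm_hankel_kernel_le:
  assumes "0 < a" "a \<le> Re w" "Re w \<le> b"
  shows "norm (hankel_kernel p w)
           \<le> exp (b\<^sup>2 + \<bar>p\<bar> * (b + 1 / a)) * exp (\<bar>p\<bar> * \<bar>Im w\<bar> - (Im w)\<^sup>2)"
proof -
  have a: "a \<le> norm w" using assms complex_Re_le_cmod order_trans by blast
  have "norm w powr p \<le> exp (\<bar>p\<bar> * (norm w + 1 / a))"
    using powr_le_exp_of_ge [OF assms(1) a] .
  also have "\<dots> \<le> exp (\<bar>p\<bar> * ((b + \<bar>Im w\<bar>) + 1 / a))"
    using cmod_le [of w] assms by (intro exp_le_cancel_iff [THEN iffD2] mult_left_mono) auto
  finally have 1: "norm w powr p \<le> exp (\<bar>p\<bar> * ((b + \<bar>Im w\<bar>) + 1 / a))" .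
  have "(Re w)\<^sup>2 \<le> b\<^sup>2" using assms by (intro power_mono) auto
  then have 2: "exp ((Re w)\<^sup>2 - (Im w)\<^sup>2) \<le> exp (b\<^sup>2 - (Im w)\<^sup>2)" by simp
  have "norm (hankel_kernel p w) = exp ((Re w)\<^sup>2 - (Im w)\<^sup>2) * norm w powr p"
    by (simp only: hankel_kernel_def norm_mult norm_exp_square norm_powr_of_real)
  also have "\<dots> \<le> exp (b\<^sup>2 - (Im w)\<^sup>2) * exp (\<bar>p\<bar> * ((b + \<bar>Im w\<bar>) + 1 / a))"
    using 1 2 by (intro mult_mono) auto
  also have "\<dots> = exp (b\<^sup>2 + \<bar>p\<bar> * (b + 1 / a)) * exp (\<bar>p\<bar> * \<bar>Im w\<bar> - (Im w)\<^sup>2)"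
    by (simp add: exp_add [symmetric] algebra_simps)
  finally show ?thesis .
qed

lemma Re_pos_notin_nonpos_Reals: "0 < Re w \<Longrightarrow> w \<notin> \<real>\<^sub>\<le>\<^sub>0"
  by (auto simp: complex_nonpos_Reals_iff)

definition hankel_kernel_deriv :: "real \<Rightarrow> complex \<Rightarrow> complex" where
  "hankel_kernel_deriv p w = 2 * hankel_kernel (p + 1) w + of_real p * hankel_kernel (p - 1) w"

lemma hankel_kernel_has_field_derivative:
  assumes "0 < Re w"
  shows "(hankel_kernel p has_field_derivative hankel_kernel_deriv p w) (at w)"
proof -
  have w: "w \<notin> \<real>\<^sub>\<le>\<^sub>0" "w \<noteq> 0" using assms by (auto simp: Re_pos_notin_nonpos_Reals)
  have "w powr of_real (p + 1) = w powr of_real p * w"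
    using w by (simp add: powr_add)
  then show ?thesis
    unfolding hankel_kernel_def hankel_kernel_deriv_def
    by (auto intro!: derivative_eq_intros w simp: algebra_simps)
qed

lemma continuous_on_hankel_kernel: "continuous_on {w. 0 < Re w} (hankel_kernel p)"
  using hankel_kernel_has_field_derivative
  by (meson DERIV_isCont continuous_at_imp_continuous_on mem_Collect_eq)

lemma continuous_on_Complex [continuous_intros]:
  assumes "continuous_on S f" "continuous_on S g"
  shows "continuous_on S (\<lambda>x. Complex (f x) (g x))"
  unfolding Complex_eq using assms by (intro continuous_intros)

lemma hankel_kernel_line_measurable [measurable]:
  assumes "0 < a"
  shows "(\<lambda>y. hankel_kernel p (Complex a y)) \<in> borel_measurable borel"
proof (rule borel_measurable_continuous_onI)
  show "continuous_on UNIV (\<lambda>y. hankel_kernel p (Complex a y))"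
    by (rule continuous_on_compose2 [OF continuous_on_hankel_kernel])
       (auto intro!: continuous_intros simp: assms)
qed

lemma hankel_kernel_line_integrable:
  assumes "0 < a"
  shows "integrable lborel (\<lambda>y. hankel_kernel p (Complex a y))"
proof (rule Bochner_Integration.integrable_bound)
  show "integrable lborel (\<lambda>y. exp (a\<^sup>2 + \<bar>p\<bar> * (a + 1 / a)) * exp (\<bar>p\<bar> * \<bar>y\<bar> - y\<^sup>2))"
    by (intro integrable_mult_right integrable_gauss_exp_abs)
  show "AE y in lborel. norm (hankel_kernel p (Complex a y))
     \<le> norm (exp (a\<^sup>2 + \<bar>p\<bar> * (a + 1 / a)) * exp (\<bar>p\<bar> * \<bar>y\<bar> - y\<^sup>2))"
    using norm_hankel_kernel_le [OF assms, of "Complex a _" a p] by (auto intro!: AE_I2)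
qed (use assms in measurable)

lemma gauss_exp_abs_tendsto:
  fixes c :: real
  shows "((\<lambda>y. exp (c * \<bar>y\<bar> - y\<^sup>2)) \<longlongrightarrow> 0) at_top" "((\<lambda>y. exp (c * \<bar>y\<bar> - y\<^sup>2)) \<longlongrightarrow> 0) at_bot"
proof -
  have "((\<lambda>y. exp (c * y - y\<^sup>2)) \<longlongrightarrow> 0) at_top" by real_asymp
  moreover have "eventually (\<lambda>y. exp (c * y - y\<^sup>2) = exp (c * \<bar>y\<bar> - y\<^sup>2)) at_top"
    using eventually_ge_at_top [of 0] by eventually_elim simp
  ultimately show *: "((\<lambda>y. exp (c * \<bar>y\<bar> - y\<^sup>2)) \<longlongrightarrow> 0) at_top"
    by (rule Lim_transform_eventually)
  show "((\<lambda>y. exp (c * \<bar>y\<bar> - y\<^sup>2)) \<longlongrightarrow> 0) at_bot"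
    using filterlim_compose [OF * filterlim_uminus_at_top_at_bot] by simp
qed

lemma hankel_kernel_line_tendsto:
  assumes "0 < a"
  shows "((\<lambda>y. hankel_kernel p (Complex a y)) \<longlongrightarrow> 0) at_top"
    and "((\<lambda>y. hankel_kernel p (Complex a y)) \<longlongrightarrow> 0) at_bot"
proof -
  have ev: "eventually (\<lambda>y. norm (hankel_kernel p (Complex a y))
     \<le> exp (a\<^sup>2 + \<bar>p\<bar> * (a + 1 / a)) * exp (\<bar>p\<bar> * \<bar>y\<bar> - y\<^sup>2)) F" for F
    using norm_hankel_kernel_le [OF assms, of "Complex a _" a p] by (auto intro!: always_eventually)
  show "((\<lambda>y. hankel_kernel p (Complex a y)) \<longlongrightarrow> 0) at_top"
    by (rule Lim_null_comparison [OF ev])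
       (use tendsto_mult_right_zero [OF gauss_exp_abs_tendsto(1)] in blast)
  show "((\<lambda>y. hankel_kernel p (Complex a y)) \<longlongrightarrow> 0) at_bot"
    by (rule Lim_null_comparison [OF ev])
       (use tendsto_mult_right_zero [OF gauss_exp_abs_tendsto(2)] in blast)
qed

definition hankel_integral :: "real \<Rightarrow> real \<Rightarrow> complex" where
  "hankel_integral p a = (LINT y|lborel. hankel_kernel p (Complex a y))"

text \<open>
The kernel vanishes at both ends of the line, so its derivative integrates to zero.  This single
fact yields both the recurrence in the exponent and the independence of the line.
\<close>
lemma hankel_kernel_deriv_integral:
  assumes "0 < a"
  shows "integrable lborel (\<lambda>y. hankel_kernel_deriv p (Complex a y))"
    and "(LINT y|lborel. hankel_kernel_deriv p (Complex a y)) = 0"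
proof -
  let ?f = "\<lambda>y. hankel_kernel_deriv p (Complex a y)"
  show int: "integrable lborel ?f"
    unfolding hankel_kernel_deriv_def
    by (intro Bochner_Integration.integrable_add integrable_mult_right
        hankel_kernel_line_integrable assms)
  have c: "continuous_on UNIV ?f"
    unfolding hankel_kernel_deriv_def
    by (intro continuous_intros continuous_on_compose2 [OF continuous_on_hankel_kernel])
       (auto simp: assms intro!: continuous_intros)
  have "(LBINT y=-\<infinity>..\<infinity>. \<i> * ?f y) = 0 - 0"
  proof (rule interval_integral_FTC_integrable)
    fix y :: real
    have C: "((\<lambda>y. Complex a y) has_vector_derivative \<i>) (at y)"
      unfolding Complex_eq by (auto intro!: derivative_eq_intros)
    have D: "(hankel_kernel p has_field_derivative ?f y) (at (Complex a y))"
      by (rule hankel_kernel_has_field_derivative) (simp add: assms)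
    show "((\<lambda>y. hankel_kernel p (Complex a y)) has_vector_derivative \<i> * ?f y) (at y)"
      using field_vector_diff_chain_at [OF C D] by (simp add: o_def)
    show "isCont (\<lambda>y. \<i> * ?f y) y"
      using c by (intro continuous_intros) (auto simp: continuous_on_eq_continuous_at)
  next
    show "set_integrable lborel (einterval (-\<infinity>) \<infinity>) (\<lambda>y. \<i> * ?f y)"
      using int by (simp add: set_integrable_def)
    show "(((\<lambda>y. hankel_kernel p (Complex a y)) \<circ> real_of_ereal) \<longlongrightarrow> 0) (at_right (- \<infinity>))"
      using hankel_kernel_line_tendsto(2) [OF assms]
      by (simp add: ereal_tendsto_simps)
    show "(((\<lambda>y. hankel_kernel p (Complex a y)) \<circ> real_of_ereal) \<longlongrightarrow> 0) (at_left \<infinity>)"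
      using hankel_kernel_line_tendsto(1) [OF assms]
      by (simp add: ereal_tendsto_simps)
  qed simp
  then show "(LINT y|lborel. ?f y) = 0"
    by (simp add: interval_lebesgue_integral_def set_lebesgue_integral_def)
qed

lemma hankel_integral_recurrence:
  assumes "0 < a"
  shows "2 * hankel_integral (p + 1) a = - of_real p * hankel_integral (p - 1) a"
proof -
  have "(LINT y|lborel. hankel_kernel_deriv p (Complex a y))
      = 2 * hankel_integral (p + 1) a + of_real p * hankel_integral (p - 1) a"
    unfolding hankel_kernel_deriv_def hankel_integral_def
    by (subst Bochner_Integration.integral_add)
       (auto intro!: integrable_mult_right hankel_kernel_line_integrable assms)
  then show ?thesis
    using hankel_kernel_deriv_integral(2) [OF assms, of p] by (simp add: add_eq_0_iff)
qed

lemma integrable_prod_mult: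
  fixes f g :: "real \<Rightarrow> real"
  assumes f: "integrable lborel f" and g: "integrable lborel g"
  shows "integrable (lborel \<Otimes>\<^sub>M lborel) (\<lambda>(x, y). f x * g y)"
proof (rule lborel_pair.Fubini_integrable)
  have [measurable]: "f \<in> borel_measurable borel" "g \<in> borel_measurable borel"
    using f g by auto
  show "(\<lambda>(x, y). f x * g y) \<in> borel_measurable (lborel \<Otimes>\<^sub>M lborel)"
    by measurable
  show "integrable lborel (\<lambda>x. LINT y|lborel. norm (case (x, y) of (x, y) \<Rightarrow> f x * g y))"
    using f by (simp add: abs_mult)
  show "AE x in lborel. integrable lborel (\<lambda>y. case (x, y) of (x, y) \<Rightarrow> f x * g y)"
    using g by simp
qed

text \<open>
Instead of Cauchy's theorem: the difference of the two integrals is the integral of the derivative of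
the kernel over the strip between the lines, and by Fubini it can be computed along vertical lines
first, where it vanishes.
\<close>
lemma hankel_integral_indep:
  assumes "0 < a" "a \<le> b"
  shows "hankel_integral p a = hankel_integral p b"
proof -
  let ?f = "hankel_kernel_deriv p"
  let ?g = "\<lambda>x y. indicator {a..b} x *\<^sub>R ?f (Complex x y)"
  let ?B = "\<lambda>q. exp (b\<^sup>2 + \<bar>q\<bar> * (b + 1 / a))"
  let ?h = "\<lambda>y. 2 * (?B (p + 1) * exp (\<bar>p + 1\<bar> * \<bar>y\<bar> - y\<^sup>2))
                + \<bar>p\<bar> * (?B (p - 1) * exp (\<bar>p - 1\<bar> * \<bar>y\<bar> - y\<^sup>2))"
  have bound: "norm (?f (Complex x y)) \<le> ?h y" if "x \<in> {a..b}" for x y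
  proof -
    have "norm (?f (Complex x y)) \<le> 2 * norm (hankel_kernel (p + 1) (Complex x y))
        + \<bar>p\<bar> * norm (hankel_kernel (p - 1) (Complex x y))"
      unfolding hankel_kernel_deriv_def
      by (rule order_trans [OF norm_triangle_ineq]) (simp add: norm_mult)
    also have "\<dots> \<le> ?h y"
      using that norm_hankel_kernel_le [OF assms(1), of "Complex x y" b]
      by (intro add_mono mult_left_mono) auto
    finally show ?thesis .
  qed
  have cont: "continuous_on ({a..b} \<times> UNIV) (\<lambda>(x, y). ?f (Complex x y))"
    unfolding hankel_kernel_deriv_def split_beta
    by (intro continuous_intros continuous_on_compose2 [OF continuous_on_hankel_kernel])
       (use assms in \<open>auto intro!: continuous_intros\<close>)
  have meas: "(\<lambda>z. indicator ({a..b} \<times> UNIV) z *\<^sub>R (case z of (x, y) \<Rightarrow> ?f (Complex x y)))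
      \<in> borel_measurable borel"
    by (rule borel_measurable_continuous_on_indicator [OF _ cont])
       (auto intro!: borel_closed closed_Times)
  have eq: "(\<lambda>z. indicator ({a..b} \<times> UNIV) z *\<^sub>R (case z of (x, y) \<Rightarrow> ?f (Complex x y)))
      = (\<lambda>(x, y). ?g x y)"
    by (auto simp: indicator_def)
  have int: "integrable (lborel \<Otimes>\<^sub>M lborel) (\<lambda>(x, y). ?g x y)"
  proof (rule Bochner_Integration.integrable_bound)
    show "integrable (lborel \<Otimes>\<^sub>M lborel) (\<lambda>(x, y). indicator {a..b} x * ?h y)"
      by (intro integrable_prod_mult Bochner_Integration.integrable_add integrable_mult_right
           integrable_gauss_exp_abs) (auto intro!: integrable_real_indicator simp: emeasure_lborel_Icc_eq)
    show "(\<lambda>(x, y). ?g x y) \<in> borel_measurable (lborel \<Otimes>\<^sub>M lborel)"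
      using meas unfolding eq by (simp add: lborel_prod)
    show "AE z in lborel \<Otimes>\<^sub>M lborel. norm (case z of (x, y) \<Rightarrow> ?g x y)
        \<le> norm (case z of (x, y) \<Rightarrow> indicator {a..b} x * ?h y)"
      using order_trans [OF bound abs_ge_self] by (intro AE_I2) (auto simp: indicator_def)
  qed
  have inner: "(LINT x|lborel. ?g x y) = hankel_kernel p (Complex b y) - hankel_kernel p (Complex a y)"
    for y
  proof (rule integral_FTC_Icc)
    fix x assume x: "a \<le> x" "x \<le> b"
    have C: "((\<lambda>x. Complex x y) has_vector_derivative 1) (at x within {a..b})"
      unfolding Complex_eq by (auto intro!: derivative_eq_intros)
    have D: "(hankel_kernel p has_field_derivative ?f (Complex x y)) (at (Complex x y))"
      by (rule hankel_kernel_has_field_derivative) (use x assms in simp)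
    show "((\<lambda>x. hankel_kernel p (Complex x y)) has_vector_derivative ?f (Complex x y))
            (at x within {a..b})"
      using field_vector_diff_chain_within [OF C has_field_derivative_at_within [OF D]]
      by (simp add: o_def)
  next
    show "continuous_on {a..b} (\<lambda>x. ?f (Complex x y))"
      by (rule continuous_on_compose2 [OF cont, of "{a..b}" "\<lambda>x. (x, y)", simplified])
         (auto intro!: continuous_intros)
  qed (use assms in auto)
  have "0 = (LINT x|lborel. (LINT y|lborel. ?g x y))"
    using hankel_kernel_deriv_integral(2) assms
    by (intro Bochner_Integration.integral_eq_zero_AE [symmetric] AE_I2) (auto simp: indicator_def)
  also have "\<dots> = (LINT y|lborel. (LINT x|lborel. ?g x y))"
    by (rule lborel_pair.Fubini_integral [OF int, symmetric])
  also have "\<dots> = hankel_integral p b - hankel_integral p a"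
    unfolding inner hankel_integral_def
    by (intro Bochner_Integration.integral_diff hankel_kernel_line_integrable)
       (use assms in auto)
  finally show ?thesis by simp
qed

section \<open>The reciprocal Gamma function as an integral over a vertical line\<close>

lemma set_integrable_lborel_of_absolutely_integrable:
  fixes f :: "real \<Rightarrow> 'a::euclidean_space"
  assumes "set_borel_measurable borel S f" "f absolutely_integrable_on S"
  shows "set_integrable lborel S f" and "(LINT x:S|lborel. f x) = integral S f"
proof -
  have "(\<lambda>x. indicator S x *\<^sub>R f x) \<in> borel_measurable lborel"
    using assms(1) by (simp add: set_borel_measurable_def)
  then show *: "set_integrable lborel S f"
    using assms(2) by (simp add: set_integrable_def integrable_completion)
  show "(LINT x:S|lborel. f x) = integral S f"
    by (rule set_borel_integral_eq_integral(2) [OF *])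
qed

lemma Gamma_half_line_absolutely_integrable:
  fixes p :: real
  assumes "0 < p"
  shows "(\<lambda>u. u powr (p - 1) * exp (- u)) absolutely_integrable_on {0<..}"
    and "integral {0<..} (\<lambda>u. u powr (p - 1) * exp (- u)) = Gamma p"
proof -
  let ?f = "\<lambda>u::real. u powr (p - 1) * exp (- u)"
  have "(?f has_integral Gamma p) {0..}"
    using Gamma_integral_real [OF assms] by (simp add: exp_minus divide_inverse)
  then have *: "(?f has_integral Gamma p) {0<..}"
  proof (rule has_integral_spike_set_eq [THEN iffD1, rotated 2])
    show "negligible {x \<in> {0..} - {0<..}. ?f x \<noteq> 0}"
      by (rule negligible_subset [of "{0::real}"]) auto
    show "negligible {x \<in> {0<..} - {0..}. ?f x \<noteq> 0}"
      by (rule negligible_subset [of "{}"]) auto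
  qed
  then show "?f absolutely_integrable_on {0<..}"
    by (intro nonnegative_absolutely_integrable_1 has_integral_integrable) auto
  show "integral {0<..} ?f = Gamma p" using * by (rule integral_unique)
qed

lemma Gamma_half_line:
  assumes "0 < (p::real)"
  shows "set_integrable lborel {0<..} (\<lambda>u. u powr (p - 1) * exp (- u))"
    and "(LINT u:{0<..}|lborel. u powr (p - 1) * exp (- u)) = Gamma p"
proof -
  let ?f = "\<lambda>u::real. u powr (p - 1) * exp (- u)"
  have m: "set_borel_measurable borel {0<..} ?f"
    unfolding set_borel_measurable_def by measurable
  note abs = Gamma_half_line_absolutely_integrable [OF assms]
  show "set_integrable lborel {0<..} ?f"
    by (rule set_integrable_lborel_of_absolutely_integrable(1) [OF m abs(1)])
  show "(LINT u:{0<..}|lborel. ?f u) = Gamma p"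
    using set_integrable_lborel_of_absolutely_integrable(2) [OF m abs(1)] abs(2) by simp
qed

text \<open>
The substitution \<open>u = y\<^sup>2\<close> in Euler's integral.
\<close>
lemma half_line_gauss_power_integral:
  fixes p :: real
  assumes "p > -1"
  shows "set_integrable lborel {0<..} (\<lambda>y. exp (- y\<^sup>2) * y powr p)"
    and "(LINT y:{0<..}|lborel. exp (- y\<^sup>2) * y powr p) = Gamma ((p + 1) / 2) / 2"
proof -
  define f where "f = (\<lambda>u::real. u powr ((p + 1) / 2 - 1) * exp (- u))"
  have f: "f absolutely_integrable_on {0<..} \<and> integral {0<..} f = Gamma ((p + 1) / 2)"
    unfolding f_def using Gamma_half_line_absolutely_integrable [of "(p + 1) / 2"] assms by simp
  have "x \<in> (\<lambda>y::real. y\<^sup>2) ` {0<..}" if "x > 0" for x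
    by (rule image_eqI [of _ _ "sqrt x"]) (use that in auto)
  then have im: "(\<lambda>y::real. y\<^sup>2) ` {0<..} = {0<..}" by auto
  have inj: "inj_on (\<lambda>y::real. y\<^sup>2) {0<..}"
    by (auto simp: inj_on_def power2_eq_iff)
  have "(\<lambda>y. \<bar>2 * y\<bar> * f (y\<^sup>2)) absolutely_integrable_on {0<..} \<and>
      integral {0<..} (\<lambda>y. \<bar>2 * y\<bar> * f (y\<^sup>2)) = Gamma ((p + 1) / 2)"
  proof -
    have der: "((\<lambda>y. y\<^sup>2) has_real_derivative 2 * y) (at y within {0<..})" for y :: real
      by (auto intro!: derivative_eq_intros)
    show ?thesis
      using f by (subst has_absolute_integral_change_of_variables_1' [OF _ der inj, unfolded im]) auto
  qed
  note I = this
  have eq: "\<bar>2 * y\<bar> * f (y\<^sup>2) = 2 * (exp (- y\<^sup>2) * y powr p)" if "y \<in> {0<..}" for y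
  proof -
    have y: "y > 0" using that by simp
    then have "y\<^sup>2 = y powr 2" by simp
    moreover have "2 * ((p + 1) / 2 - 1) = p - 1" by (simp add: field_simps)
    ultimately have "(y\<^sup>2) powr ((p + 1) / 2 - 1) = y powr (p - 1)"
      by (simp only: powr_powr)
    also have "y * \<dots> = y powr p" using y by (simp add: powr_mult_base)
    finally show ?thesis using y by (simp add: f_def exp_minus field_simps)
  qed
  have 1: "(\<lambda>y. 2 * (exp (- y\<^sup>2) * y powr p)) absolutely_integrable_on {0<..}"
    and 2: "integral {0<..} (\<lambda>y. 2 * (exp (- y\<^sup>2) * y powr p)) = Gamma ((p + 1) / 2)"
  proof -
    have "(\<lambda>y. \<bar>2 * y\<bar> * f (y\<^sup>2)) absolutely_integrable_on {0<..}
      \<longleftrightarrow> (\<lambda>y. 2 * (exp (- y\<^sup>2) * y powr p)) absolutely_integrable_on {0<..}"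
      by (rule set_integrable_cong [OF refl refl eq])
    moreover have "integral {0<..} (\<lambda>y. \<bar>2 * y\<bar> * f (y\<^sup>2))
      = integral {0<..} (\<lambda>y. 2 * (exp (- y\<^sup>2) * y powr p))"
      by (rule Henstock_Kurzweil_Integration.integral_cong [OF eq])
    ultimately show "(\<lambda>y. 2 * (exp (- y\<^sup>2) * y powr p)) absolutely_integrable_on {0<..}"
      and "integral {0<..} (\<lambda>y. 2 * (exp (- y\<^sup>2) * y powr p)) = Gamma ((p + 1) / 2)"
      using I by simp_all
  qed
  have m: "set_borel_measurable borel {0<..} (\<lambda>y. exp (- y\<^sup>2) * y powr p)"
    unfolding set_borel_measurable_def by measurable
  have 3: "(\<lambda>y. exp (- y\<^sup>2) * y powr p) absolutely_integrable_on {0<..}"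
    using set_integrable_mult_right [of "1/2", OF 1] by simp
  show "set_integrable lborel {0<..} (\<lambda>y. exp (- y\<^sup>2) * y powr p)"
    by (rule set_integrable_lborel_of_absolutely_integrable(1) [OF m 3])
  have "(LINT y:{0<..}|lborel. exp (- y\<^sup>2) * y powr p)
      = integral {0<..} (\<lambda>y. exp (- y\<^sup>2) * y powr p)"
    by (rule set_integrable_lborel_of_absolutely_integrable(2) [OF m 3])
  then show "(LINT y:{0<..}|lborel. exp (- y\<^sup>2) * y powr p) = Gamma ((p + 1) / 2) / 2"
    using 2 by simp
qed

lemma hankel_kernel_imaginary_axis:
  assumes "y > 0"
  shows "hankel_kernel p (Complex 0 y) = exp (\<i> * of_real (pi * p / 2)) * of_real (exp (- y\<^sup>2) * y powr p)"
    and "hankel_kernel p (Complex 0 (- y)) = exp (- (\<i> * of_real (pi * p / 2))) * of_real (exp (- y\<^sup>2) * y powr p)"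
proof -
  have C: "Complex 0 y = of_real y * \<i>" "Complex 0 (- y) = of_real y * (- \<i>)"
    by (simp_all add: complex_eq_iff)
  have "Ln (of_real y * \<i>) = of_real (ln y) + \<i> * of_real pi / 2"
    "Ln (of_real y * (- \<i>)) = of_real (ln y) - \<i> * of_real pi / 2"
    using Ln_times_of_real [OF assms, of "\<i>"] Ln_times_of_real [OF assms, of "-\<i>"] assms
    by (simp_all add: Ln_of_real)
  then have L: "Ln (Complex 0 y) = of_real (ln y) + \<i> * of_real pi / 2"
    "Ln (Complex 0 (- y)) = of_real (ln y) - \<i> * of_real pi / 2"
    unfolding C .
  have sq: "(Complex 0 y)\<^sup>2 = of_real (- y\<^sup>2)" "(Complex 0 (- y))\<^sup>2 = of_real (- y\<^sup>2)"
    by (simp_all add: complex_eq_iff power2_eq_square)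
  have nz: "Complex 0 y \<noteq> 0" "Complex 0 (- y) \<noteq> 0" using assms by (simp_all add: complex_eq_iff)
  show "hankel_kernel p (Complex 0 y) = exp (\<i> * of_real (pi * p / 2)) * of_real (exp (- y\<^sup>2) * y powr p)"
    unfolding hankel_kernel_def powr_def sq L using assms nz
    by (simp add: exp_of_real [symmetric] exp_add [symmetric] algebra_simps)
  show "hankel_kernel p (Complex 0 (- y)) = exp (- (\<i> * of_real (pi * p / 2))) * of_real (exp (- y\<^sup>2) * y powr p)"
    unfolding hankel_kernel_def powr_def sq L using assms nz
    by (simp add: exp_of_real [symmetric] exp_add [symmetric] algebra_simps)
qed

lemma hankel_kernel_imaginary_axis_measurable:
  "(\<lambda>y. hankel_kernel p (Complex 0 y)) \<in> borel_measurable borel"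
proof (rule borel_measurable_continuous_countable_exceptions)
  show "continuous_on (- {0}) (\<lambda>y. hankel_kernel p (Complex 0 y))"
    unfolding hankel_kernel_def
    by (intro continuous_intros) (auto simp: complex_nonpos_Reals_iff complex_eq_iff)
qed simp

lemma rGamma_reflection_real: "rGamma x * rGamma (1 - x) = sin (pi * x) / (pi :: real)"
proof -
  have "complex_of_real (rGamma x * rGamma (1 - x)) = rGamma (of_real x) * rGamma (1 - of_real x)"
    by (simp flip: rGamma_complex_of_real)
  also have "\<dots> = sin (of_real pi * of_real x) / of_real pi"
    by (rule rGamma_reflection_complex)
  also have "\<dots> = of_real (sin (pi * x) / pi)"
    by (simp flip: sin_of_real)
  finally show ?thesis by (simp only: of_real_eq_iff)
qed

text \<open>
On the imaginary axis the two half lines contribute conjugate phases, so the integral is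
\<open>cos (\<pi> p / 2) \<Gamma> ((p + 1) / 2)\<close>, and the reflection formula turns this into a reciprocal Gamma
value.
\<close>
lemma hankel_integral_imaginary_axis:
  assumes "p \<ge> 0"
  shows "(LINT y|lborel. hankel_kernel p (Complex 0 y)) = of_real (pi * rGamma ((1 - p) / 2))"
proof -
  define j where "j = (\<lambda>y::real. indicator {0<..} y *\<^sub>R (exp (- y\<^sup>2) * y powr p))"
  have j: "has_bochner_integral lborel j (Gamma ((p + 1) / 2) / 2)"
    using half_line_gauss_power_integral [of p] assms
    by (simp add: has_bochner_integral_iff j_def set_integrable_def set_lebesgue_integral_def)
  then have j': "has_bochner_integral lborel (\<lambda>y. j (- y)) (Gamma ((p + 1) / 2) / 2)"
    using lborel_has_bochner_integral_real_affine_iff [of "-1" j _ 0] by simp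
  let ?e = "exp (\<i> * of_real (pi * p / 2))" and ?e' = "exp (- (\<i> * of_real (pi * p / 2)))"
  have "has_bochner_integral lborel (\<lambda>y. ?e * of_real (j y) + ?e' * of_real (j (- y)))
      (?e * of_real (Gamma ((p + 1) / 2) / 2) + ?e' * of_real (Gamma ((p + 1) / 2) / 2))"
    by (intro has_bochner_integral_add has_bochner_integral_mult_right has_bochner_integral_of_real j j')
  then have "(LINT y|lborel. ?e * of_real (j y) + ?e' * of_real (j (- y)))
      = (?e + ?e') * of_real (Gamma ((p + 1) / 2) / 2)"
    by (simp add: has_bochner_integral_iff distrib_right)
  moreover have "(LINT y|lborel. hankel_kernel p (Complex 0 y))
      = (LINT y|lborel. ?e * of_real (j y) + ?e' * of_real (j (- y)))"
  proof (rule integral_cong_AE)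
    have "AE y in lborel. y \<noteq> (0::real)" by (rule AE_lborel_singleton)
    then show "AE y in lborel. hankel_kernel p (Complex 0 y) = ?e * of_real (j y) + ?e' * of_real (j (- y))"
    proof eventually_elim
      case (elim y)
      then show ?case
        using hankel_kernel_imaginary_axis(1) [of y p] hankel_kernel_imaginary_axis(2) [of "- y" p]
        by (cases "y > 0") (auto simp: j_def)
    qed
    show "(\<lambda>y. hankel_kernel p (Complex 0 y)) \<in> borel_measurable lborel"
      using hankel_kernel_imaginary_axis_measurable by simp
    show "(\<lambda>y. ?e * of_real (j y) + ?e' * of_real (j (- y))) \<in> borel_measurable lborel"
      unfolding j_def by measurable
  qed
  moreover have "?e + ?e' = 2 * of_real (cos (pi * p / 2))"
    by (simp add: cos_of_real [symmetric] cos_exp_eq)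
  moreover have "cos (pi * p / 2) * Gamma ((p + 1) / 2) = pi * rGamma ((1 - p) / 2)"
  proof -
    have "rGamma ((1 - p) / 2) * rGamma (1 - (1 - p) / 2) = sin (pi * ((1 - p) / 2)) / pi"
      by (rule rGamma_reflection_real)
    also have "pi * ((1 - p) / 2) = pi / 2 - pi * p / 2" by (simp add: field_simps)
    also have "sin \<dots> = cos (pi * p / 2)" by (simp add: sin_diff)
    also have "1 - (1 - p) / 2 = (p + 1) / 2" by (simp add: field_simps)
    finally have *: "rGamma ((1 - p) / 2) * rGamma ((p + 1) / 2) = cos (pi * p / 2) / pi" .
    have "Gamma ((p + 1) / 2) > 0" using assms by (intro Gamma_real_pos) simp
    then have "rGamma ((p + 1) / 2) * Gamma ((p + 1) / 2) = 1"
      by (simp add: rGamma_inverse_Gamma)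
    then have "rGamma ((1 - p) / 2) = cos (pi * p / 2) / pi * Gamma ((p + 1) / 2)"
      by (metis * mult.assoc mult.right_neutral)
    then show ?thesis by simp
  qed
  ultimately show ?thesis
    by (simp add: of_real_mult [symmetric] del: of_real_mult)
qed

text \<open>
The value does not depend on the line, and for \<open>p \<ge> 0\<close> the kernel stays bounded near the origin, so
the line may be pushed onto the imaginary axis by dominated convergence.
\<close>
lemma hankel_integral_nonneg_exponent:
  assumes "p \<ge> 0" "a > 0"
  shows "hankel_integral p a = of_real (pi * rGamma ((1 - p) / 2))"
proof -
  let ?s = "\<lambda>n y. hankel_kernel p (Complex (a / (real n + 1)) y)"
  have pos: "a / (real n + 1) > 0" "a / (real n + 1) \<le> a" for n
    using assms by (auto simp: field_simps)
  have "(\<lambda>n. LINT y|lborel. ?s n y) \<longlonglongrightarrow> (LINT y|lborel. hankel_kernel p (Complex 0 y))"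
  proof (rule integral_dominated_convergence)
    show "integrable lborel (\<lambda>y. exp (a\<^sup>2 + p * a) * exp (p * \<bar>y\<bar> - y\<^sup>2))"
      by (intro integrable_mult_right integrable_gauss_exp_abs)
    show "AE y in lborel. (\<lambda>n. ?s n y) \<longlonglongrightarrow> hankel_kernel p (Complex 0 y)"
      using AE_lborel_singleton [of "0::real"]
    proof eventually_elim
      case (elim y)
      then have "isCont (hankel_kernel p) (Complex 0 y)"
        unfolding hankel_kernel_def
        by (intro continuous_intros) (auto simp: complex_nonpos_Reals_iff)
      moreover have "(\<lambda>n. Complex (a / (real n + 1)) y) \<longlonglongrightarrow> Complex 0 y"
        unfolding tendsto_complex_iff by (simp, real_asymp)
      ultimately show ?case by (rule isCont_tendsto_compose)
    qed
    show "AE y in lborel. norm (?s n y) \<le> exp (a\<^sup>2 + p * a) * exp (p * \<bar>y\<bar> - y\<^sup>2)" for n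
    proof (rule AE_I2)
      fix y :: real
      let ?w = "Complex (a / (real n + 1)) y"
      have w: "norm ?w > 0" using assms by (auto simp: complex_eq_iff)
      have le: "norm ?w \<le> a + \<bar>y\<bar>" using cmod_le [of ?w] pos [of n] by simp
      have "ln (norm ?w) \<le> norm ?w" using ln_le_minus_one [OF w] by simp
      also note le
      finally have "norm ?w powr p \<le> exp (p * (a + \<bar>y\<bar>))"
        using w assms by (auto simp: powr_def intro!: mult_left_mono)
      moreover have "(a / (real n + 1))\<^sup>2 \<le> a\<^sup>2"
        using pos [of n] by (intro power_mono) auto
      then have "norm (exp (?w\<^sup>2)) \<le> exp (a\<^sup>2 - y\<^sup>2)" by (simp add: norm_exp_square del: norm_exp_eq_Re)
      ultimately have "norm (exp (?w\<^sup>2)) * norm ?w powr p \<le> exp (a\<^sup>2 - y\<^sup>2) * exp (p * (a + \<bar>y\<bar>))"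
        by (intro mult_mono) auto
      then show "norm (?s n y) \<le> exp (a\<^sup>2 + p * a) * exp (p * \<bar>y\<bar> - y\<^sup>2)"
        by (simp add: hankel_kernel_def norm_mult norm_powr_of_real exp_add [symmetric] algebra_simps
              del: norm_exp_eq_Re)
    qed
    show "(\<lambda>y. hankel_kernel p (Complex 0 y)) \<in> borel_measurable lborel"
      using hankel_kernel_imaginary_axis_measurable by simp
    show "?s n \<in> borel_measurable lborel" for n
      using hankel_kernel_line_measurable [OF pos(1)] by simp
  qed
  moreover have "(LINT y|lborel. ?s n y) = hankel_integral p a" for n
    using hankel_integral_indep [OF pos(1) [of n] pos(2) [of n], of p] by (simp add: hankel_integral_def)
  ultimately have "(\<lambda>n::nat. hankel_integral p a) \<longlonglongrightarrow> of_real (pi * rGamma ((1 - p) / 2))"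
    by (simp only: hankel_integral_imaginary_axis [OF assms(1)])
  then show ?thesis by (simp add: LIMSEQ_const_iff)
qed

text \<open>
The recurrences of the integral and of \<open>1/\<Gamma>\<close> coincide.  They carry the formula from \<open>p + 2\<close> down to
\<open>p\<close>, except at \<open>p = -1\<close>, where the coefficient vanishes.
\<close>
lemma hankel_integral_step:
  assumes "a > 0" "p \<noteq> -1" "hankel_integral (p + 2) a = of_real (pi * rGamma ((1 - (p + 2)) / 2))"
  shows "hankel_integral p a = of_real (pi * rGamma ((1 - p) / 2))"
proof -
  define z where "z = - (p + 1) / 2"
  have "2 * hankel_integral (p + 2) a = - of_real (p + 1) * hankel_integral p a"
    using hankel_integral_recurrence [OF assms(1), of "p + 1"] by (simp add: add.commute add.left_commute)
  then have "hankel_integral (p + 2) a = of_real z * hankel_integral p a"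
    by (simp add: z_def field_simps)
  moreover have "hankel_integral (p + 2) a = of_real (pi * (z * rGamma (z + 1)))"
  proof -
    have "(1 - (p + 2)) / 2 = z" by (simp add: z_def field_simps)
    then show ?thesis using assms(3) by (simp only: rGamma_plus1)
  qed
  moreover have "z \<noteq> 0" "z + 1 = (1 - p) / 2" using assms(2) by (auto simp: z_def field_simps)
  ultimately show ?thesis by simp
qed

text \<open>
The exponent that the recurrence cannot reach follows from its neighbours by continuity in \<open>p\<close>.
\<close>
lemma hankel_integral_minus_one:
  assumes "a > 0"
  shows "hankel_integral (-1) a = of_real (pi * rGamma ((1 - (-1)) / 2))"
proof -
  \<comment> \<open>exponents at which the recurrence works, since \<open>p + 2 \<ge> 0\<close> and \<open>p \<noteq> -1\<close>\<close>
  let ?r = "\<lambda>n. - 1 + 1 / (real n + 1)"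
  have r: "\<bar>?r n\<bar> \<le> 1" "?r n \<noteq> -1" "?r n + 2 \<ge> 0" for n by (auto simp: field_simps abs_le_iff)
  have lim: "?r \<longlonglongrightarrow> -1" by real_asymp
  have val: "hankel_integral (?r n) a = of_real (pi * rGamma ((1 - ?r n) / 2))" for n
    by (rule hankel_integral_step [OF assms r(2) hankel_integral_nonneg_exponent [OF r(3) assms]])
  have "(\<lambda>n. hankel_integral (?r n) a) \<longlonglongrightarrow> hankel_integral (-1) a"
    unfolding hankel_integral_def
  proof (rule integral_dominated_convergence)
    show "integrable lborel (\<lambda>y. exp (a\<^sup>2 + 1 * (a + 1 / a)) * exp (1 * \<bar>y\<bar> - y\<^sup>2))"
      by (intro integrable_mult_right integrable_gauss_exp_abs)
    show "AE y in lborel. (\<lambda>n. hankel_kernel (?r n) (Complex a y)) \<longlonglongrightarrow> hankel_kernel (-1) (Complex a y)"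
      unfolding hankel_kernel_def using assms
      by (intro AE_I2 tendsto_intros lim) (auto simp: complex_eq_iff complex_nonpos_Reals_iff)
    show "AE y in lborel. norm (hankel_kernel (?r n) (Complex a y))
        \<le> exp (a\<^sup>2 + 1 * (a + 1 / a)) * exp (1 * \<bar>y\<bar> - y\<^sup>2)" for n
    proof (rule AE_I2)
      fix y :: real
      have "norm (hankel_kernel (?r n) (Complex a y))
          \<le> exp (a\<^sup>2 + \<bar>?r n\<bar> * (a + 1 / a)) * exp (\<bar>?r n\<bar> * \<bar>y\<bar> - y\<^sup>2)"
        using norm_hankel_kernel_le [OF assms, of "Complex a y" a "?r n"] by simp
      also have "\<dots> \<le> exp (a\<^sup>2 + 1 * (a + 1 / a)) * exp (1 * \<bar>y\<bar> - y\<^sup>2)"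
        using r(1) [of n] assms
        by (intro mult_mono exp_le_cancel_iff [THEN iffD2] add_mono diff_mono mult_right_mono) auto
      finally show "norm (hankel_kernel (?r n) (Complex a y)) \<le> \<dots>" .
    qed
  qed (use hankel_kernel_line_measurable [OF assms] in auto)
  moreover have "(\<lambda>n. hankel_integral (?r n) a) \<longlonglongrightarrow> of_real (pi * rGamma ((1 - (-1)) / 2))"
    unfolding val
    by (intro tendsto_intros lim continuous_on_tendsto_compose [OF continuous_on_rGamma [of UNIV]])
       simp_all
  ultimately show ?thesis by (rule LIMSEQ_unique)
qed

theorem hankel_integral_eq_rGamma:
  assumes "a > 0"
  shows "hankel_integral p a = of_real (pi * rGamma ((1 - p) / 2))"
proof -
  have "hankel_integral p a = of_real (pi * rGamma ((1 - p) / 2))" if "p \<ge> - 2 * real n" for n p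
    using that
  proof (induction n arbitrary: p)
    case 0
    then show ?case using hankel_integral_nonneg_exponent assms by simp
  next
    case (Suc n)
    show ?case
    proof (cases "p = -1")
      case True
      then show ?thesis using hankel_integral_minus_one [OF assms] by simp
    next
      case False
      show ?thesis
        by (rule hankel_integral_step [OF assms False Suc.IH]) (use Suc.prems in simp)
    qed
  qed
  moreover obtain n :: nat where "- p / 2 \<le> real n" using real_arch_simple by blast
  ultimately show ?thesis by (metis mult_minus_left minus_le_iff divide_le_eq_numeral1(1) mult.commute)
qed

section \<open>The Wright function of a half line\<close>

text \<open>
Dominated convergence for partial sums; it only asks for a majorant of the partial sums, which is
what exponential and geometric series provide directly.
\<close>
lemma integral_sums_dominated:
  fixes f :: "nat \<Rightarrow> 'a \<Rightarrow> 'b::{banach, second_countable_topology}"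
  assumes f: "\<And>n. integrable M (f n)" and F: "F \<in> borel_measurable M" and g: "integrable M g"
    and sums: "AE x in M. (\<lambda>n. f n x) sums F x"
    and bound: "\<And>n. AE x in M. norm (\<Sum>k<n. f k x) \<le> g x"
  shows "integrable M F" and "(\<lambda>n. integral\<^sup>L M (f n)) sums integral\<^sup>L M F"
proof -
  have m: "(\<lambda>x. \<Sum>k<n. f k x) \<in> borel_measurable M" for n
    using f by (intro borel_measurable_sum) auto
  have l: "AE x in M. (\<lambda>n. \<Sum>k<n. f k x) \<longlonglongrightarrow> F x"
    using sums by (simp add: sums_def)
  show "integrable M F" by (rule integrable_dominated_convergence [OF F m g l bound])
  have "(\<lambda>n. integral\<^sup>L M (\<lambda>x. \<Sum>k<n. f k x)) \<longlonglongrightarrow> integral\<^sup>L M F"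
    by (rule integral_dominated_convergence [OF F m g l bound])
  then show "(\<lambda>n. integral\<^sup>L M (f n)) sums integral\<^sup>L M F"
    unfolding sums_def by (subst (asm) Bochner_Integration.integral_sum) (auto intro: f)
qed

lemma hankel_kernel_mult_powr_power:
  fixes w :: complex
  assumes "w \<noteq> 0"
  shows "hankel_kernel p w * (w powr of_real q) ^ n = hankel_kernel (p + q * real n) w"
proof -
  have "(w powr of_real q) ^ n = w powr of_real (q * real n)"
    using assms by (simp add: powr_def exp_of_nat_mult [symmetric] algebra_simps)
  then show ?thesis using assms by (simp add: hankel_kernel_def powr_add)
qed

text \<open>
The sum of the kernels \<open>(- z)\<^sup>n / n!\<close> times \<open>hankel_kernel (\<alpha> - 1 + \<alpha> n)\<close>, which are the integrands
belonging to the terms of the Wright series.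
\<close>
definition wright_kernel :: "real \<Rightarrow> real \<Rightarrow> complex \<Rightarrow> complex" where
  "wright_kernel \<alpha> z w = hankel_kernel (\<alpha> - 1) w * exp (- (of_real z * w powr of_real \<alpha>))"

lemma continuous_on_powr_right_half_plane:
  "continuous_on {w. 0 < Re w} (\<lambda>w. w powr of_real (p::real))"
  by (intro continuous_intros) (auto simp: Re_pos_notin_nonpos_Reals)

lemma continuous_on_wright_kernel:
  "continuous_on (UNIV \<times> {w. 0 < Re w}) (\<lambda>(z, w). wright_kernel \<alpha> z w)"
  unfolding wright_kernel_def split_beta
  by (intro continuous_intros continuous_on_compose2 [OF continuous_on_hankel_kernel]
        continuous_on_compose2 [OF continuous_on_powr_right_half_plane]) auto

lemma wright_kernel_measurable:
  assumes "0 < a"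
  shows "(\<lambda>(z, y). wright_kernel \<alpha> z (Complex a y)) \<in> borel_measurable borel"
proof (rule borel_measurable_continuous_onI)
  have "continuous_on UNIV (\<lambda>x. (\<lambda>(z, w). wright_kernel \<alpha> z w) (fst x, Complex a (snd x)))"
    by (rule continuous_on_compose2 [OF continuous_on_wright_kernel])
       (use assms in \<open>auto intro!: continuous_intros\<close>)
  then show "continuous_on UNIV (\<lambda>(z, y). wright_kernel \<alpha> z (Complex a y))"
    by (simp add: split_beta)
qed

lemma wright_kernel_line_measurable:
  assumes "0 < a"
  shows "(\<lambda>y. wright_kernel \<alpha> z (Complex a y)) \<in> borel_measurable borel"
  using measurable_compose [OF _ wright_kernel_measurable [OF assms], of "\<lambda>y. (z, y)" borel \<alpha>]
  by (simp add: borel_prod [symmetric])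

lemma powr_le_one_plus:
  fixes x \<alpha> :: real
  assumes "0 \<le> x" "0 < \<alpha>" "\<alpha> < 1"
  shows "x powr \<alpha> \<le> 1 + x"
proof (cases "x \<le> 1")
  case True
  then show ?thesis using assms powr_mono2 [of \<alpha> x 1] by simp
next
  case False
  then show ?thesis using assms powr_mono [of \<alpha> 1 x] by simp
qed

text \<open>
Each reciprocal Gamma value in the Wright series is replaced by its line integral; the sum may be
taken under the integral because \<open>\<bar>w\<bar>\<^sup>\<alpha> \<le> 1 + \<bar>w\<bar>\<close>, so that even the series of absolute values is
dominated by a Gaussian.
\<close>
lemma wright_hankel_integral:
  assumes "0 < a" "0 < \<alpha>" "\<alpha> < 1"
  shows "integrable lborel (\<lambda>y. wright_kernel \<alpha> z (Complex a y))"
    and "(LINT y|lborel. wright_kernel \<alpha> z (Complex a y))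
           = of_real (pi * wright (- \<alpha> / 2) (1 - \<alpha> / 2) (- z))"
proof -
  let ?w = "Complex a"
  let ?f = "\<lambda>n y. of_real ((- z) ^ n / fact n) * hankel_kernel (\<alpha> - 1 + \<alpha> * real n) (?w y)"
  let ?C = "exp (a\<^sup>2 + \<bar>\<alpha> - 1\<bar> * (a + 1 / a)) * exp (\<bar>z\<bar> * (1 + a))"
  let ?g = "\<lambda>y. ?C * exp ((\<bar>\<alpha> - 1\<bar> + \<bar>z\<bar>) * \<bar>y\<bar> - y\<^sup>2)"
  have nz: "?w y \<noteq> 0" for y using assms by (auto simp: complex_eq_iff)
  have f: "?f n y = hankel_kernel (\<alpha> - 1) (?w y) * ((- (of_real z * ?w y powr of_real \<alpha>)) ^ n /\<^sub>R fact n)"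
    for n y
  proof -
    have "(- (of_real z * ?w y powr of_real \<alpha>)) ^ n = of_real ((- z) ^ n) * (?w y powr of_real \<alpha>) ^ n"
      by (simp flip: power_mult_distrib)
    then show ?thesis
      unfolding hankel_kernel_mult_powr_power [OF nz, symmetric] by (simp add: scaleR_conv_of_real field_simps)
  qed
  have sums: "(\<lambda>n. ?f n y) sums wright_kernel \<alpha> z (?w y)" for y
    unfolding f wright_kernel_def by (intro sums_mult exp_converges)
  have bound: "norm (\<Sum>k<n. ?f k y) \<le> ?g y" for n y
  proof -
    let ?x = "norm (of_real z * ?w y powr of_real \<alpha>)"
    have "norm (\<Sum>k<n. ?f k y) \<le> (\<Sum>k<n. norm (hankel_kernel (\<alpha> - 1) (?w y)) * (?x ^ k /\<^sub>R fact k))"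
      unfolding f by (rule order_trans [OF norm_sum], rule sum_mono)
        (simp add: norm_mult norm_power power_mult_distrib)
    also have "\<dots> = norm (hankel_kernel (\<alpha> - 1) (?w y)) * (\<Sum>k<n. ?x ^ k /\<^sub>R fact k)"
      by (simp add: sum_distrib_left)
    also have "(\<Sum>k<n. ?x ^ k /\<^sub>R fact k) \<le> exp ?x"
      unfolding exp_def by (rule sum_le_suminf [OF summable_exp_generic]) simp_all
    also have "exp ?x \<le> exp (\<bar>z\<bar> * (1 + (a + \<bar>y\<bar>)))"
    proof -
      have "norm (?w y) powr \<alpha> \<le> 1 + norm (?w y)"
        using assms by (intro powr_le_one_plus) auto
      also have "\<dots> \<le> 1 + (a + \<bar>y\<bar>)" using cmod_le [of "?w y"] assms by simp
      finally show ?thesis by (auto simp: norm_mult norm_powr_of_real intro!: mult_left_mono)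
    qed
    also have "norm (hankel_kernel (\<alpha> - 1) (?w y))
        \<le> exp (a\<^sup>2 + \<bar>\<alpha> - 1\<bar> * (a + 1 / a)) * exp (\<bar>\<alpha> - 1\<bar> * \<bar>y\<bar> - y\<^sup>2)"
      using norm_hankel_kernel_le [of a "?w y" a "\<alpha> - 1"] assms by simp
    finally show ?thesis
      by (simp add: exp_add [symmetric] algebra_simps mult_left_mono mult_right_mono)
  qed
  have int: "integrable lborel (?f n)" for n
    using assms by (intro integrable_mult_right hankel_kernel_line_integrable)
  have g: "integrable lborel ?g"
    by (intro integrable_mult_right integrable_gauss_exp_abs)
  have m: "(\<lambda>y. wright_kernel \<alpha> z (?w y)) \<in> borel_measurable lborel"
    using wright_kernel_line_measurable [OF assms(1)] by simp
  note * = integral_sums_dominated [OF int m g AE_I2 [OF sums] AE_I2 [OF bound]]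
  show "integrable lborel (\<lambda>y. wright_kernel \<alpha> z (Complex a y))" by (rule *(1))
  have "integral\<^sup>L lborel (?f n) = of_real (pi * ((- z) ^ n / fact n * rGamma (- \<alpha> / 2 * real n + (1 - \<alpha> / 2))))"
    for n
  proof -
    have "(1 - (\<alpha> - 1 + \<alpha> * real n)) / 2 = - \<alpha> / 2 * real n + (1 - \<alpha> / 2)"
      by (simp add: field_simps)
    then have "hankel_integral (\<alpha> - 1 + \<alpha> * real n) a = of_real (pi * rGamma (- \<alpha> / 2 * real n + (1 - \<alpha> / 2)))"
      by (simp only: hankel_integral_eq_rGamma [OF assms(1)])
    moreover have "integral\<^sup>L lborel (?f n) = of_real ((- z) ^ n / fact n) * hankel_integral (\<alpha> - 1 + \<alpha> * real n) a"
      unfolding hankel_integral_def by (rule integral_mult_right_zero)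
    ultimately show ?thesis by (simp only: of_real_mult mult_ac)
  qed
  then have s: "(\<lambda>n. complex_of_real (pi * ((- z) ^ n / fact n * rGamma (- \<alpha> / 2 * real n + (1 - \<alpha> / 2)))))
      sums (LINT y|lborel. wright_kernel \<alpha> z (Complex a y))"
    using *(2) by (simp only:)
  \<comment> \<open>the series has real terms, so the complex integral is real\<close>
  define r where "r = Re (LINT y|lborel. wright_kernel \<alpha> z (Complex a y))"
  have "(\<lambda>n. 0 :: real) sums Im (LINT y|lborel. wright_kernel \<alpha> z (Complex a y))"
    using sums_Im [OF s] by (simp only: Im_complex_of_real)
  then have "Im (LINT y|lborel. wright_kernel \<alpha> z (Complex a y)) = 0"
    using sums_unique2 [OF _ sums_0] by blast
  then have r: "(LINT y|lborel. wright_kernel \<alpha> z (Complex a y)) = of_real r"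
    by (simp add: r_def complex_eq_iff)
  have "(\<lambda>n. pi * ((- z) ^ n / fact n * rGamma (- \<alpha> / 2 * real n + (1 - \<alpha> / 2)))) sums r"
    using s unfolding r by (simp only: sums_of_real_iff)
  then have "r = pi * wright (- \<alpha> / 2) (1 - \<alpha> / 2) (- z)"
    unfolding wright_def
    using sums_mult_iff [of pi "\<lambda>n. (- z) ^ n / fact n * rGamma (- \<alpha> / 2 * real n + (1 - \<alpha> / 2))" "r / pi"]
    by (simp add: sums_iff)
  then show "(LINT y|lborel. wright_kernel \<alpha> z (Complex a y))
      = of_real (pi * wright (- \<alpha> / 2) (1 - \<alpha> / 2) (- z))"
    using r by simp
qed

text \<open>
In the right half plane the argument of \<open>w\<close> is below \<open>\<pi>/2\<close> in absolute value, hence that of \<open>w\<^sup>\<alpha>\<close> is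
below \<open>\<alpha> \<pi> / 2 < \<pi> / 2\<close>.  This is where \<open>\<alpha> < 1\<close> produces the exponential decay of the Wright function.
\<close>
lemma Re_powr_ge:
  assumes "0 < a" "a \<le> Re w" "0 < \<alpha>" "\<alpha> < 1"
  shows "a powr \<alpha> * cos (\<alpha> * pi / 2) \<le> Re (w powr of_real \<alpha>)"
proof -
  have w: "w \<noteq> 0" "0 < Re w" using assms by auto
  have "\<bar>Im (Ln w)\<bar> < pi / 2" by (rule Re_Ln_pos_lt_imp [OF w(2)])
  then have "\<alpha> * \<bar>Im (Ln w)\<bar> \<le> \<alpha> * (pi / 2)"
    using assms by (intro mult_left_mono) auto
  moreover have "\<alpha> * (pi / 2) \<le> 1 * (pi / 2)" using assms by (intro mult_right_mono) auto
  ultimately have "cos (\<alpha> * (pi / 2)) \<le> cos (\<alpha> * \<bar>Im (Ln w)\<bar>)"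
    using assms pi_ge_zero by (intro cos_monotone_0_pi_le) (auto simp del: pi_ge_zero)
  also have "\<alpha> * \<bar>Im (Ln w)\<bar> = \<bar>\<alpha> * Im (Ln w)\<bar>" using assms by (simp add: abs_mult)
  also have "cos \<dots> = cos (\<alpha> * Im (Ln w))" by (rule cos_abs_real)
  finally have c: "cos (\<alpha> * (pi / 2)) \<le> cos (\<alpha> * Im (Ln w))" .
  have "0 \<le> cos (\<alpha> * (pi / 2))"
    using assms \<open>\<alpha> * (pi / 2) \<le> 1 * (pi / 2)\<close> pi_ge_zero
    by (intro cos_ge_zero) (auto intro: order_trans [of _ 0])
  moreover have "a powr \<alpha> \<le> norm w powr \<alpha>"
    using assms complex_Re_le_cmod [of w] by (intro powr_mono2) auto
  ultimately have "a powr \<alpha> * cos (\<alpha> * (pi / 2)) \<le> norm w powr \<alpha> * cos (\<alpha> * Im (Ln w))"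
    using c by (intro mult_mono) auto
  also have "\<dots> = Re (w powr of_real \<alpha>)"
    using w by (simp add: powr_def Re_exp Re_Ln)
  finally show ?thesis by simp
qed

lemma norm_wright_kernel_le:
  assumes "0 < a" "0 < \<alpha>" "\<alpha> < 1" "0 \<le> z"
  shows "norm (wright_kernel \<alpha> z (Complex a y))
    \<le> exp (- (a powr \<alpha> * cos (\<alpha> * pi / 2)) * z)
        * (exp (a\<^sup>2 + \<bar>\<alpha> - 1\<bar> * (a + 1 / a)) * exp (\<bar>\<alpha> - 1\<bar> * \<bar>y\<bar> - y\<^sup>2))"
proof -
  have "z * (a powr \<alpha> * cos (\<alpha> * pi / 2)) \<le> z * Re (Complex a y powr of_real \<alpha>)"
    using assms by (intro mult_left_mono Re_powr_ge) auto
  then have "norm (exp (- (of_real z * Complex a y powr of_real \<alpha>))) \<le> exp (- (a powr \<alpha> * cos (\<alpha> * pi / 2)) * z)"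
    by (simp add: mult.commute)
  moreover have "norm (hankel_kernel (\<alpha> - 1) (Complex a y))
        \<le> exp (a\<^sup>2 + \<bar>\<alpha> - 1\<bar> * (a + 1 / a)) * exp (\<bar>\<alpha> - 1\<bar> * \<bar>y\<bar> - y\<^sup>2)"
    using norm_hankel_kernel_le [of a "Complex a y" a "\<alpha> - 1"] assms by simp
  ultimately show ?thesis
    unfolding wright_kernel_def norm_mult by (subst mult.commute) (intro mult_mono, auto)
qed

lemma half_line_exp_integral:
  assumes "0 < Re q"
  shows "set_integrable lborel {0<..} (\<lambda>x. exp (- (q * of_real x)))"
    and "(LINT x:{0<..}|lborel. exp (- (q * of_real x))) = 1 / q"
proof -
  have E: "einterval 0 \<infinity> = {0<..}" by (auto simp: einterval_def)
  have lim: "((\<lambda>x. exp (- (r * x))) \<longlongrightarrow> 0) at_top" if "r > 0" for r :: real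
    using that by real_asymp
  have "set_integrable lborel (einterval 0 \<infinity>) (\<lambda>x. exp (- (Re q * x)))"
  proof (rule interval_integral_FTC_nonneg(1) [of _ _ "\<lambda>x. - exp (- (Re q * x)) / Re q" _ "- 1 / Re q" 0])
    show "((\<lambda>x. - exp (- (Re q * x)) / Re q) has_real_derivative exp (- (Re q * x))) (at x)" for x
      using assms by (auto intro!: derivative_eq_intros)
    have "((\<lambda>x. - exp (- (Re q * x)) / Re q) \<longlongrightarrow> - exp (- (Re q * 0)) / Re q) (at_right 0)"
      using assms by (intro tendsto_intros) auto
    then show "((((\<lambda>x. - exp (- (Re q * x)) / Re q)) \<circ> real_of_ereal) \<longlongrightarrow> - 1 / Re q) (at_right 0)"
      by (simp add: zero_ereal_def ereal_tendsto_simps)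
    have "((\<lambda>x. - exp (- (Re q * x)) / Re q) \<longlongrightarrow> - 0 / Re q) at_top"
      using assms by (intro tendsto_intros lim) auto
    then show "((((\<lambda>x. - exp (- (Re q * x)) / Re q)) \<circ> real_of_ereal) \<longlongrightarrow> 0) (at_left \<infinity>)"
      by (simp add: ereal_tendsto_simps)
  qed auto
  then have "set_integrable lborel {0<..} (\<lambda>x. exp (- (Re q * x)))" by (simp only: E)
  then show int: "set_integrable lborel {0<..} (\<lambda>x. exp (- (q * of_real x)))"
    by (rule set_integrable_bound) (auto simp: set_borel_measurable_def)
  have "(LBINT x=0..\<infinity>. exp (- (q * of_real x))) = 0 - (- 1 / q)"
  proof (rule interval_integral_FTC_integrable)
    show "((\<lambda>x. - exp (- (q * of_real x)) / q) has_vector_derivative exp (- (q * of_real x))) (at x)" for x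
      using assms by (intro has_vector_derivative_real_field)
         (auto intro!: derivative_eq_intros)
    show "set_integrable lborel (einterval 0 \<infinity>) (\<lambda>x. exp (- (q * of_real x)))"
      using int by (simp only: E)
    have "((\<lambda>x. - exp (- (q * of_real x)) / q) \<longlongrightarrow> - exp (- (q * of_real 0)) / q) (at_right 0)"
      using assms by (intro tendsto_intros) auto
    then show "((((\<lambda>x. - exp (- (q * of_real x)) / q)) \<circ> real_of_ereal) \<longlongrightarrow> - 1 / q) (at_right 0)"
      by (simp add: zero_ereal_def ereal_tendsto_simps)
    have "((\<lambda>x. exp (- (q * of_real x))) \<longlongrightarrow> 0) at_top"
      using lim [OF assms] by (subst tendsto_norm_zero_iff [symmetric]) simp
    then have "((\<lambda>x. - exp (- (q * of_real x)) / q) \<longlongrightarrow> - 0 / q) at_top"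
      using assms by (intro tendsto_intros) auto
    then show "((((\<lambda>x. - exp (- (q * of_real x)) / q)) \<circ> real_of_ereal) \<longlongrightarrow> 0) (at_left \<infinity>)"
      by (simp add: ereal_tendsto_simps)
  qed auto
  then show "(LINT x:{0<..}|lborel. exp (- (q * of_real x))) = 1 / q"
    by (simp add: interval_lebesgue_integral_def E)
qed

lemma half_line_exp_cos_integral:
  fixes b :: real
  assumes "0 < Re p"
  shows "(LINT x:{0<..}|lborel. exp (- (p * of_real x)) * of_real (cos (b * x))) = p / (p\<^sup>2 + of_real (b\<^sup>2))"
proof -
  let ?q = "p - \<i> * of_real b" and ?r = "p + \<i> * of_real b"
  have q: "0 < Re ?q" "0 < Re ?r" using assms by auto
  have nz: "?q \<noteq> 0" "?r \<noteq> 0" using q by (metis less_irrefl zero_complex.sel(1))+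
  have "exp (- (p * of_real x)) * of_real (cos (b * x))
     = (1/2) * (exp (- (?q * of_real x)) + exp (- (?r * of_real x)))" for x
    unfolding cos_of_real [symmetric] cos_exp_eq
    by (simp add: exp_add [symmetric] distrib_left algebra_simps)
  then have "(LINT x:{0<..}|lborel. exp (- (p * of_real x)) * of_real (cos (b * x)))
     = (1/2) * (1 / ?q + 1 / ?r)"
    using half_line_exp_integral [OF q(1)] half_line_exp_integral [OF q(2)]
    by (simp only: set_integral_mult_right set_integral_add)
  also have "\<dots> = p / (?q * ?r)" using nz by (simp add: field_simps)
  also have "?q * ?r = p\<^sup>2 + of_real (b\<^sup>2)"
    by (simp add: algebra_simps power2_eq_square)
  finally show ?thesis .
qed

section \<open>The Fourier transform of the Wright density\<close>

text \<open>
The Mainardi (M-Wright) function of order \<open>\<alpha>/2\<close>.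
\<close>
definition mainardi :: "real \<Rightarrow> real \<Rightarrow> real" where
  "mainardi \<alpha> z = wright (- \<alpha> / 2) (1 - \<alpha> / 2) (- z)"

lemma mainardi_hankel_integral:
  assumes "0 < a" "0 < \<alpha>" "\<alpha> < 1"
  shows "(LINT y|lborel. wright_kernel \<alpha> z (Complex a y)) = of_real (pi * mainardi \<alpha> z)"
  unfolding mainardi_def using wright_hankel_integral(2) [OF assms] by simp

text \<open>
The cosine transform of \<open>exp (- p z)\<close> is \<open>p / (p\<^sup>2 + b\<^sup>2)\<close>.  With \<open>p = w\<^sup>\<alpha>\<close> it expands into a geometric
series as soon as \<open>\<bar>w\<bar>\<^bsup>2\<alpha>\<^esup> > b\<^sup>2\<close>, and every term is again a Hankel kernel.
\<close>
lemma geometric_hankel_sums: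
  assumes a: "0 < a" and w: "a \<le> Re w" and \<alpha>: "0 < \<alpha>" "\<alpha> < 1" and b: "b\<^sup>2 < a powr (2 * \<alpha>)"
  shows "(\<lambda>n. of_real ((- (b\<^sup>2)) ^ n) * hankel_kernel (- 1 + - (2 * \<alpha>) * real n) w)
           sums (hankel_kernel (\<alpha> - 1) w * (w powr of_real \<alpha> / ((w powr of_real \<alpha>)\<^sup>2 + of_real (b\<^sup>2))))"
    and "norm (\<Sum>k<n. of_real ((- (b\<^sup>2)) ^ k) * hankel_kernel (- 1 + - (2 * \<alpha>) * real k) w)
           \<le> norm (hankel_kernel (- 1) w) * (1 / (1 - b\<^sup>2 / a powr (2 * \<alpha>)))"
proof -
  have nz: "w \<noteq> 0" using a w by auto
  define p where "p = w powr complex_of_real \<alpha>"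
  define x where "x = - (of_real (b\<^sup>2) * w powr complex_of_real (- (2 * \<alpha>)))"
  let ?\<rho> = "b\<^sup>2 / a powr (2 * \<alpha>)"
  have \<rho>: "0 \<le> ?\<rho>" "?\<rho> < 1" using b a by (auto simp: divide_less_eq)
  have p2: "p\<^sup>2 = w powr complex_of_real (2 * \<alpha>)"
    unfolding p_def using nz by (simp add: powr_def mult.assoc flip: exp_double)
  have pnz: "p \<noteq> 0" unfolding p_def using nz by simp
  have x: "x = - (of_real (b\<^sup>2) / p\<^sup>2)"
    unfolding x_def p2 by (simp add: powr_minus divide_inverse)
  have "(norm p)\<^sup>2 = norm w powr (2 * \<alpha>)"
    using p2 by (metis norm_power norm_powr_of_real)
  moreover have "a powr (2 * \<alpha>) \<le> norm w powr (2 * \<alpha>)"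
    using a w \<alpha> complex_Re_le_cmod [of w] by (intro powr_mono2) auto
  ultimately have nx: "norm x \<le> ?\<rho>"
    unfolding x using a by (auto simp: norm_divide norm_power intro!: divide_left_mono mult_pos_pos)
  have f: "of_real ((- (b\<^sup>2)) ^ n) * hankel_kernel (- 1 + - (2 * \<alpha>) * real n) w = hankel_kernel (- 1) w * x ^ n" for n
  proof -
    have "x ^ n = of_real ((- (b\<^sup>2)) ^ n) * (w powr of_real (- (2 * \<alpha>))) ^ n"
      unfolding x_def by (simp flip: power_mult_distrib)
    then show ?thesis unfolding hankel_kernel_mult_powr_power [OF nz, symmetric] by simp
  qed
  have "(\<lambda>n. hankel_kernel (- 1) w * x ^ n) sums (hankel_kernel (- 1) w * (1 / (1 - x)))"
    using nx \<rho> by (intro sums_mult geometric_sums) auto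
  moreover have "hankel_kernel (- 1) w * (1 / (1 - x)) = hankel_kernel (\<alpha> - 1) w * (p / (p\<^sup>2 + of_real (b\<^sup>2)))"
  proof -
    have "hankel_kernel (\<alpha> - 1) w = hankel_kernel (- 1) w * p"
      using hankel_kernel_mult_powr_power [OF nz, of "- 1" \<alpha> 1] by (simp add: p_def)
    moreover have "1 / (1 - x) = p * (p / (p\<^sup>2 + of_real (b\<^sup>2)))"
      unfolding x using pnz by (simp add: field_simps power2_eq_square)
    ultimately show ?thesis by simp
  qed
  ultimately show "(\<lambda>n. of_real ((- (b\<^sup>2)) ^ n) * hankel_kernel (- 1 + - (2 * \<alpha>) * real n) w)
           sums (hankel_kernel (\<alpha> - 1) w * (w powr of_real \<alpha> / ((w powr of_real \<alpha>)\<^sup>2 + of_real (b\<^sup>2))))"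
    unfolding f p_def by simp
  have "norm (\<Sum>k<n. hankel_kernel (- 1) w * x ^ k) = norm (hankel_kernel (- 1) w) * norm (\<Sum>k<n. x ^ k)"
    by (simp add: sum_distrib_left [symmetric] norm_mult)
  also have "norm (\<Sum>k<n. x ^ k) \<le> (\<Sum>k<n. ?\<rho> ^ k)"
    by (rule order_trans [OF norm_sum], rule sum_mono) (simp add: norm_power nx power_mono)
  also have "\<dots> \<le> (\<Sum>k. ?\<rho> ^ k)"
    using \<rho> by (intro sum_le_suminf summable_geometric) auto
  also have "\<dots> = 1 / (1 - ?\<rho>)" using \<rho> by (intro suminf_geometric) auto
  finally show "norm (\<Sum>k<n. of_real ((- (b\<^sup>2)) ^ k) * hankel_kernel (- 1 + - (2 * \<alpha>) * real k) w)
           \<le> norm (hankel_kernel (- 1) w) * (1 / (1 - b\<^sup>2 / a powr (2 * \<alpha>)))"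
    unfolding f by (simp add: mult_left_mono)
qed

text \<open>
The line integral of the Wright function is integrated over \<open>z\<close> first.  Its independence of \<open>a\<close> is
essential: the line is chosen in dependence on the frequency \<open>b\<close>, so far to the right that the
geometric series converges.
\<close>
lemma mainardi_cos_transform:
  assumes \<alpha>: "0 < \<alpha>" "\<alpha> < 1"
  shows "set_integrable lborel {0<..} (\<lambda>z. cos (b * z) * mainardi \<alpha> z)"
    and "(\<lambda>n. (- (b\<^sup>2)) ^ n * rGamma (1 + \<alpha> * real n)) sums
           (LINT z:{0<..}|lborel. cos (b * z) * mainardi \<alpha> z)"
proof -
  \<comment> \<open>far enough to the right that \<open>a\<^bsup>2\<alpha>\<^esup> = (1 + \<bar>b\<bar>)\<^sup>2\<close> exceeds \<open>b\<^sup>2\<close>\<close>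
  define a where "a = (1 + \<bar>b\<bar>) powr (1 / \<alpha>)"
  have a: "0 < a" unfolding a_def by simp
  have "a powr (2 * \<alpha>) = (1 + \<bar>b\<bar>) powr 2" unfolding a_def using \<alpha> by (simp add: powr_powr)
  also have "\<dots> = (1 + \<bar>b\<bar>)\<^sup>2" by simp
  also have "\<dots> > b\<^sup>2" by (simp add: power2_eq_square algebra_simps abs_mult_self_eq)
  finally have b: "b\<^sup>2 < a powr (2 * \<alpha>)" .
  \<comment> \<open>the rate of exponential decay in \<open>z\<close> that this line provides\<close>
  define \<kappa> where "\<kappa> = a powr \<alpha> * cos (\<alpha> * pi / 2)"
  have "0 < cos (\<alpha> * pi / 2)" using \<alpha> by (intro cos_gt_zero_pi) (auto intro: less_trans [of _ 0])
  then have \<kappa>: "0 < \<kappa>" unfolding \<kappa>_def using a by simp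
  let ?G = "\<lambda>z y. indicator {0<..} z *\<^sub>R (wright_kernel \<alpha> z (Complex a y) * of_real (cos (b * z)))"
  let ?h = "\<lambda>y. exp (a\<^sup>2 + \<bar>\<alpha> - 1\<bar> * (a + 1 / a)) * exp (\<bar>\<alpha> - 1\<bar> * \<bar>y\<bar> - y\<^sup>2)"
  have bound: "norm (?G z y) \<le> (indicator {0<..} z * exp (- \<kappa> * z)) * ?h y" for z y
  proof (cases "z > 0")
    case True
    have "norm (wright_kernel \<alpha> z (Complex a y) * of_real (cos (b * z)))
       \<le> (exp (- \<kappa> * z) * ?h y) * 1"
      unfolding norm_mult using norm_wright_kernel_le [OF a \<alpha>, of z y] True
      by (intro mult_mono) (auto simp: \<kappa>_def)
    then show ?thesis using True by (simp add: mult.assoc)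
  qed simp
  have meas: "(\<lambda>(z, y). ?G z y) \<in> borel_measurable (lborel \<Otimes>\<^sub>M lborel)"
  proof -
    have [measurable]: "(\<lambda>x. wright_kernel \<alpha> (fst x) (Complex a (snd x))) \<in> borel_measurable (borel \<Otimes>\<^sub>M borel)"
      using wright_kernel_measurable [OF a, of \<alpha>] by (simp add: case_prod_beta' borel_prod)
    show ?thesis unfolding split_beta by measurable
  qed
  have exp: "integrable lborel (\<lambda>z. indicator {0<..} z * exp (- \<kappa> * z) :: real)"
    using set_integrable_norm [OF half_line_exp_integral(1) [of "of_real \<kappa>"]] \<kappa>
    by (simp add: set_integrable_def)
  have int: "integrable (lborel \<Otimes>\<^sub>M lborel) (\<lambda>(z, y). ?G z y)"
  proof (rule Bochner_Integration.integrable_bound)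
    show "integrable (lborel \<Otimes>\<^sub>M lborel) (\<lambda>(z, y). (indicator {0<..} z * exp (- \<kappa> * z)) * ?h y)"
      by (intro integrable_prod_mult exp integrable_mult_right integrable_gauss_exp_abs)
    show "AE x in lborel \<Otimes>\<^sub>M lborel. norm (case x of (z, y) \<Rightarrow> ?G z y)
        \<le> norm (case x of (z, y) \<Rightarrow> (indicator {0<..} z * exp (- \<kappa> * z)) * ?h y)"
      using bound by (intro AE_I2) (auto simp: split_beta simp del: norm_scaleR intro: order_trans [OF _ abs_ge_self])
  qed (rule meas)
  have in_y: "(LINT y|lborel. ?G z y) = of_real (indicator {0<..} z *\<^sub>R (pi * (cos (b * z) * mainardi \<alpha> z)))" for z
    using mainardi_hankel_integral [OF a \<alpha>, of z] wright_hankel_integral(1) [OF a \<alpha>, of z]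
    by (simp add: scaleR_conv_of_real mult_ac)
  have "integrable lborel (\<lambda>z. LINT y|lborel. ?G z y)"
    using lborel_pair.integrable_fst [OF int] .
  then have M1: "integrable lborel (\<lambda>z. indicator {0<..} z *\<^sub>R (pi * (cos (b * z) * mainardi \<alpha> z)))"
    unfolding in_y by (simp only: complex_of_real_integrable_eq)
  then have "integrable lborel (\<lambda>z. (1 / pi) * (indicator {0<..} z *\<^sub>R (pi * (cos (b * z) * mainardi \<alpha> z))))"
    by (rule integrable_mult_right)
  then show "set_integrable lborel {0<..} (\<lambda>z. cos (b * z) * mainardi \<alpha> z)"
    by (simp add: set_integrable_def mult_ac)
  let ?w = "Complex a"
  let ?F = "\<lambda>y. hankel_kernel (\<alpha> - 1) (?w y) * (?w y powr of_real \<alpha> / ((?w y powr of_real \<alpha>)\<^sup>2 + of_real (b\<^sup>2)))"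
  have in_z: "(LINT z|lborel. ?G z y) = ?F y" for y
  proof -
    have "Re (?w y powr of_real \<alpha>) \<ge> \<kappa>"
      unfolding \<kappa>_def using a \<alpha> by (intro Re_powr_ge) auto
    then have "Re (?w y powr of_real \<alpha>) > 0" using \<kappa> by linarith
    from half_line_exp_cos_integral [OF this, of b]
    have "(LINT z:{0<..}|lborel. hankel_kernel (\<alpha> - 1) (?w y) *
        (exp (- (?w y powr of_real \<alpha> * of_real z)) * of_real (cos (b * z)))) = ?F y"
      by (simp only: set_integral_mult_right)
    moreover have "?G z y = indicator {0<..} z *\<^sub>R (hankel_kernel (\<alpha> - 1) (?w y) *
        (exp (- (?w y powr of_real \<alpha> * of_real z)) * of_real (cos (b * z))))" for z
      by (simp add: wright_kernel_def mult_ac)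
    ultimately show ?thesis by (simp only: set_lebesgue_integral_def)
  qed
  let ?f = "\<lambda>n y. of_real ((- (b\<^sup>2)) ^ n) * hankel_kernel (- 1 + - (2 * \<alpha>) * real n) (?w y)"
  have sums: "(\<lambda>n. ?f n y) sums ?F y" for y
    by (rule geometric_hankel_sums(1) [OF a _ \<alpha> b]) simp
  have fb: "norm (\<Sum>k<n. ?f k y) \<le> norm (hankel_kernel (- 1) (?w y)) * (1 / (1 - b\<^sup>2 / a powr (2 * \<alpha>)))" for n y
    by (rule geometric_hankel_sums(2) [OF a _ \<alpha> b]) simp
  have fint: "integrable lborel (?f n)" for n
    by (intro integrable_mult_right hankel_kernel_line_integrable a)
  have gint: "integrable lborel (\<lambda>y. norm (hankel_kernel (- 1) (?w y)) * (1 / (1 - b\<^sup>2 / a powr (2 * \<alpha>))))"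
    by (intro integrable_mult_left integrable_norm hankel_kernel_line_integrable a)
  have Fm: "?F \<in> borel_measurable lborel"
    using lborel_pair.integrable_snd [OF int] unfolding in_z by simp
  have "integral\<^sup>L lborel (?f n) = of_real (pi * ((- (b\<^sup>2)) ^ n * rGamma (1 + \<alpha> * real n)))" for n
  proof -
    have "(1 - (- 1 + - (2 * \<alpha>) * real n)) / 2 = 1 + \<alpha> * real n" by (simp add: field_simps)
    then have "hankel_integral (- 1 + - (2 * \<alpha>) * real n) a = of_real (pi * rGamma (1 + \<alpha> * real n))"
      by (simp only: hankel_integral_eq_rGamma [OF a])
    moreover have "integral\<^sup>L lborel (?f n) = of_real ((- (b\<^sup>2)) ^ n) * hankel_integral (- 1 + - (2 * \<alpha>) * real n) a"
      unfolding hankel_integral_def by (rule integral_mult_right_zero)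
    ultimately show ?thesis by (simp only: of_real_mult mult_ac)
  qed
  then have s: "(\<lambda>n. complex_of_real (pi * ((- (b\<^sup>2)) ^ n * rGamma (1 + \<alpha> * real n)))) sums integral\<^sup>L lborel ?F"
    using integral_sums_dominated(2) [OF fint Fm gint AE_I2 [OF sums] AE_I2 [OF fb]] by (simp only:)
  also have "integral\<^sup>L lborel ?F = (LINT y|lborel. (LINT z|lborel. ?G z y))"
    unfolding in_z ..
  also have "\<dots> = (LINT z|lborel. (LINT y|lborel. ?G z y))"
    by (rule lborel_pair.Fubini_integral [OF int])
  also have "\<dots> = of_real (LINT z|lborel. indicator {0<..} z *\<^sub>R (pi * (cos (b * z) * mainardi \<alpha> z)))"
    unfolding in_y by (rule integral_complex_of_real)
  also have "(LINT z|lborel. indicator {0<..} z *\<^sub>R (pi * (cos (b * z) * mainardi \<alpha> z)))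
      = pi * (LINT z:{0<..}|lborel. cos (b * z) * mainardi \<alpha> z)"
    unfolding set_lebesgue_integral_def by (simp add: mult.left_commute [of _ pi])
  finally have "(\<lambda>n. pi * ((- (b\<^sup>2)) ^ n * rGamma (1 + \<alpha> * real n))) sums
      (pi * (LINT z:{0<..}|lborel. cos (b * z) * mainardi \<alpha> z))"
    by (simp only: sums_of_real_iff)
  then show "(\<lambda>n. (- (b\<^sup>2)) ^ n * rGamma (1 + \<alpha> * real n)) sums
           (LINT z:{0<..}|lborel. cos (b * z) * mainardi \<alpha> z)"
    by (subst (asm) sums_mult_iff) simp_all
qed

text \<open>
The half line \<open>x < 0\<close> is reflected to \<open>x > 0\<close>; the origin is a null set.
\<close>
lemma fourier_even:
  fixes h :: "real \<Rightarrow> real"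
  assumes h: "set_integrable lborel {0<..} h" and g: "\<And>x. g x = h \<bar>x\<bar>"
  shows "integrable lborel g"
    and "fourier g b = of_real (2 * (LINT x:{0<..}|lborel. cos (b * x) * h x))"
proof -
  \<comment> \<open>the contribution of the right half line for \<open>s = 1\<close>, and of the reflected left one for \<open>s = -1\<close>\<close>
  define k where "k = (\<lambda>s x. indicator {0<..} x *\<^sub>R (exp (\<i> * of_real (s * b * x)) * of_real (h x)) :: complex)"
  have h': "set_integrable lborel {0<..} (\<lambda>x. complex_of_real (h x))"
    using h unfolding set_integrable_def by (simp add: scaleR_conv_of_real flip: of_real_mult complex_of_real_integrable_eq)
  have k: "integrable lborel (k s)" for s
    unfolding k_def
  proof (rule Bochner_Integration.integrable_bound [OF h' [unfolded set_integrable_def]])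
    have [measurable]: "(\<lambda>x. indicator {0<..} x *\<^sub>R complex_of_real (h x)) \<in> borel_measurable borel"
      using borel_measurable_integrable [OF h' [unfolded set_integrable_def]] by simp
    have "(\<lambda>x. exp (\<i> * of_real (s * b * x)) * (indicator {0<..} x *\<^sub>R complex_of_real (h x))) \<in> borel_measurable borel"
      by measurable
    then show "(\<lambda>x. indicator {0<..} x *\<^sub>R (exp (\<i> * of_real (s * b * x)) * of_real (h x))) \<in> borel_measurable lborel"
      by simp
  qed (simp add: norm_mult)
  have AE0: "AE x in lborel. x \<noteq> (0::real)" by (rule AE_lborel_singleton)
  have k': "integrable lborel (\<lambda>x. k s (- x))" "(LINT x|lborel. k s (- x)) = integral\<^sup>L lborel (k s)" for s
    using lborel_integrable_real_affine [OF k [of s], of "-1" 0]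
      lborel_integral_real_affine [of "-1" "k s" 0] by simp_all
  have split: "AE x in lborel. exp (\<i> * of_real (b * x)) * of_real (g x) = k 1 x + k (- 1) (- x)"
    using AE0 by eventually_elim (auto simp: k_def g indicator_def)
  have gm: "g \<in> borel_measurable borel"
  proof -
    have hm: "(\<lambda>x. indicator {0<..} x *\<^sub>R h x) \<in> borel_measurable borel"
      using borel_measurable_integrable [OF h [unfolded set_integrable_def]] by simp
    have habs: "(\<lambda>x. indicator {0<..} \<bar>x\<bar> *\<^sub>R h \<bar>x\<bar>) \<in> borel_measurable borel"
      by (rule measurable_compose [OF _ hm]) measurable
    have "g = (\<lambda>x. if x = 0 then h 0 else indicator {0<..} \<bar>x\<bar> *\<^sub>R h \<bar>x\<bar>)"
      by (auto simp: g fun_eq_iff)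
    moreover have "(\<lambda>x. if x = 0 then h 0 else indicator {0<..} \<bar>x\<bar> *\<^sub>R h \<bar>x\<bar>) \<in> borel_measurable borel"
      by (intro measurable_If habs) auto
    ultimately show ?thesis by simp
  qed
  then have m: "(\<lambda>x. exp (\<i> * of_real (b * x)) * of_real (g x)) \<in> borel_measurable lborel" by simp
  have mk: "(\<lambda>x. k 1 x + k (- 1) (- x)) \<in> borel_measurable lborel"
    by (rule borel_measurable_integrable [OF Bochner_Integration.integrable_add [OF k k'(1)]])
  have "integrable lborel (\<lambda>x. exp (\<i> * of_real (b * x)) * of_real (g x))"
    using integrable_cong_AE [OF m mk split] k k' by simp
  then show "integrable lborel g"
    using gm by (subst (asm) integrable_norm_iff [symmetric]) (auto simp: norm_mult integrable_abs_iff)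
  have "fourier g b = (LINT x|lborel. k 1 x + k (- 1) (- x))"
    unfolding fourier_def by (rule integral_cong_AE [OF m mk split])
  also have "\<dots> = integral\<^sup>L lborel (k 1) + integral\<^sup>L lborel (k (- 1))"
    using k k' by simp
  also have "\<dots> = (LINT x|lborel. k 1 x + k (- 1) x)" using k by simp
  also have "\<dots> = (LINT x|lborel. of_real (2 * (indicator {0<..} x *\<^sub>R (cos (b * x) * h x))))"
  proof (rule Bochner_Integration.integral_cong [OF refl])
    fix x
    have "exp (\<i> * of_real (1 * b * x)) + exp (\<i> * of_real (- 1 * b * x)) = 2 * complex_of_real (cos (b * x))"
      by (simp add: cos_of_real [symmetric] cos_exp_eq)
    then have "(exp (\<i> * of_real (1 * b * x)) + exp (\<i> * of_real (- 1 * b * x))) * complex_of_real (h x)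
        = 2 * complex_of_real (cos (b * x)) * complex_of_real (h x)" by (simp only:)
    then show "k 1 x + k (- 1) x = of_real (2 * (indicator {0<..} x *\<^sub>R (cos (b * x) * h x)))"
      by (cases "x > 0") (simp_all add: k_def distrib_right mult.assoc)
  qed
  also have "\<dots> = of_real (2 * (LINT x:{0<..}|lborel. cos (b * x) * h x))"
    unfolding set_lebesgue_integral_def by (simp only: integral_complex_of_real integral_mult_right_zero)
  finally show "fourier g b = of_real (2 * (LINT x:{0<..}|lborel. cos (b * x) * h x))" .
qed

lemma half_line_scale:
  fixes f :: "real \<Rightarrow> real"
  assumes "0 < c"
  shows "set_integrable lborel {0<..} (\<lambda>x. f (x / c)) \<longleftrightarrow> set_integrable lborel {0<..} f"
    and "(LINT x:{0<..}|lborel. f (x / c)) = c * (LINT x:{0<..}|lborel. f x)"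
proof -
  have i: "indicator {0<..} (x / c) = (indicator {0<..} x :: real)" for x
    using assms by (simp add: indicator_def zero_less_divide_iff)
  show "set_integrable lborel {0<..} (\<lambda>x. f (x / c)) \<longleftrightarrow> set_integrable lborel {0<..} f"
    unfolding set_integrable_def
    using lborel_integrable_real_affine_iff [of "1 / c" "\<lambda>x. indicator {0<..} x *\<^sub>R f x" 0] assms i by simp
  show "(LINT x:{0<..}|lborel. f (x / c)) = c * (LINT x:{0<..}|lborel. f x)"
    unfolding set_lebesgue_integral_def
    using lborel_integral_real_affine [of "1 / c" "\<lambda>x. indicator {0<..} x *\<^sub>R f x" 0] assms i by simp
qed

definition mittag_leffler :: "real \<Rightarrow> real \<Rightarrow> real" where
  "mittag_leffler \<alpha> x = (\<Sum>n. rGamma (1 + \<alpha> * real n) * x ^ n)"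

lemma mainardi_fourier:
  assumes \<alpha>: "0 < \<alpha>" "\<alpha> < 1" and c: "0 < c"
  shows "integrable lborel (\<lambda>x. 1 / (2 * c) * mainardi \<alpha> (\<bar>x\<bar> / c))"
    and "fourier (\<lambda>x. 1 / (2 * c) * mainardi \<alpha> (\<bar>x\<bar> / c)) b = of_real (mittag_leffler \<alpha> (- ((b * c)\<^sup>2)))"
proof -
  let ?h = "\<lambda>x. 1 / (2 * c) * mainardi \<alpha> (x / c)"
  have "set_integrable lborel {0<..} (mainardi \<alpha>)"
    using mainardi_cos_transform(1) [OF \<alpha>, of 0] by simp
  then have h: "set_integrable lborel {0<..} ?h"
    using half_line_scale(1) [OF c, of "mainardi \<alpha>"] by simp
  show "integrable lborel (\<lambda>x. 1 / (2 * c) * mainardi \<alpha> (\<bar>x\<bar> / c))"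
    by (rule fourier_even(1) [OF h]) simp
  have "fourier (\<lambda>x. 1 / (2 * c) * mainardi \<alpha> (\<bar>x\<bar> / c)) b = of_real (2 * (LINT x:{0<..}|lborel. cos (b * x) * ?h x))"
    by (rule fourier_even(2) [OF h]) simp
  also have "(LINT x:{0<..}|lborel. cos (b * x) * ?h x)
      = (LINT x:{0<..}|lborel. 1 / (2 * c) * (cos ((b * c) * (x / c)) * mainardi \<alpha> (x / c)))"
    using c by (simp add: mult_ac)
  also have "\<dots> = 1 / (2 * c) * (c * (LINT x:{0<..}|lborel. cos ((b * c) * x) * mainardi \<alpha> x))"
    by (subst set_integral_mult_right) (simp only: half_line_scale(2) [OF c, of "\<lambda>x. cos ((b * c) * x) * mainardi \<alpha> x"])
  also have "2 * \<dots> = (LINT x:{0<..}|lborel. cos ((b * c) * x) * mainardi \<alpha> x)"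
    using c by simp
  also have "\<dots> = mittag_leffler \<alpha> (- ((b * c)\<^sup>2))"
    unfolding mittag_leffler_def using mainardi_cos_transform(2) [OF \<alpha>, of "b * c"]
    by (simp add: sums_iff mult.commute)
  finally show "fourier (\<lambda>x. 1 / (2 * c) * mainardi \<alpha> (\<bar>x\<bar> / c)) b = of_real (mittag_leffler \<alpha> (- ((b * c)\<^sup>2)))" .
qed

text \<open>
Convergence at every negative argument was obtained together with the cosine transform, and a power
series converges absolutely inside its region of convergence.
\<close>
lemma summable_mittag_leffler:
  assumes \<alpha>: "0 < \<alpha>" "\<alpha> < 1"
  shows "summable (\<lambda>n. norm (rGamma (1 + \<alpha> * real n) * x ^ n))"
proof (rule powser_insidea)
  show "summable (\<lambda>n. rGamma (1 + \<alpha> * real n) * (- ((sqrt (1 + \<bar>x\<bar>))\<^sup>2)) ^ n)"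
    using mainardi_cos_transform(2) [OF \<alpha>, of "sqrt (1 + \<bar>x\<bar>)"] by (simp add: sums_iff mult.commute)
  show "norm x < norm (- ((sqrt (1 + \<bar>x\<bar>))\<^sup>2))" by simp
qed

section \<open>Fourier transforms determine integrable functions\<close>

lemma density_char:
  fixes f :: "real \<Rightarrow> real"
  assumes f: "integrable lborel f" and nn: "\<And>x. 0 \<le> f x"
  shows "char (density lborel (\<lambda>x. ennreal (f x))) t = fourier f t"
proof -
  have "char (density lborel (\<lambda>x. ennreal (f x))) t = (LINT x|lborel. f x *\<^sub>R iexp (t * x))"
    unfolding char_def using f nn by (intro integral_density) auto
  then show ?thesis by (simp add: fourier_def scaleR_conv_of_real mult.commute)
qed

lemma fourier_scale: "fourier (\<lambda>x. c * f x) t = of_real c * fourier f t"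
proof -
  have "fourier (\<lambda>x. c * f x) t = (LINT x|lborel. of_real c * (exp (\<i> * of_real (t * x)) * of_real (f x)))"
    unfolding fourier_def by (simp add: mult_ac)
  also have "\<dots> = of_real c * fourier f t"
    unfolding fourier_def by (rule integral_mult_right_zero)
  finally show ?thesis .
qed

lemma integrable_fourier_integrand:
  fixes f :: "real \<Rightarrow> real"
  assumes "integrable lborel f"
  shows "integrable lborel (\<lambda>x. exp (\<i> * of_real (t * x)) * of_real (f x))"
proof (rule Bochner_Integration.integrable_bound [OF assms])
  have [measurable]: "f \<in> borel_measurable borel" using assms by auto
  show "(\<lambda>x. exp (\<i> * of_real (t * x)) * of_real (f x)) \<in> borel_measurable lborel" by measurable
qed (simp add: norm_mult)

lemma fourier_diff:
  assumes "integrable lborel f" "integrable lborel g"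
  shows "fourier (\<lambda>x. f x - g x) t = fourier f t - fourier g t"
  unfolding fourier_def
  using Bochner_Integration.integral_diff [OF integrable_fourier_integrand [OF assms(1), of t]
      integrable_fourier_integrand [OF assms(2), of t]]
  by (simp add: right_diff_distrib)

text \<open>
Normalised to mass one, the two functions are densities of probability measures with the same
characteristic function.
\<close>
lemma fourier_nonneg_unique:
  fixes f g :: "real \<Rightarrow> real"
  assumes f: "integrable lborel f" "\<And>x. 0 \<le> f x" and g: "integrable lborel g" "\<And>x. 0 \<le> g x"
    and eq: "\<And>t. fourier f t = fourier g t"
  shows "AE x in lborel. f x = g x"
proof -
  define c where "c = (LINT x|lborel. f x)"
  have "fourier f 0 = of_real c" "fourier g 0 = of_real (LINT x|lborel. g x)"
    unfolding c_def fourier_def by simp_all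
  then have c: "(LINT x|lborel. g x) = c" using eq [of 0] by simp
  show ?thesis
  proof (cases "c = 0")
    case True
    have "AE x in lborel. f x = 0"
      using True f c_def integral_nonneg_eq_0_iff_AE [of lborel f] by auto
    moreover have "AE x in lborel. g x = 0"
      using True g c integral_nonneg_eq_0_iff_AE [of lborel g] by auto
    ultimately show ?thesis by eventually_elim simp
  next
    case False
    then have c0: "c > 0" unfolding c_def using f Bochner_Integration.integral_nonneg [of lborel f] by (simp add: less_le)
    have dist: "real_distribution (density lborel (\<lambda>x. ennreal (1 / c * h x)))"
      if h: "integrable lborel h" "\<And>x. 0 \<le> h x" "(LINT x|lborel. h x) = c" for h
    proof -
      have "(\<integral>\<^sup>+ x. ennreal (1 / c * h x) \<partial>lborel) = ennreal (LINT x|lborel. 1 / c * h x)"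
        using h c0 by (intro nn_integral_eq_integral) auto
      also have "\<dots> = 1" using h c0 by simp
      finally have "emeasure (density lborel (\<lambda>x. ennreal (1 / c * h x))) UNIV = 1"
        using h by (subst emeasure_density) auto
      then have "prob_space (density lborel (\<lambda>x. ennreal (1 / c * h x)))"
        by (intro prob_spaceI) simp
      then show ?thesis
        by (simp add: real_distribution_def real_distribution_axioms_def)
    qed
    have "char (density lborel (\<lambda>x. ennreal (1 / c * f x))) = char (density lborel (\<lambda>x. ennreal (1 / c * g x)))"
    proof
      fix t
      show "char (density lborel (\<lambda>x. ennreal (1 / c * f x))) t = char (density lborel (\<lambda>x. ennreal (1 / c * g x))) t"
        using f g c0 eq [of t] by (subst (1 2) density_char) (auto simp: fourier_scale [of "1 / c", simplified])
    qed
    then have "density lborel (\<lambda>x. ennreal (1 / c * f x)) = density lborel (\<lambda>x. ennreal (1 / c * g x))"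
      using dist [OF f] dist [OF g c] c_def by (intro Levy_uniqueness) auto
    then have "AE x in lborel. ennreal (1 / c * f x) = ennreal (1 / c * g x)"
      using f g by (intro sigma_finite_measure.density_unique [OF sigma_finite_lborel]) auto
    then show ?thesis
    proof eventually_elim
      case (elim x)
      then show ?case using f(2) [of x] g(2) [of x] c0 by simp
    qed
  qed
qed

text \<open>
The positive and the negative part of the difference have the same Fourier transform.
\<close>
theorem fourier_unique:
  fixes f g :: "real \<Rightarrow> real"
  assumes f: "integrable lborel f" and g: "integrable lborel g"
    and eq: "\<And>t. fourier f t = fourier g t"
  shows "AE x in lborel. f x = g x"
proof -
  let ?d = "\<lambda>x. f x - g x"
  have d: "integrable lborel ?d" "integrable lborel (\<lambda>x. g x - f x)" using f g by simp_all
  have p: "integrable lborel (\<lambda>x. max 0 (?d x))" and m: "integrable lborel (\<lambda>x. max 0 (g x - f x))"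
    using d by (auto intro!: integrable_max)
  have "fourier (\<lambda>x. max 0 (?d x)) t = fourier (\<lambda>x. max 0 (g x - f x)) t" for t
  proof -
    have "fourier (\<lambda>x. max 0 (?d x)) t - fourier (\<lambda>x. max 0 (g x - f x)) t = fourier ?d t"
      by (subst fourier_diff [OF p m, symmetric]) (intro arg_cong2 [where f = fourier], auto)
    also have "\<dots> = 0" using fourier_diff [OF f g] eq by simp
    finally show ?thesis by simp
  qed
  then have "AE x in lborel. max 0 (?d x) = max 0 (g x - f x)"
    by (intro fourier_nonneg_unique p m) auto
  then show ?thesis by eventually_elim (simp add: max_def split: if_splits)
qed

section \<open>Erdelyi-Kober integrals as Abel integrals\<close>

text \<open>
Euler's Beta integral carried to an arbitrary interval; with \<open>q = 1\<close> it also shows that the Abel kernel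
is integrable.
\<close>
lemma beta_integral_affine:
  fixes l r p q :: real
  assumes lr: "l < r" and p: "p > 0" and q: "q > 0"
  shows "set_integrable lborel {l<..<r} (\<lambda>x. (r - x) powr (p - 1) * (x - l) powr (q - 1))"
    and "(LINT x:{l<..<r}|lborel. (r - x) powr (p - 1) * (x - l) powr (q - 1)) = (r - l) powr (p + q - 1) * Beta p q"
proof -
  let ?c = "r - l"
  have c: "?c > 0" using lr by simp
  let ?b = "\<lambda>t. t powr (q - 1) * (1 - t) powr (p - 1)"
  let ?f = "\<lambda>x. indicator {l<..<r} x *\<^sub>R ((r - x) powr (p - 1) * (x - l) powr (q - 1))"
  have int01: "set_integrable lborel {0..1} ?b" by (rule integrable_Beta [OF q p])
  have "(LINT t:{0..1}|lborel. ?b t) = Beta q p"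
    using set_borel_integral_eq_integral(2) [OF int01] integral_unique [OF has_integral_Beta_real [OF q p]] by simp
  moreover have ind: "indicator {0..1} t *\<^sub>R ?b t = indicator {0<..<1} t *\<^sub>R ?b t" for t :: real
    by (cases "t = 0 \<or> t = 1") (auto simp: indicator_def)
  ultimately have I: "integrable lborel (\<lambda>t. indicator {0<..<1} t *\<^sub>R ?b t)"
    "(LINT t|lborel. indicator {0<..<1} t *\<^sub>R ?b t) = Beta p q"
    using int01 unfolding set_integrable_def set_lebesgue_integral_def ind
    by (simp_all only: Beta_commute)
  have *: "?f (l + ?c * t) = ?c powr (p + q - 2) * (indicator {0<..<1} t *\<^sub>R ?b t)" for t
  proof (cases "t \<in> {0<..<1}")
    case True
    have "?c * t < ?c * 1" "0 < ?c * t"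
      using True c by (intro mult_strict_left_mono mult_pos_pos; simp)+
    then have "l + ?c * t \<in> {l<..<r}" by simp
    moreover have "r - (l + ?c * t) = ?c * (1 - t)" by (simp add: algebra_simps)
    moreover have "l + ?c * t - l = ?c * t" by simp
    moreover have "?c powr (p + q - 2) = ?c powr (p - 1) * ?c powr (q - 1)"
      by (simp add: powr_add [symmetric])
    ultimately show ?thesis using True c by (simp only:) (simp add: powr_mult)
  next
    case False
    have "0 < ?c * t \<longleftrightarrow> 0 < t" "?c * t < ?c \<longleftrightarrow> t < 1"
      using c by (auto simp: zero_less_mult_iff mult_less_cancel_left)
    then have "l + ?c * t \<notin> {l<..<r}" using False by auto
    then show ?thesis using False by simp
  qed
  have "integrable lborel (\<lambda>t. ?f (l + ?c * t))"
    unfolding * using I(1) by (rule integrable_mult_right)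
  then show "set_integrable lborel {l<..<r} (\<lambda>x. (r - x) powr (p - 1) * (x - l) powr (q - 1))"
    unfolding set_integrable_def using c lborel_integrable_real_affine_iff [of ?c ?f l] by simp
  have "integral\<^sup>L lborel ?f = ?c * (LINT t|lborel. ?f (l + ?c * t))"
    using lborel_integral_real_affine [of ?c ?f l] c by simp
  also have "\<dots> = ?c * (?c powr (p + q - 2) * Beta p q)"
    unfolding * using I(2) by (simp only: integral_mult_right_zero)
  also have "\<dots> = ?c powr (p + q - 1) * Beta p q"
    using c by (simp add: powr_mult_base)
  finally show "(LINT x:{l<..<r}|lborel. (r - x) powr (p - 1) * (x - l) powr (q - 1)) = (r - l) powr (p + q - 1) * Beta p q"
    by (simp add: set_lebesgue_integral_def)
qed

lemma abel_kernel_integrable: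
  fixes r p :: real
  assumes "r > 0" "p > 0"
  shows "set_integrable lborel {0<..<r} (\<lambda>x. (r - x) powr (p - 1))"
proof -
  have "set_integrable lborel {0<..<r} (\<lambda>x. (r - x) powr (p - 1) * (x - 0) powr (1 - 1))"
    by (rule beta_integral_affine) (use assms in auto)
  then show ?thesis
    by (rule set_integrable_cong [THEN iffD1, rotated 3]) auto
qed

text \<open>
The change of variables theorem speaks about the completed Lebesgue measure; for a Borel measurable
function this makes no difference to integrability, so it applies in both directions.
\<close>
lemma substitution_powr_real:
  fixes h :: "real \<Rightarrow> real"
  assumes m: "m > 0" and t: "t > 0" and h: "set_borel_measurable borel {0<..<t powr m} h"
  shows "set_integrable lborel {0<..<t} (\<lambda>s. m * s powr (m - 1) * h (s powr m))
      \<longleftrightarrow> set_integrable lborel {0<..<t powr m} h"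
    and "(LINT s:{0<..<t}|lborel. m * s powr (m - 1) * h (s powr m)) = (LINT y:{0<..<t powr m}|lborel. h y)"
proof -
  let ?g = "\<lambda>s. s powr m" and ?S = "{0<..<t}" and ?T = "{0<..<t powr m}"
  let ?k = "\<lambda>s. m * s powr (m - 1) * h (s powr m)"
  have "y \<in> ?g ` ?S" if "y \<in> ?T" for y
  proof (rule image_eqI [of _ _ "y powr (1 / m)"])
    have "y powr (1 / m) < (t powr m) powr (1 / m)" using that m by (intro powr_less_mono2) auto
    then show "y powr (1 / m) \<in> ?S" using that m t by (simp add: powr_powr)
  qed (use that m in \<open>simp add: powr_powr\<close>)
  moreover have "?g ` ?S \<subseteq> ?T" using m by (auto intro!: powr_less_mono2)
  ultimately have im: "?g ` ?S = ?T" by blast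
  have inj: "inj_on ?g ?S"
    by (rule inj_on_inverseI [of _ "\<lambda>y. y powr (1 / m)"]) (use m in \<open>simp add: powr_powr\<close>)
  have der: "(?g has_field_derivative m * s powr (m - 1)) (at s within ?S)" if "s \<in> ?S" for s
    using that by (auto intro!: derivative_eq_intros simp: field_simps powr_diff)
  have cov: "(\<lambda>s. \<bar>m * s powr (m - 1)\<bar> * h (?g s)) absolutely_integrable_on ?S \<and>
      integral ?S (\<lambda>s. \<bar>m * s powr (m - 1)\<bar> * h (?g s)) = b
      \<longleftrightarrow> h absolutely_integrable_on ?T \<and> integral ?T h = b" for b
    using has_absolute_integral_change_of_variables_1' [OF _ der inj, of h b] unfolding im by simp
  have abs: "\<bar>m * s powr (m - 1)\<bar> = m * s powr (m - 1)" for s using m by simp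
  have hm: "(\<lambda>y. indicator ?T y *\<^sub>R h y) \<in> borel_measurable borel"
    using h by (simp add: set_borel_measurable_def)
  have "(\<lambda>s. indicator ?S s *\<^sub>R (m * s powr (m - 1) * (indicator ?T (?g s) *\<^sub>R h (?g s)))) \<in> borel_measurable borel"
    using measurable_compose [of ?g borel borel, OF _ hm] by measurable
  also have "(\<lambda>s. indicator ?S s *\<^sub>R (m * s powr (m - 1) * (indicator ?T (?g s) *\<^sub>R h (?g s)))) = (\<lambda>s. indicator ?S s *\<^sub>R ?k s)"
    using im by (auto simp: fun_eq_iff indicator_def)
  finally have km: "set_borel_measurable borel ?S ?k"
    by (simp add: set_borel_measurable_def)
  have leb: "set_integrable lborel A f \<longleftrightarrow> f absolutely_integrable_on A"
    if "set_borel_measurable borel A f" for A and f :: "real \<Rightarrow> real"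
    using that by (simp add: set_integrable_def set_borel_measurable_def integrable_completion)
  show iff: "set_integrable lborel ?S ?k \<longleftrightarrow> set_integrable lborel ?T h"
    unfolding leb [OF km] leb [OF h] using cov by (auto simp: abs)
  show "(LINT s:?S|lborel. ?k s) = (LINT y:?T|lborel. h y)"
  proof (cases "set_integrable lborel ?T h")
    case True
    have "h absolutely_integrable_on ?T" using True leb [OF h] by simp
    then have "integral ?S ?k = integral ?T h" using cov [of "integral ?T h"] by (simp add: abs)
    then show ?thesis
      using True iff by (simp add: set_borel_integral_eq_integral(2))
  next
    case False
    then have "\<not> set_integrable lborel ?S ?k" using iff by simp
    then show ?thesis using False
      by (simp add: set_integrable_def set_lebesgue_integral_def not_integrable_integral_eq)
  qed
qed

lemma set_integrable_complex_iff:
  fixes f :: "real \<Rightarrow> complex"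
  shows "set_integrable lborel A f \<longleftrightarrow>
    set_integrable lborel A (\<lambda>x. Re (f x)) \<and> set_integrable lborel A (\<lambda>x. Im (f x))"
proof -
  let ?f = "\<lambda>x. indicator A x *\<^sub>R f x"
  have "integrable lborel ?f \<longleftrightarrow> integrable lborel (\<lambda>x. Re (?f x)) \<and> integrable lborel (\<lambda>x. Im (?f x))"
  proof
    assume *: "integrable lborel (\<lambda>x. Re (?f x)) \<and> integrable lborel (\<lambda>x. Im (?f x))"
    have "integrable lborel (\<lambda>x. of_real (Re (?f x)) + \<i> * of_real (Im (?f x)))"
      using * by (intro Bochner_Integration.integrable_add integrable_mult_right integrable_of_real) auto
    then show "integrable lborel ?f" by (simp only: complex_eq [symmetric])
  next
    assume "integrable lborel ?f"
    then show "integrable lborel (\<lambda>x. Re (?f x)) \<and> integrable lborel (\<lambda>x. Im (?f x))"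
      by (intro conjI integrable_Re integrable_Im)
  qed
  then show ?thesis by (simp add: set_integrable_def)
qed

lemma set_integral_complex:
  fixes f :: "real \<Rightarrow> complex"
  assumes "set_integrable lborel A f"
  shows "Re (LINT x:A|lborel. f x) = (LINT x:A|lborel. Re (f x))"
    and "Im (LINT x:A|lborel. f x) = (LINT x:A|lborel. Im (f x))"
  using integral_Re [of lborel "\<lambda>x. indicator A x *\<^sub>R f x"] integral_Im [of lborel "\<lambda>x. indicator A x *\<^sub>R f x"] assms
  by (simp_all add: set_integrable_def set_lebesgue_integral_def)

lemma substitution_powr_complex:
  fixes h :: "real \<Rightarrow> complex"
  assumes m: "m > 0" and t: "t > 0" and h: "set_borel_measurable borel {0<..<t powr m} h"
  shows "set_integrable lborel {0<..<t} (\<lambda>s. (m * s powr (m - 1)) *\<^sub>R h (s powr m))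
      \<longleftrightarrow> set_integrable lborel {0<..<t powr m} h"
    and "(LINT s:{0<..<t}|lborel. (m * s powr (m - 1)) *\<^sub>R h (s powr m)) = (LINT y:{0<..<t powr m}|lborel. h y)"
proof -
  have hm: "(\<lambda>y. indicator {0<..<t powr m} y *\<^sub>R h y) \<in> borel_measurable borel"
    using h by (simp add: set_borel_measurable_def)
  have hRe: "set_borel_measurable borel {0<..<t powr m} (\<lambda>y. Re (h y))"
    using measurable_compose [OF hm borel_measurable_Re] by (simp add: set_borel_measurable_def)
  have hIm: "set_borel_measurable borel {0<..<t powr m} (\<lambda>y. Im (h y))"
    using measurable_compose [OF hm borel_measurable_Im] by (simp add: set_borel_measurable_def)
  note R = substitution_powr_real [OF m t hRe] and I = substitution_powr_real [OF m t hIm]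
  show iff: "set_integrable lborel {0<..<t} (\<lambda>s. (m * s powr (m - 1)) *\<^sub>R h (s powr m))
      \<longleftrightarrow> set_integrable lborel {0<..<t powr m} h"
    unfolding set_integrable_complex_iff [of _ h]
    by (subst set_integrable_complex_iff) (simp only: scaleR_complex.sel R(1) I(1))
  show "(LINT s:{0<..<t}|lborel. (m * s powr (m - 1)) *\<^sub>R h (s powr m)) = (LINT y:{0<..<t powr m}|lborel. h y)"
  proof (cases "set_integrable lborel {0<..<t powr m} h")
    case True
    note True' = True [unfolded iff [symmetric]]
    show ?thesis
      by (rule complex_eqI)
         (simp_all only: set_integral_complex [OF True] set_integral_complex [OF True'] scaleR_complex.sel R(2) I(2))
  next
    case False
    then have "\<not> set_integrable lborel {0<..<t} (\<lambda>s. (m * s powr (m - 1)) *\<^sub>R h (s powr m))" using iff by simp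
    then show ?thesis using False
      by (simp add: set_integrable_def set_lebesgue_integral_def not_integrable_integral_eq)
  qed
qed

text \<open>
The Riemann-Liouville integral of order \<open>a\<close> without its factor \<open>1 / \<Gamma>(a)\<close>.
\<close>
definition abel_integral :: "real \<Rightarrow> (real \<Rightarrow> complex) \<Rightarrow> real \<Rightarrow> complex" where
  "abel_integral a h T = (LINT y:{0<..<T}|lborel. (T - y) powr (a - 1) *\<^sub>R h y)"

definition abel_integrable :: "real \<Rightarrow> (real \<Rightarrow> complex) \<Rightarrow> real \<Rightarrow> bool" where
  "abel_integrable a h T \<longleftrightarrow> set_integrable lborel {0<..<T} (\<lambda>y. (T - y) powr (a - 1) *\<^sub>R h y)"

lemma EK_integrand_substitution:
  fixes f :: "real \<Rightarrow> complex"
  assumes m: "m > 0" and t: "t > 0" and f: "set_borel_measurable borel {0<..} f"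
  shows "set_integrable lborel {0<..<t} (EK_integrand m 0 a f t)
      \<longleftrightarrow> abel_integrable a (\<lambda>y. f (y powr (1 / m))) (t powr m)"
    and "(LINT s:{0<..<t}|lborel. EK_integrand m 0 a f t s)
      = abel_integral a (\<lambda>y. f (y powr (1 / m))) (t powr m)"
proof -
  define h where "h = (\<lambda>y. (t powr m - y) powr (a - 1) *\<^sub>R f (y powr (1 / m)))"
  have fm: "(\<lambda>s. indicator {0<..} s *\<^sub>R f s) \<in> borel_measurable borel"
    using f by (simp add: set_borel_measurable_def)
  have "(\<lambda>y. indicator {0<..<t powr m} y *\<^sub>R ((t powr m - y) powr (a - 1) *\<^sub>R
      (indicator {0<..} (y powr (1 / m)) *\<^sub>R f (y powr (1 / m))))) \<in> borel_measurable borel"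
    using measurable_compose [of "\<lambda>y. y powr (1 / m)" borel borel, OF _ fm] by measurable
  also have "(\<lambda>y. indicator {0<..<t powr m} y *\<^sub>R ((t powr m - y) powr (a - 1) *\<^sub>R
      (indicator {0<..} (y powr (1 / m)) *\<^sub>R f (y powr (1 / m))))) = (\<lambda>y. indicator {0<..<t powr m} y *\<^sub>R h y)"
    by (auto simp: fun_eq_iff indicator_def h_def)
  finally have h: "set_borel_measurable borel {0<..<t powr m} h"
    by (simp add: set_borel_measurable_def)
  have eq: "EK_integrand m 0 a f t s = (m * s powr (m - 1)) *\<^sub>R h (s powr m)" if "s \<in> {0<..<t}" for s
    using that m by (simp add: EK_integrand_def h_def powr_powr mult_ac)
  have "set_integrable lborel {0<..<t} (EK_integrand m 0 a f t)
     \<longleftrightarrow> set_integrable lborel {0<..<t} (\<lambda>s. (m * s powr (m - 1)) *\<^sub>R h (s powr m))"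
    by (rule set_integrable_cong [OF refl refl eq])
  also have "\<dots> \<longleftrightarrow> abel_integrable a (\<lambda>y. f (y powr (1 / m))) (t powr m)"
    unfolding abel_integrable_def substitution_powr_complex(1) [OF m t h] by (simp only: h_def)
  finally show "set_integrable lborel {0<..<t} (EK_integrand m 0 a f t)
      \<longleftrightarrow> abel_integrable a (\<lambda>y. f (y powr (1 / m))) (t powr m)" .
  have "(LINT s:{0<..<t}|lborel. EK_integrand m 0 a f t s)
     = (LINT s:{0<..<t}|lborel. (m * s powr (m - 1)) *\<^sub>R h (s powr m))"
    by (rule set_lebesgue_integral_cong) (use eq in auto)
  also have "\<dots> = abel_integral a (\<lambda>y. f (y powr (1 / m))) (t powr m)"
    unfolding abel_integral_def substitution_powr_complex(2) [OF m t h] by (simp only: h_def)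
  finally show "(LINT s:{0<..<t}|lborel. EK_integrand m 0 a f t s)
      = abel_integral a (\<lambda>y. f (y powr (1 / m))) (t powr m)" .
qed

lemma vector_derivative_seq_limit:
  fixes f :: "real \<Rightarrow> 'a::real_normed_vector"
  assumes "(f has_vector_derivative d) (at s)"
  shows "(\<lambda>n. (real n + 1) *\<^sub>R (f (s + 1 / (real n + 1)) - f s)) \<longlonglongrightarrow> d"
proof -
  let ?h = "\<lambda>n. 1 / (real n + 1)"
  have lim: "((\<lambda>h. norm (f (s + h) - f s - h *\<^sub>R d) / norm h) \<longlongrightarrow> 0) (at 0)"
    using assms unfolding has_vector_derivative_def has_derivative_at by simp
  have "?h \<longlonglongrightarrow> 0" by real_asymp
  then have "filterlim ?h (at 0) sequentially"
    by (simp add: filterlim_at)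
  from filterlim_compose [OF lim this]
  have "(\<lambda>n. norm (f (s + ?h n) - f s - ?h n *\<^sub>R d) / norm (?h n)) \<longlonglongrightarrow> 0" .
  moreover have "norm (f (s + ?h n) - f s - ?h n *\<^sub>R d) / norm (?h n)
      = norm ((real n + 1) *\<^sub>R (f (s + ?h n) - f s) - d)" for n
  proof -
    have "(real n + 1) *\<^sub>R (f (s + ?h n) - f s) - d = (real n + 1) *\<^sub>R (f (s + ?h n) - f s - ?h n *\<^sub>R d)"
      by (simp add: scaleR_diff_right)
    then show ?thesis by (simp only: norm_scaleR) (simp add: field_simps)
  qed
  ultimately have "(\<lambda>n. norm ((real n + 1) *\<^sub>R (f (s + ?h n) - f s) - d)) \<longlonglongrightarrow> 0" by simp
  then show ?thesis by (simp only: tendsto_norm_zero_iff LIM_zero_iff)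
qed

text \<open>
A derivative is the pointwise limit of difference quotients, hence Borel measurable even if it is
not continuous.  This makes the substitution below applicable to arbitrary solutions.
\<close>
lemma vector_derivative_measurable:
  fixes f :: "real \<Rightarrow> complex"
  assumes diff: "\<And>s. s > 0 \<Longrightarrow> f differentiable (at s)"
  shows "set_borel_measurable borel {0<..} f"
    and "set_borel_measurable borel {0<..} (\<lambda>s. vector_derivative f (at s))"
proof -
  have "continuous_on {0<..} f"
    using diff by (intro continuous_at_imp_continuous_on ballI differentiable_imp_continuous_within) auto
  then have fm: "(\<lambda>s. indicator {0<..} s *\<^sub>R f s) \<in> borel_measurable borel"
    by (intro borel_measurable_continuous_on_indicator) auto
  then show "set_borel_measurable borel {0<..} f" by (simp add: set_borel_measurable_def)
  let ?F = "\<lambda>s. indicator {0<..} s *\<^sub>R f s"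
  \<comment> \<open>difference quotients with increments to the right, which stay in the half line\<close>
  let ?D = "\<lambda>n s. indicator {0<..} s *\<^sub>R ((real n + 1) *\<^sub>R (?F (s + 1 / (real n + 1)) - ?F s))"
  have "(\<lambda>s. indicator {0<..} s *\<^sub>R vector_derivative f (at s)) \<in> borel_measurable borel"
  proof (rule borel_measurable_LIMSEQ_metric)
    show "?D n \<in> borel_measurable borel" for n
      using fm measurable_compose [OF _ fm, of "\<lambda>s. s + 1 / (real n + 1)" borel] by measurable
    show "(\<lambda>n. ?D n s) \<longlonglongrightarrow> indicator {0<..} s *\<^sub>R vector_derivative f (at s)" for s
    proof (cases "s > 0")
      case True
      then have "s + 1 / (real n + 1) > 0" for n by (simp add: add_pos_pos)
      moreover have "(f has_vector_derivative vector_derivative f (at s)) (at s)"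
        using diff [OF True] by (simp add: vector_derivative_works)
      ultimately show ?thesis
        using vector_derivative_seq_limit [of f "vector_derivative f (at s)" s] True by simp
    qed simp
  qed
  then show "set_borel_measurable borel {0<..} (\<lambda>s. vector_derivative f (at s))"
    by (simp add: set_borel_measurable_def)
qed

lemma abel_cong:
  assumes "\<And>y. 0 < y \<Longrightarrow> y < T \<Longrightarrow> f y = g y"
  shows "abel_integrable a f T = abel_integrable a g T" and "abel_integral a f T = abel_integral a g T"
proof -
  show "abel_integrable a f T = abel_integrable a g T"
    unfolding abel_integrable_def by (rule set_integrable_cong) (use assms in auto)
  show "abel_integral a f T = abel_integral a g T"
    unfolding abel_integral_def by (rule set_lebesgue_integral_cong) (use assms in auto)
qed

lemma abel_scaleR:
  assumes "c \<noteq> 0"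
  shows "abel_integrable a (\<lambda>y. c *\<^sub>R f y) T = abel_integrable a f T"
    and "abel_integral a (\<lambda>y. c *\<^sub>R f y) T = c *\<^sub>R abel_integral a f T"
proof -
  have eq: "(T - y) powr (a - 1) *\<^sub>R c *\<^sub>R f y = c *\<^sub>R ((T - y) powr (a - 1) *\<^sub>R f y)" for y
    by (simp add: mult.commute)
  show "abel_integrable a (\<lambda>y. c *\<^sub>R f y) T = abel_integrable a f T"
  proof -
    let ?X = "\<lambda>y. indicator {0<..<T} y *\<^sub>R ((T - y) powr (a - 1) *\<^sub>R f y)"
    have "integrable lborel (\<lambda>y. c *\<^sub>R ?X y) \<longleftrightarrow> integrable lborel ?X"
    proof
      assume "integrable lborel (\<lambda>y. c *\<^sub>R ?X y)"
      then have "integrable lborel (\<lambda>y. inverse c *\<^sub>R (c *\<^sub>R ?X y))"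
        by (rule integrable_scaleR_right)
      moreover have "inverse c *\<^sub>R (c *\<^sub>R z) = z" for z :: complex
        using assms by simp
      ultimately show "integrable lborel ?X" by (simp only:)
    qed (rule integrable_scaleR_right)
    then show ?thesis
      unfolding abel_integrable_def eq set_integrable_def by (simp only: scaleR_left_commute [of _ c])
  qed
  show "abel_integral a (\<lambda>y. c *\<^sub>R f y) T = c *\<^sub>R abel_integral a f T"
    unfolding abel_integral_def eq by (rule set_integral_scaleR_right)
qed

text \<open>
This is \<open>y G'(y)\<close> for \<open>G(y) = v (y\<^bsup>1/m\<^esup>)\<close>, expressed through the derivative of \<open>v\<close>.
\<close>
definition log_derivative :: "real \<Rightarrow> (real \<Rightarrow> complex) \<Rightarrow> real \<Rightarrow> complex" where
  "log_derivative m v y = (1 / m) *\<^sub>R (y powr (1 / m) *\<^sub>R vector_derivative v (at (y powr (1 / m))))"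

text \<open>
With \<open>y = s\<^bsup>2H\<^esup>\<close> the Caputo-like power becomes a combination of two Abel integrals of order
\<open>1 - \<alpha>\<close>, and the operator \<open>s d/ds\<close> becomes \<open>2H y d/dy\<close>.  Subtracting the constant initial value does not
change the derivative.
\<close>
lemma caputo_power_abel:
  fixes v :: "real \<Rightarrow> complex"
  assumes H: "0 < H" and \<alpha>: "0 < \<alpha>" "\<alpha> < 1" and t: "0 < t"
    and diff: "\<And>s. s > 0 \<Longrightarrow> v differentiable (at s)"
    and lim: "(v \<longlongrightarrow> l) (at_right 0)"
  defines "G \<equiv> \<lambda>y. v (y powr (1 / (2 * H))) - l" and "D \<equiv> log_derivative (2 * H) v" and "T \<equiv> t powr (2 * H)"
  shows "caputo_power_exists H \<alpha> v t \<longleftrightarrow> abel_integrable (1 - \<alpha>) G T \<and> abel_integrable (1 - \<alpha>) D T"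
    and "caputo_power H \<alpha> v t = ((2 * H) powr \<alpha> / (T * Gamma (1 - \<alpha>))) *\<^sub>R
      ((1 - \<alpha>) *\<^sub>R abel_integral (1 - \<alpha>) G T + abel_integral (1 - \<alpha>) D T)"
proof -
  have m: "2 * H > 0" using H by simp
  have reg: "regularize v = (\<lambda>s. v s - l)"
    using tendsto_Lim [OF _ lim] by (simp add: regularize_def fun_eq_iff)
  have diff': "(\<lambda>s. v s - l) differentiable (at s)" if "s > 0" for s
    using diff [OF that] by simp
  have vd: "vector_derivative (\<lambda>s. v s - l) (at s) = vector_derivative v (at s)" if "s > 0" for s
  proof -
    have "(v has_vector_derivative vector_derivative v (at s)) (at s)"
      using diff [OF that] by (simp add: vector_derivative_works)
    then have "((\<lambda>s. v s - l) has_vector_derivative vector_derivative v (at s) - 0) (at s)"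
      by (intro derivative_intros)
    then show ?thesis by (simp add: vector_derivative_at)
  qed
  let ?f = "\<lambda>s. s *\<^sub>R vector_derivative (\<lambda>s. v s - l) (at s)"
  note meas = vector_derivative_measurable [OF diff', simplified]
  have fm: "set_borel_measurable borel {0<..} ?f"
  proof -
    have "(\<lambda>s. s *\<^sub>R (indicator {0<..} s *\<^sub>R vector_derivative (\<lambda>s. v s - l) (at s))) \<in> borel_measurable borel"
      using meas(2) unfolding set_borel_measurable_def by measurable
    then show ?thesis by (simp add: set_borel_measurable_def scaleR_left_commute mult.commute)
  qed
  note G = EK_integrand_substitution [OF m t meas(1), of "1 - \<alpha>", folded G_def T_def]
  note F = EK_integrand_substitution [OF m t fm, of "1 - \<alpha>", folded T_def]
  have Deq: "D y = (1 / (2 * H)) *\<^sub>R ?f (y powr (1 / (2 * H)))" if "0 < y" for y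
    using vd [of "y powr (1 / (2 * H))"] that by (simp add: D_def log_derivative_def)
  have D1: "abel_integrable (1 - \<alpha>) D T = abel_integrable (1 - \<alpha>) (\<lambda>y. ?f (y powr (1 / (2 * H)))) T"
    using H by (subst abel_cong(1) [OF Deq]) (simp_all add: abel_scaleR(1) del: scaleR_scaleR)
  have D2: "abel_integral (1 - \<alpha>) D T = (1 / (2 * H)) *\<^sub>R abel_integral (1 - \<alpha>) (\<lambda>y. ?f (y powr (1 / (2 * H)))) T"
    using H by (subst abel_cong(2) [OF Deq]) (simp_all add: abel_scaleR(2) del: scaleR_scaleR)
  have ex: "EK_exists (2 * H) 0 (1 - \<alpha>) f t \<longleftrightarrow> set_integrable lborel {0<..<t} (EK_integrand (2 * H) 0 (1 - \<alpha>) f t)" for f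
    using \<alpha> by (subst EK_exists.simps) simp
  have "EK_exists (2 * H) 0 (- \<alpha>) (regularize v) t \<longleftrightarrow>
      (\<forall>s\<in>{0<..<t}. (\<lambda>s. v s - l) differentiable at s) \<and>
      EK_exists (2 * H) 0 (1 - \<alpha>) (\<lambda>s. v s - l) t \<and> EK_exists (2 * H) 0 (1 - \<alpha>) ?f t"
    unfolding reg using \<alpha> by (subst EK_exists.simps) (simp add: add.commute [of "- \<alpha>"])
  also have "\<dots> \<longleftrightarrow> abel_integrable (1 - \<alpha>) G T \<and> abel_integrable (1 - \<alpha>) D T"
    unfolding ex G(1) F(1) D1 using diff' by auto
  finally show "caputo_power_exists H \<alpha> v t \<longleftrightarrow> abel_integrable (1 - \<alpha>) G T \<and> abel_integrable (1 - \<alpha>) D T"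
    unfolding caputo_power_exists_def using lim by auto
  define c where "c = t powr (- (2 * H * (1 - \<alpha>))) / Gamma (1 - \<alpha>)"
  have ek: "erdelyi_kober (2 * H) 0 (1 - \<alpha>) f t = c *\<^sub>R (LINT s:{0<..<t}|lborel. EK_integrand (2 * H) 0 (1 - \<alpha>) f t s)" for f
    using \<alpha> by (subst erdelyi_kober.simps) (simp add: c_def)
  have "erdelyi_kober (2 * H) 0 (- \<alpha>) (regularize v) t =
      (1 - \<alpha>) *\<^sub>R erdelyi_kober (2 * H) 0 (1 - \<alpha>) (\<lambda>s. v s - l) t
      + (1 / (2 * H)) *\<^sub>R erdelyi_kober (2 * H) 0 (1 - \<alpha>) ?f t"
    unfolding reg using \<alpha> by (subst erdelyi_kober.simps) (simp add: add.commute [of "- \<alpha>"])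
  also have "\<dots> = c *\<^sub>R ((1 - \<alpha>) *\<^sub>R abel_integral (1 - \<alpha>) G T + abel_integral (1 - \<alpha>) D T)"
    unfolding ek G(2) F(2) D2 by (simp add: scaleR_add_right mult.commute)
  finally have "caputo_power H \<alpha> v t = ((2 * H) powr \<alpha> * t powr (- (2 * H * \<alpha>)) * c) *\<^sub>R
      ((1 - \<alpha>) *\<^sub>R abel_integral (1 - \<alpha>) G T + abel_integral (1 - \<alpha>) D T)"
    by (simp add: caputo_power_def mcbride_power_def)
  moreover have "(2 * H) powr \<alpha> * t powr (- (2 * H * \<alpha>)) * c = (2 * H) powr \<alpha> / (T * Gamma (1 - \<alpha>))"
  proof -
    have "t powr (- (2 * H * \<alpha>)) * t powr (- (2 * H * (1 - \<alpha>))) = t powr (- (2 * H))"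
      by (simp add: powr_add [symmetric] algebra_simps)
    also have "\<dots> = 1 / T" by (simp add: T_def powr_minus_divide)
    finally have *: "t powr (- (2 * H * \<alpha>)) * t powr (- (2 * H * (1 - \<alpha>))) = 1 / T" .
    have "(2 * H) powr \<alpha> * t powr (- (2 * H * \<alpha>)) * c
        = (2 * H) powr \<alpha> * (t powr (- (2 * H * \<alpha>)) * t powr (- (2 * H * (1 - \<alpha>)))) / Gamma (1 - \<alpha>)"
      by (simp add: c_def)
    then show ?thesis unfolding * by simp
  qed
  ultimately show "caputo_power H \<alpha> v t = ((2 * H) powr \<alpha> / (T * Gamma (1 - \<alpha>))) *\<^sub>R
      ((1 - \<alpha>) *\<^sub>R abel_integral (1 - \<alpha>) G T + abel_integral (1 - \<alpha>) D T)"
    by simp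
qed

text \<open>
Abel integrals of powers are Beta integrals, and on \<open>0 < y < T\<close> the series is dominated by its value at
\<open>T\<close>.
\<close>
lemma abel_power_series:
  fixes c :: "nat \<Rightarrow> real"
  assumes \<alpha>: "0 < \<alpha>" "\<alpha> < 1" and T: "0 < T" and c: "summable (\<lambda>k. \<bar>c k\<bar> * T powr (\<alpha> * real k))"
  shows "abel_integrable (1 - \<alpha>) (\<lambda>y. of_real (\<Sum>k. c k * y powr (\<alpha> * real k))) T"
    and "(\<lambda>k. of_real (c k * (T powr (1 - \<alpha> + \<alpha> * real k) * Beta (1 - \<alpha>) (\<alpha> * real k + 1)))) sums
      abel_integral (1 - \<alpha>) (\<lambda>y. of_real (\<Sum>k. c k * y powr (\<alpha> * real k))) T"
proof -
  let ?S = "{0<..<T}"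
  let ?f = "\<lambda>k y. indicator ?S y *\<^sub>R ((T - y) powr (1 - \<alpha> - 1) *\<^sub>R complex_of_real (c k * y powr (\<alpha> * real k)))"
  let ?F = "\<lambda>y. indicator ?S y *\<^sub>R ((T - y) powr (1 - \<alpha> - 1) *\<^sub>R complex_of_real (\<Sum>k. c k * y powr (\<alpha> * real k)))"
  let ?B = "\<Sum>k. \<bar>c k\<bar> * T powr (\<alpha> * real k)"
  let ?g = "\<lambda>y. (indicator ?S y *\<^sub>R (T - y) powr (1 - \<alpha> - 1)) * ?B"
  have le: "\<bar>c k * y powr (\<alpha> * real k)\<bar> \<le> \<bar>c k\<bar> * T powr (\<alpha> * real k)" if "y \<in> ?S" for y k
    using that \<alpha> by (auto simp: abs_mult intro!: mult_left_mono powr_mono2)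
  have beta: "has_bochner_integral lborel (\<lambda>y. indicator ?S y *\<^sub>R ((T - y) powr (1 - \<alpha> - 1) * y powr (\<alpha> * real k)))
      (T powr (1 - \<alpha> + \<alpha> * real k) * Beta (1 - \<alpha>) (\<alpha> * real k + 1))" for k
  proof -
    have p: "0 < 1 - \<alpha>" "0 < \<alpha> * real k + 1" using \<alpha> by (auto intro: add_nonneg_pos)
    have e: "1 - \<alpha> + (\<alpha> * real k + 1) - 1 = 1 - \<alpha> + \<alpha> * real k" by simp
    show ?thesis
      using beta_integral_affine [OF T p]
      by (simp only: has_bochner_integral_iff set_integrable_def set_lebesgue_integral_def
          diff_zero add_diff_cancel_right' e)
  qed
  have f: "has_bochner_integral lborel (?f k)
      (of_real (c k * (T powr (1 - \<alpha> + \<alpha> * real k) * Beta (1 - \<alpha>) (\<alpha> * real k + 1))))" for k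
  proof -
    have "has_bochner_integral lborel (\<lambda>y. complex_of_real (c k * (indicator ?S y *\<^sub>R ((T - y) powr (1 - \<alpha> - 1) * y powr (\<alpha> * real k)))))
        (of_real (c k * (T powr (1 - \<alpha> + \<alpha> * real k) * Beta (1 - \<alpha>) (\<alpha> * real k + 1))))"
      by (intro has_bochner_integral_of_real has_bochner_integral_mult_right beta)
    moreover have "complex_of_real (c k * (indicator ?S y *\<^sub>R ((T - y) powr (1 - \<alpha> - 1) * y powr (\<alpha> * real k)))) = ?f k y" for y
      by (simp add: scaleR_conv_of_real mult_ac)
    ultimately show ?thesis by simp
  qed
  have fi: "integrable lborel (?f k)"
    and fv: "integral\<^sup>L lborel (?f k) = of_real (c k * (T powr (1 - \<alpha> + \<alpha> * real k) * Beta (1 - \<alpha>) (\<alpha> * real k + 1)))" for k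
    using f [of k] by (simp_all only: has_bochner_integral_iff)
  have Fm: "?F \<in> borel_measurable lborel" by measurable
  have gi: "integrable lborel ?g"
    using abel_kernel_integrable [OF T, of "1 - \<alpha>"] \<alpha> unfolding set_integrable_def
    by (intro integrable_mult_left) simp
  have sums: "(\<lambda>k. ?f k y) sums ?F y" for y
  proof (cases "y \<in> ?S")
    case True
    have "summable (\<lambda>k. c k * y powr (\<alpha> * real k))"
      by (rule summable_comparison_test' [OF c, of 0]) (use le [OF True] in simp)
    then show ?thesis
      by (intro sums_scaleR_right sums_of_real summable_sums)
  qed simp
  have bound: "norm (\<Sum>k<n. ?f k y) \<le> ?g y" for n y
  proof (cases "y \<in> ?S")
    case True
    have "norm (\<Sum>k<n. ?f k y) \<le> (\<Sum>k<n. (T - y) powr (1 - \<alpha> - 1) * (\<bar>c k\<bar> * T powr (\<alpha> * real k)))"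
      using le [OF True] True
      by (intro order_trans [OF norm_sum] sum_mono) (auto simp del: of_real_mult intro!: mult_left_mono)
    also have "\<dots> = (T - y) powr (1 - \<alpha> - 1) * (\<Sum>k<n. \<bar>c k\<bar> * T powr (\<alpha> * real k))"
      by (simp add: sum_distrib_left)
    also have "\<dots> \<le> (T - y) powr (1 - \<alpha> - 1) * ?B"
      by (intro mult_left_mono sum_le_suminf c) auto
    finally show ?thesis using True by simp
  qed simp
  note * = integral_sums_dominated [OF fi Fm gi AE_I2 [OF sums] AE_I2 [OF bound]]
  show "abel_integrable (1 - \<alpha>) (\<lambda>y. of_real (\<Sum>k. c k * y powr (\<alpha> * real k))) T"
    using *(1) by (simp only: abel_integrable_def set_integrable_def)
  show "(\<lambda>k. of_real (c k * (T powr (1 - \<alpha> + \<alpha> * real k) * Beta (1 - \<alpha>) (\<alpha> * real k + 1)))) sums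
      abel_integral (1 - \<alpha>) (\<lambda>y. of_real (\<Sum>k. c k * y powr (\<alpha> * real k))) T"
    using *(2) unfolding fv by (simp only: abel_integral_def set_lebesgue_integral_def)
qed

section \<open>The Mittag-Leffler function solves the fractional equation\<close>

lemma mittag_leffler_sums:
  assumes "0 < \<alpha>" "\<alpha> < 1"
  shows "(\<lambda>n. rGamma (1 + \<alpha> * real n) * x ^ n) sums mittag_leffler \<alpha> x"
  unfolding mittag_leffler_def
  using summable_norm_cancel [OF summable_mittag_leffler [OF assms]] by (rule summable_sums)

text \<open>
Multiplying the derivative by \<open>x\<close> restores the original powers, so that \<open>y G'(y)\<close> is again a
series in the same powers of \<open>y\<close> as \<open>G(y)\<close>.
\<close>
lemma mittag_leffler_derivative:
  assumes \<alpha>: "0 < \<alpha>" "\<alpha> < 1"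
  obtains E' where "\<And>x. (mittag_leffler \<alpha> has_real_derivative E' x) (at x)"
    and "\<And>x. (\<lambda>n. real n * (rGamma (1 + \<alpha> * real n) * x ^ n)) sums (x * E' x)"
proof
  let ?c = "\<lambda>n. rGamma (1 + \<alpha> * real n)"
  let ?E' = "\<lambda>x. \<Sum>n. diffs ?c n * x ^ n"
  have s: "summable (\<lambda>n. ?c n * x ^ n)" for x
    using summable_mittag_leffler [OF \<alpha>, of x] by (rule summable_norm_cancel)
  show "(mittag_leffler \<alpha> has_real_derivative ?E' x) (at x)" for x
    unfolding mittag_leffler_def [abs_def] by (rule termdiffs_strong_converges_everywhere [OF s])
  show "(\<lambda>n. real n * (?c n * x ^ n)) sums (x * ?E' x)" for x
  proof -
    have "(\<lambda>n. x * (real n * ?c n * x ^ (n - Suc 0))) sums (x * ?E' x)"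
      by (intro sums_mult diffs_equiv termdiff_converges_all s)
    moreover have "x * (real n * ?c n * x ^ (n - Suc 0)) = real n * (?c n * x ^ n)" for n
      by (cases n) auto
    ultimately show ?thesis by simp
  qed
qed

lemma mittag_leffler_0: "mittag_leffler \<alpha> 0 = 1"
  unfolding mittag_leffler_def by (subst suminf_finite [of "{0}"]) auto

lemma rGamma_pos: "x > 0 \<Longrightarrow> rGamma (x::real) > 0"
  by (simp add: rGamma_inverse_Gamma Gamma_real_pos)

text \<open>
Both Abel integrals are evaluated term by term.  The term with index \<open>k + 1\<close> carries the factor
\<open>(1 + \<alpha> k) / \<Gamma> (2 + \<alpha> k) = 1 / \<Gamma> (1 + \<alpha> k)\<close>, so the operator shifts the series by one index, which
reproduces \<open>v\<close> up to a constant factor.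
\<close>
lemma caputo_mittag_leffler:
  fixes v :: "real \<Rightarrow> complex"
  assumes H: "0 < H" and \<alpha>: "0 < \<alpha>" "\<alpha> < 1"
    and v: "\<And>t. 0 < t \<Longrightarrow> v t = of_real (mittag_leffler \<alpha> (- (\<mu> * t powr (2 * H * \<alpha>))))"
  shows "(v \<longlongrightarrow> 1) (at_right 0)"
    and "\<And>s. 0 < s \<Longrightarrow> v differentiable (at s)"
    and "\<And>t. 0 < t \<Longrightarrow> caputo_power_exists H \<alpha> v t"
    and "\<And>t. 0 < t \<Longrightarrow> caputo_power H \<alpha> v t = - of_real ((2 * H) powr \<alpha> * \<mu>) * v t"
proof -
  let ?m = "2 * H"
  have m: "0 < ?m" using H by simp
  obtain E' where E': "\<And>x. (mittag_leffler \<alpha> has_real_derivative E' x) (at x)"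
    and E's: "\<And>x. (\<lambda>n. real n * (rGamma (1 + \<alpha> * real n) * x ^ n)) sums (x * E' x)"
    using mittag_leffler_derivative [OF \<alpha>] by blast
  let ?x = "\<lambda>t. - (\<mu> * t powr (2 * H * \<alpha>))"
  have v_lim: "((\<lambda>t. mittag_leffler \<alpha> (?x t)) \<longlongrightarrow> 1) (at_right 0)"
  proof -
    have "((\<lambda>t. t powr (2 * H * \<alpha>)) \<longlongrightarrow> 0 powr (2 * H * \<alpha>)) (at_right 0)"
      using m \<alpha> by (intro tendsto_powr2 tendsto_intros) (auto simp: eventually_at_filter)
    then have "(?x \<longlongrightarrow> - (\<mu> * 0)) (at_right 0)"
      by (intro tendsto_intros) simp
    then have "((\<lambda>t. mittag_leffler \<alpha> (?x t)) \<longlongrightarrow> mittag_leffler \<alpha> 0) (at_right 0)"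
      using DERIV_isCont [OF E', of 0] by (intro isCont_tendsto_compose [of 0 "mittag_leffler \<alpha>"]) auto
    then show ?thesis by (simp add: mittag_leffler_0)
  qed
  show lim: "(v \<longlongrightarrow> 1) (at_right 0)"
  proof (rule Lim_transform_eventually)
    show "((\<lambda>t. complex_of_real (mittag_leffler \<alpha> (?x t))) \<longlongrightarrow> 1) (at_right 0)"
      using tendsto_of_real [OF v_lim, where 'a = complex] by simp
    show "\<forall>\<^sub>F t in at_right 0. complex_of_real (mittag_leffler \<alpha> (?x t)) = v t"
      using v by (auto simp: eventually_at_filter)
  qed
  have vd: "(v has_vector_derivative of_real (E' (?x s) * (- (\<mu> * (2 * H * \<alpha> * s powr (2 * H * \<alpha> - 1)))))) (at s)"
    if s: "0 < s" for s
  proof -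
    have 1: "((\<lambda>t. mittag_leffler \<alpha> (?x t)) has_real_derivative E' (?x s) * (- (\<mu> * (2 * H * \<alpha> * s powr (2 * H * \<alpha> - 1))))) (at s)"
      by (rule DERIV_chain2 [OF E']) (use s in \<open>auto intro!: derivative_eq_intros simp: powr_diff field_simps\<close>)
    have "((\<lambda>t. complex_of_real (mittag_leffler \<alpha> (?x t))) has_vector_derivative
        of_real (E' (?x s) * (- (\<mu> * (2 * H * \<alpha> * s powr (2 * H * \<alpha> - 1)))))) (at s)"
      using 1 by (intro has_vector_derivative_of_real) (simp add: has_real_derivative_iff_has_vector_derivative)
    then show ?thesis
      by (rule has_vector_derivative_transform_within_open [of _ _ _ "{0<..}"]) (use s v in auto)
  qed
  show diff: "v differentiable (at s)" if "0 < s" for s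
    using vd [OF that] by (rule differentiableI_vector)
  define G where "G = (\<lambda>y. v (y powr (1 / ?m)) - 1)"
  define D where "D = log_derivative ?m v"
  \<comment> \<open>the coefficients of the regularized function: subtracting the initial value \<open>1\<close> removes the term with index \<open>0\<close>\<close>
  define c where "c = (\<lambda>k::nat. if k = 0 then 0 else (- \<mu>) ^ k * rGamma (1 + \<alpha> * real k))"
  let ?d = "\<lambda>k. \<alpha> * real k * c k"
  have xy: "(- (\<mu> * y powr \<alpha>)) ^ k = (- \<mu>) ^ k * y powr (\<alpha> * real k)" if "0 < y" for y k
  proof -
    have "(- (\<mu> * y powr \<alpha>)) ^ k = (- \<mu>) ^ k * (y powr \<alpha>) ^ k"
      by (simp flip: power_mult_distrib)
    then show ?thesis using that by (simp add: powr_power mult.commute)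
  qed
  have ypow: "(y powr (1 / ?m)) powr (2 * H * \<alpha>) = y powr \<alpha>" for y
    using H by (simp add: powr_powr)
  have Gsums: "(\<lambda>k. c k * y powr (\<alpha> * real k)) sums (mittag_leffler \<alpha> (- (\<mu> * y powr \<alpha>)) - 1)" if y: "0 < y" for y
  proof -
    let ?z = "- (\<mu> * y powr \<alpha>)"
    have "(\<lambda>k. rGamma (1 + \<alpha> * real k) * ?z ^ k) sums mittag_leffler \<alpha> ?z"
      by (rule mittag_leffler_sums [OF \<alpha>])
    moreover have "(\<lambda>k. if k = 0 then 1 else 0 :: real) sums 1"
      using sums_single [of 0 "\<lambda>_. 1 :: real"] by simp
    ultimately have "(\<lambda>k. rGamma (1 + \<alpha> * real k) * ?z ^ k - (if k = 0 then 1 else 0)) sums (mittag_leffler \<alpha> ?z - 1)"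
      by (rule sums_diff)
    moreover have "rGamma (1 + \<alpha> * real k) * ?z ^ k - (if k = 0 then 1 else 0) = c k * y powr (\<alpha> * real k)" for k
      using y by (simp add: c_def xy del: power_minus')
    ultimately show ?thesis by simp
  qed
  have Dsums: "(\<lambda>k. ?d k * y powr (\<alpha> * real k)) sums (\<alpha> * (- (\<mu> * y powr \<alpha>) * E' (- (\<mu> * y powr \<alpha>))))" if y: "0 < y" for y
  proof -
    have "(\<lambda>k. \<alpha> * (real k * (rGamma (1 + \<alpha> * real k) * (- (\<mu> * y powr \<alpha>)) ^ k))) sums
        (\<alpha> * (- (\<mu> * y powr \<alpha>) * E' (- (\<mu> * y powr \<alpha>))))"
      by (intro sums_mult E's)
    moreover have "\<alpha> * (real k * (rGamma (1 + \<alpha> * real k) * (- (\<mu> * y powr \<alpha>)) ^ k)) = ?d k * y powr (\<alpha> * real k)" for k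
      using y by (simp add: c_def xy del: power_minus')
    ultimately show ?thesis by simp
  qed
  have Gy: "G y = of_real (\<Sum>k. c k * y powr (\<alpha> * real k))" if y: "0 < y" for y
    using Gsums [OF y] v [of "y powr (1 / ?m)"] y ypow by (simp add: sums_iff G_def)
  have Dy: "D y = of_real (\<Sum>k. ?d k * y powr (\<alpha> * real k))" if y: "0 < y" for y
  proof -
    let ?s = "y powr (1 / ?m)"
    have s: "0 < ?s" using y by simp
    have "?s * ?s powr (2 * H * \<alpha> - 1) = ?s powr (2 * H * \<alpha>)"
      using s by (simp add: powr_mult_base)
    then have sy: "?s * ?s powr (2 * H * \<alpha> - 1) = y powr \<alpha>" using ypow by simp
    have "D y = of_real ((1 / ?m) * (?s * (E' (?x ?s) * (- (\<mu> * (2 * H * \<alpha> * ?s powr (2 * H * \<alpha> - 1)))))))"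
      unfolding D_def log_derivative_def vector_derivative_at [OF vd [OF s]]
      by (simp only: scaleR_conv_of_real of_real_mult)
    also have "(1 / ?m) * (?s * (E' (?x ?s) * (- (\<mu> * (2 * H * \<alpha> * ?s powr (2 * H * \<alpha> - 1))))))
       = \<alpha> * (- (\<mu> * (?s * ?s powr (2 * H * \<alpha> - 1))) * E' (?x ?s))"
      using H by (simp add: field_simps)
    also have "\<dots> = \<alpha> * (- (\<mu> * y powr \<alpha>) * E' (- (\<mu> * y powr \<alpha>)))"
      unfolding sy ypow ..
    also have "\<dots> = (\<Sum>k. ?d k * y powr (\<alpha> * real k))"
      using Dsums [OF y] by (simp add: sums_iff)
    finally show ?thesis .
  qed
  have csum: "summable (\<lambda>k. \<bar>c k\<bar> * y powr (\<alpha> * real k))" and dsum: "summable (\<lambda>k. \<bar>?d k\<bar> * y powr (\<alpha> * real k))"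
    if y: "0 < y" for y
  proof -
    let ?z = "\<bar>\<mu>\<bar> * y powr \<alpha>"
    have z: "?z ^ k = \<bar>\<mu>\<bar> ^ k * y powr (\<alpha> * real k)" for k
      using y by (simp add: power_mult_distrib powr_power mult.commute)
    have rG: "\<bar>rGamma (1 + \<alpha> * real k)\<bar> = rGamma (1 + \<alpha> * real k)" for k
      using rGamma_pos [of "1 + \<alpha> * real k"] \<alpha> by (simp add: add_pos_nonneg)
    have le: "\<bar>c k\<bar> * y powr (\<alpha> * real k) \<le> rGamma (1 + \<alpha> * real k) * ?z ^ k" for k
      unfolding z using rG [of k] by (simp add: c_def abs_mult power_abs)
    show "summable (\<lambda>k. \<bar>c k\<bar> * y powr (\<alpha> * real k))"
      by (rule summable_comparison_test' [OF summable_norm_cancel [OF summable_mittag_leffler [OF \<alpha>, of ?z]], of 0])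
         (use le in simp)
    have "\<bar>?d k\<bar> * y powr (\<alpha> * real k) \<le> \<alpha> * (real k * (rGamma (1 + \<alpha> * real k) * ?z ^ k))" for k
      using mult_left_mono [OF le [of k], of "\<alpha> * real k"] \<alpha> by (simp add: abs_mult mult_ac)
    then show "summable (\<lambda>k. \<bar>?d k\<bar> * y powr (\<alpha> * real k))"
      by (intro summable_comparison_test' [OF summable_mult [OF sums_summable [OF E's [of ?z]], of \<alpha>], of 0])
         (simp add: abs_mult)
  qed
  fix t :: real assume t: "0 < t"
  define T where "T = t powr (2 * H)"
  have T: "0 < T" using t by (simp add: T_def)
  note g = abel_power_series [OF \<alpha> T csum [OF T]] and d = abel_power_series [OF \<alpha> T dsum [OF T]]
  have Ga: "abel_integrable (1 - \<alpha>) G T = abel_integrable (1 - \<alpha>) (\<lambda>y. of_real (\<Sum>k. c k * y powr (\<alpha> * real k))) T"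
      "abel_integral (1 - \<alpha>) G T = abel_integral (1 - \<alpha>) (\<lambda>y. of_real (\<Sum>k. c k * y powr (\<alpha> * real k))) T"
    by (intro abel_cong Gy; assumption)+
  have Da: "abel_integrable (1 - \<alpha>) D T = abel_integrable (1 - \<alpha>) (\<lambda>y. of_real (\<Sum>k. ?d k * y powr (\<alpha> * real k))) T"
      "abel_integral (1 - \<alpha>) D T = abel_integral (1 - \<alpha>) (\<lambda>y. of_real (\<Sum>k. ?d k * y powr (\<alpha> * real k))) T"
    by (intro abel_cong Dy; assumption)+
  have cap1: "caputo_power_exists H \<alpha> v t \<longleftrightarrow> abel_integrable (1 - \<alpha>) G T \<and> abel_integrable (1 - \<alpha>) D T"
    unfolding G_def D_def T_def by (rule caputo_power_abel(1) [OF H \<alpha> t diff lim])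
  have cap2: "caputo_power H \<alpha> v t = ((2 * H) powr \<alpha> / (T * Gamma (1 - \<alpha>))) *\<^sub>R
      ((1 - \<alpha>) *\<^sub>R abel_integral (1 - \<alpha>) G T + abel_integral (1 - \<alpha>) D T)"
    unfolding G_def D_def T_def by (rule caputo_power_abel(2) [OF H \<alpha> t diff lim])
  show "caputo_power_exists H \<alpha> v t"
    using cap1 Ga(1) Da(1) g(1) d(1) by simp
  let ?S = "(1 - \<alpha>) *\<^sub>R abel_integral (1 - \<alpha>) G T + abel_integral (1 - \<alpha>) D T"
  let ?B = "\<lambda>k. T powr (1 - \<alpha> + \<alpha> * real k) * Beta (1 - \<alpha>) (\<alpha> * real k + 1)"
  have "(\<lambda>k. (1 - \<alpha>) *\<^sub>R of_real (c k * ?B k) + of_real (?d k * ?B k)) sums ?S"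
    unfolding Ga(2) Da(2) by (intro sums_add sums_scaleR_right g(2) d(2))
  moreover have "(1 - \<alpha>) *\<^sub>R of_real (c k * ?B k) + of_real (?d k * ?B k)
      = complex_of_real ((1 - \<alpha> + \<alpha> * real k) * c k * ?B k)" for k
    by (simp add: scaleR_conv_of_real algebra_simps)
  ultimately have "(\<lambda>k. complex_of_real ((1 - \<alpha> + \<alpha> * real k) * c k * ?B k)) sums ?S" by simp
  \<comment> \<open>the vanishing term with index \<open>0\<close> is dropped, which makes the index shift visible\<close>
  then have "(\<lambda>k. complex_of_real ((1 - \<alpha> + \<alpha> * real (Suc k)) * c (Suc k) * ?B (Suc k))) sums ?S"
    by (subst sums_Suc_iff) (simp add: c_def)
  moreover have "(1 - \<alpha> + \<alpha> * real (Suc k)) * c (Suc k) * ?B (Suc k)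
     = - (\<mu> * T * Gamma (1 - \<alpha>)) * (rGamma (1 + \<alpha> * real k) * (- (\<mu> * T powr \<alpha>)) ^ k)" for k
  proof -
    let ?a = "1 + \<alpha> * real k"
    have a: "0 < ?a" using \<alpha> by (simp add: add_pos_nonneg)
    have e: "1 - \<alpha> + \<alpha> * real (Suc k) = ?a" "1 - \<alpha> + (\<alpha> * real (Suc k) + 1) = ?a + 1"
      "\<alpha> * real (Suc k) + 1 = 1 + \<alpha> * real (Suc k)"
      by (simp_all add: algebra_simps)
    have beta: "Beta (1 - \<alpha>) (\<alpha> * real (Suc k) + 1) = Gamma (1 - \<alpha>) * Gamma (1 + \<alpha> * real (Suc k)) * rGamma (?a + 1)"
    proof -
      have "1 - \<alpha> + (\<alpha> * real (Suc k) + 1) = ?a + 1" by (simp add: algebra_simps)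
      then show ?thesis unfolding Beta_altdef by (simp only: add.commute [of _ "1 :: real"])
    qed
    have pos: "Gamma (1 + \<alpha> * real (Suc k)) * rGamma (1 + \<alpha> * real (Suc k)) = 1"
    proof -
      have "0 < rGamma (1 + \<alpha> * real (Suc k))"
        using \<alpha> by (intro rGamma_pos add_pos_nonneg) auto
      then show ?thesis by (simp add: Gamma_def)
    qed
    have "(1 - \<alpha> + \<alpha> * real (Suc k)) * c (Suc k) * ?B (Suc k)
      = (- \<mu>) ^ Suc k * (Gamma (1 + \<alpha> * real (Suc k)) * rGamma (1 + \<alpha> * real (Suc k)))
          * Gamma (1 - \<alpha>) * T powr ?a * (?a * rGamma (?a + 1))"
      unfolding e(1) beta by (simp add: c_def)
    also have "\<dots> = (- \<mu>) ^ Suc k * Gamma (1 - \<alpha>) * T powr ?a * rGamma ?a"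
      unfolding pos rGamma_plus1 by simp
    also have "T powr ?a = T * T powr (\<alpha> * real k)"
      using T by (simp add: powr_add)
    also have "(- \<mu>) ^ Suc k * Gamma (1 - \<alpha>) * (T * T powr (\<alpha> * real k)) * rGamma ?a
      = - (\<mu> * T * Gamma (1 - \<alpha>)) * (rGamma ?a * ((- \<mu>) ^ k * T powr (\<alpha> * real k)))"
      by simp
    finally show ?thesis unfolding xy [OF T] .
  qed
  ultimately have "(\<lambda>k. complex_of_real (- (\<mu> * T * Gamma (1 - \<alpha>)) * (rGamma (1 + \<alpha> * real k) * (- (\<mu> * T powr \<alpha>)) ^ k))) sums ?S"
    by (simp only:)
  moreover have "(\<lambda>k. complex_of_real (- (\<mu> * T * Gamma (1 - \<alpha>)) * (rGamma (1 + \<alpha> * real k) * (- (\<mu> * T powr \<alpha>)) ^ k))) sums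
      of_real (- (\<mu> * T * Gamma (1 - \<alpha>)) * mittag_leffler \<alpha> (- (\<mu> * T powr \<alpha>)))"
    by (intro sums_of_real sums_mult mittag_leffler_sums [OF \<alpha>])
  ultimately have S: "?S = of_real (- (\<mu> * T * Gamma (1 - \<alpha>)) * mittag_leffler \<alpha> (- (\<mu> * T powr \<alpha>)))"
    by (rule sums_unique2)
  have G0: "Gamma (1 - \<alpha>) \<noteq> 0" using rGamma_pos [of "1 - \<alpha>"] \<alpha> by (auto simp: Gamma_def)
  have "T powr \<alpha> = t powr (2 * H * \<alpha>)" by (simp add: T_def powr_powr)
  then have vt: "v t = of_real (mittag_leffler \<alpha> (- (\<mu> * T powr \<alpha>)))" using v [OF t] by simp
  have "caputo_power H \<alpha> v t = of_real ((2 * H) powr \<alpha> / (T * Gamma (1 - \<alpha>)) *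
      (- (\<mu> * T * Gamma (1 - \<alpha>)) * mittag_leffler \<alpha> (- (\<mu> * T powr \<alpha>))))"
    unfolding cap2 S by (simp only: scaleR_conv_of_real of_real_mult)
  also have "(2 * H) powr \<alpha> / (T * Gamma (1 - \<alpha>)) *
      (- (\<mu> * T * Gamma (1 - \<alpha>)) * mittag_leffler \<alpha> (- (\<mu> * T powr \<alpha>)))
      = - ((2 * H) powr \<alpha> * \<mu>) * mittag_leffler \<alpha> (- (\<mu> * T powr \<alpha>))"
    using T G0 by (simp add: field_simps)
  finally show "caputo_power H \<alpha> v t = - of_real ((2 * H) powr \<alpha> * \<mu>) * v t"
    unfolding vt by simp
qed

section \<open>Abel inversion and a Volterra equation\<close>

text \<open>
Abel integrals of complementary orders compose to an ordinary integral: after exchanging the order of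
integration, the inner integral \<open>\<integral>\<^sub>y\<^sup>X (X - T)\<^bsup>\<alpha>-1\<^esup> (T - y)\<^bsup>-\<alpha>\<^esup> dT\<close> is a Beta value independent of
\<open>y\<close>.
\<close>
lemma abel_inversion:
  fixes \<phi> :: "real \<Rightarrow> complex"
  assumes \<alpha>: "0 < \<alpha>" "\<alpha> < 1" and \<phi>: "set_integrable lborel {0<..<X} \<phi>"
  shows "abel_integral \<alpha> (abel_integral (1 - \<alpha>) \<phi>) X = Beta \<alpha> (1 - \<alpha>) *\<^sub>R (LINT y:{0<..<X}|lborel. \<phi> y)"
proof -
  let ?B = "Beta \<alpha> (1 - \<alpha>)"
  define \<psi> where "\<psi> = (\<lambda>y. indicator {0<..<X} y *\<^sub>R \<phi> y)"
  define k where "k = (\<lambda>y T. if y < T \<and> T < X then (X - T) powr (\<alpha> - 1) * (T - y) powr (1 - \<alpha> - 1) else 0 :: real)"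
  have \<psi>i: "integrable lborel \<psi>" using \<phi> by (simp add: \<psi>_def set_integrable_def)
  then have [measurable]: "\<psi> \<in> borel_measurable borel" by simp
  have kb: "has_bochner_integral lborel (k y) ?B" if "y < X" for y
  proof -
    have p: "0 < 1 - \<alpha>" using \<alpha> by simp
    have "indicator {y<..<X} T *\<^sub>R ((X - T) powr (\<alpha> - 1) * (T - y) powr (1 - \<alpha> - 1)) = k y T" for T
      by (simp add: k_def indicator_def)
    then show ?thesis
      using beta_integral_affine [OF that \<alpha>(1) p] that
      by (simp add: has_bochner_integral_iff set_integrable_def set_lebesgue_integral_def)
  qed
  have k0: "0 \<le> k y T" for y T by (simp add: k_def)
  have inner: "has_bochner_integral lborel (\<lambda>T. k y T *\<^sub>R \<psi> y) (?B *\<^sub>R \<psi> y)" for y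
  proof (cases "y < X")
    case True
    then show ?thesis by (intro has_bochner_integral_scaleR_left kb)
  next
    case False
    then have "\<psi> y = 0" by (simp add: \<psi>_def)
    then show ?thesis by (simp add: has_bochner_integral_zero)
  qed
  have innern: "(LINT T|lborel. norm (k y T *\<^sub>R \<psi> y)) = ?B * norm (\<psi> y)" for y
  proof (cases "y < X")
    case True
    have "has_bochner_integral lborel (\<lambda>T. k y T * norm (\<psi> y)) (?B * norm (\<psi> y))"
      by (intro has_bochner_integral_mult_left kb True)
    then show ?thesis using k0 by (simp add: has_bochner_integral_iff)
  next
    case False
    then have "\<psi> y = 0" by (simp add: \<psi>_def)
    then show ?thesis by simp
  qed
  have int: "integrable (lborel \<Otimes>\<^sub>M lborel) (\<lambda>(y, T). k y T *\<^sub>R \<psi> y)"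
  proof (rule lborel_pair.Fubini_integrable)
    show "(\<lambda>(y, T). k y T *\<^sub>R \<psi> y) \<in> borel_measurable (lborel \<Otimes>\<^sub>M lborel)"
      unfolding k_def by measurable
    show "integrable lborel (\<lambda>y. LINT T|lborel. norm (case (y, T) of (y, T) \<Rightarrow> k y T *\<^sub>R \<psi> y))"
      unfolding prod.case innern by (intro integrable_mult_right integrable_norm \<psi>i)
    show "AE y in lborel. integrable lborel (\<lambda>T. case (y, T) of (y, T) \<Rightarrow> k y T *\<^sub>R \<psi> y)"
      using inner by (auto simp: has_bochner_integral_iff)
  qed
  have outer: "(LINT y|lborel. k y T *\<^sub>R \<psi> y)
      = indicator {0<..<X} T *\<^sub>R ((X - T) powr (\<alpha> - 1) *\<^sub>R abel_integral (1 - \<alpha>) \<phi> T)" for T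
  proof (cases "T \<in> {0<..<X}")
    case True
    have "k y T *\<^sub>R \<psi> y = (X - T) powr (\<alpha> - 1) *\<^sub>R (indicator {0<..<T} y *\<^sub>R ((T - y) powr (1 - \<alpha> - 1) *\<^sub>R \<phi> y))" for y
      using True by (auto simp: k_def \<psi>_def indicator_def)
    then have "(LINT y|lborel. k y T *\<^sub>R \<psi> y) = (X - T) powr (\<alpha> - 1) *\<^sub>R abel_integral (1 - \<alpha>) \<phi> T"
      by (simp only: integral_scaleR_right abel_integral_def set_lebesgue_integral_def)
    then show ?thesis using True by simp
  next
    case False
    have z: "k y T *\<^sub>R \<psi> y = 0" for y
      using False by (auto simp: k_def \<psi>_def indicator_def)
    show ?thesis unfolding z using False by simp
  qed
  have "abel_integral \<alpha> (abel_integral (1 - \<alpha>) \<phi>) X = (LINT T|lborel. (LINT y|lborel. k y T *\<^sub>R \<psi> y))"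
    unfolding outer by (simp only: abel_integral_def [of \<alpha>] set_lebesgue_integral_def)
  also have "\<dots> = (LINT y|lborel. (LINT T|lborel. k y T *\<^sub>R \<psi> y))"
    by (rule lborel_pair.Fubini_integral [OF int])
  also have "\<dots> = (LINT y|lborel. ?B *\<^sub>R \<psi> y)"
    using inner by (simp only: has_bochner_integral_iff)
  also have "\<dots> = ?B *\<^sub>R (LINT y:{0<..<X}|lborel. \<phi> y)"
    unfolding set_lebesgue_integral_def \<psi>_def by (rule integral_scaleR_right)
  finally show ?thesis .
qed

text \<open>
The Abel kernel of order \<open>1 - \<alpha>\<close> is bounded below by a positive constant.
\<close>
lemma abel_integrable_imp_integrable:
  fixes h :: "real \<Rightarrow> complex"
  assumes "abel_integrable (1 - \<alpha>) h X" "0 < \<alpha>" 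
  shows "set_integrable lborel {0<..<X} h"
proof -
  let ?f = "\<lambda>y. indicator {0<..<X} y *\<^sub>R ((X - y) powr (1 - \<alpha> - 1) *\<^sub>R h y)"
  have f: "integrable lborel ?f"
    using assms(1) by (simp only: abel_integrable_def set_integrable_def)
  then have [measurable]: "?f \<in> borel_measurable borel" by simp
  have eq: "((indicator {0<..<X} y * (X - y) powr \<alpha>)) *\<^sub>R ?f y = indicator {0<..<X} y *\<^sub>R h y" for y
    by (simp add: indicator_def powr_add [symmetric])
  have "integrable lborel (\<lambda>y. ((indicator {0<..<X} y * (X - y) powr \<alpha>)) *\<^sub>R ?f y)"
  proof (rule Bochner_Integration.integrable_bound)
    show "integrable lborel (\<lambda>y. (X powr \<alpha>) *\<^sub>R ?f y)" using f by (rule integrable_scaleR_right)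
    have "(\<lambda>y. ((indicator {0<..<X} y * (X - y) powr \<alpha>)) *\<^sub>R ?f y) \<in> borel_measurable borel" by measurable
    then show "(\<lambda>y. ((indicator {0<..<X} y * (X - y) powr \<alpha>)) *\<^sub>R ?f y) \<in> borel_measurable lborel" by simp
    have "\<bar>indicator {0<..<X} y * (X - y) powr \<alpha>\<bar> \<le> \<bar>X powr \<alpha>\<bar>" for y
      using assms(2) by (auto simp: indicator_def intro!: powr_mono2)
    then show "AE y in lborel. norm (((indicator {0<..<X} y * (X - y) powr \<alpha>)) *\<^sub>R ?f y) \<le> norm ((X powr \<alpha>) *\<^sub>R ?f y)"
      unfolding norm_scaleR by (intro AE_I2 mult_right_mono) auto
  qed
  then show ?thesis unfolding eq by (simp only: set_integrable_def)
qed

lemma bounded_of_tendsto_zero: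
  fixes F :: "real \<Rightarrow> complex"
  assumes cont: "continuous_on {0<..} F" and lim: "(F \<longlongrightarrow> 0) (at_right 0)"
  obtains B where "0 \<le> B" "\<And>y. 0 < y \<Longrightarrow> y \<le> R \<Longrightarrow> norm (F y) \<le> B"
proof -
  have "eventually (\<lambda>y. dist (F y) 0 < 1) (at_right 0)"
    using tendstoD [OF lim, of 1] by simp
  then obtain d where d: "d > 0" "\<And>y. 0 < y \<Longrightarrow> y < d \<Longrightarrow> norm (F y) < 1"
    by (auto simp: eventually_at_right_field)
  have "compact (F ` {d..R})"
    using d(1) by (intro compact_continuous_image continuous_on_subset [OF cont]) auto
  then obtain B where B: "\<And>y. y \<in> {d..R} \<Longrightarrow> norm (F y) \<le> B"
    by (meson bounded_iff compact_imp_bounded imageI)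
  show thesis
  proof (rule that [of "max 1 B"])
    show "norm (F y) \<le> max 1 B" if "0 < y" "y \<le> R" for y
      using d(2) [of y] B [of y] that by (cases "y < d") (auto simp: le_max_iff_disj)
  qed simp
qed

lemma bounded_continuous_abel_integrable:
  fixes F :: "real \<Rightarrow> complex"
  assumes cont: "continuous_on {0<..} F" and lim: "(F \<longlongrightarrow> 0) (at_right 0)" and a: "a > 0" and X: "X > 0"
  shows "abel_integrable a F X"
proof -
  obtain B where B: "0 \<le> B" "\<And>y. 0 < y \<Longrightarrow> y \<le> X \<Longrightarrow> norm (F y) \<le> B"
    using bounded_of_tendsto_zero [OF cont lim] by blast
  have "continuous_on {0<..<X} F" by (rule continuous_on_subset [OF cont]) auto
  then have [measurable]: "(\<lambda>y. indicator {0<..<X} y *\<^sub>R F y) \<in> borel_measurable borel"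
    by (intro borel_measurable_continuous_on_indicator) auto
  have "integrable lborel (\<lambda>y. (X - y) powr (a - 1) *\<^sub>R (indicator {0<..<X} y *\<^sub>R F y))"
  proof (rule Bochner_Integration.integrable_bound)
    show "integrable lborel (\<lambda>y. (indicator {0<..<X} y *\<^sub>R (X - y) powr (a - 1)) * B)"
      using abel_kernel_integrable [OF X a] unfolding set_integrable_def by (rule integrable_mult_left)
    have "(\<lambda>y. (X - y) powr (a - 1) *\<^sub>R (indicator {0<..<X} y *\<^sub>R F y)) \<in> borel_measurable borel"
      by measurable
    then show "(\<lambda>y. (X - y) powr (a - 1) *\<^sub>R (indicator {0<..<X} y *\<^sub>R F y)) \<in> borel_measurable lborel"
      by simp
    show "AE y in lborel. norm ((X - y) powr (a - 1) *\<^sub>R (indicator {0<..<X} y *\<^sub>R F y))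
        \<le> norm ((indicator {0<..<X} y *\<^sub>R (X - y) powr (a - 1)) * B)"
      using B by (intro AE_I2) (auto simp: indicator_def abs_mult intro!: mult_left_mono)
  qed
  moreover have "(X - y) powr (a - 1) *\<^sub>R (indicator {0<..<X} y *\<^sub>R F y)
      = indicator {0<..<X} y *\<^sub>R ((X - y) powr (a - 1) *\<^sub>R F y)" for y
    by (simp add: mult_ac)
  ultimately show ?thesis by (simp only: abel_integrable_def set_integrable_def)
qed

lemma abel_integrable_one: "abel_integrable 1 F X = set_integrable lborel {0<..<X} F"
  unfolding abel_integrable_def by (rule set_integrable_cong) auto

lemma abel_diff:
  assumes "abel_integrable a f X" "abel_integrable a g X"
  shows "abel_integral a (\<lambda>y. f y - g y) X = abel_integral a f X - abel_integral a g X"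
  using assms unfolding abel_integral_def abel_integrable_def
  by (subst set_integral_diff(2) [symmetric]) (simp_all add: scaleR_diff_right)

lemma abel_add:
  assumes "abel_integrable a f X" "abel_integrable a g X"
  shows "abel_integral a (\<lambda>y. f y + g y) X = abel_integral a f X + abel_integral a g X"
  using assms unfolding abel_integral_def abel_integrable_def
  by (subst set_integral_add(2) [symmetric]) (simp_all add: scaleR_add_right)

text \<open>
Up to the cut at \<open>X\<close> this is Euler's integral with \<open>u = l (X - T)\<close>; the bound is uniform in \<open>X\<close> and tends to
\<open>0\<close> as \<open>l\<close> grows.
\<close>
lemma exp_weighted_kernel_bound:
  fixes \<alpha> l X :: real
  assumes \<alpha>: "0 < \<alpha>" and l: "0 < l" and X: "0 < X"
  shows "set_integrable lborel {0<..<X} (\<lambda>T. (X - T) powr (\<alpha> - 1) * exp (- (l * (X - T))))"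
    and "(LINT T:{0<..<X}|lborel. (X - T) powr (\<alpha> - 1) * exp (- (l * (X - T)))) \<le> Gamma \<alpha> * l powr (- \<alpha>)"
proof -
  let ?f = "\<lambda>u::real. u powr (\<alpha> - 1) * exp (- u)"
  let ?g = "\<lambda>r. r powr (\<alpha> - 1) * exp (- (l * r))"
  have c: "0 < 1 / l" using l by simp
  have fg: "?f (r / (1 / l)) = l powr (\<alpha> - 1) * ?g r" if "r \<in> {0<..}" for r
    using that l by (simp add: powr_mult mult.commute)
  have fi: "set_integrable lborel {0<..} (\<lambda>r. ?f (r / (1 / l)))"
    unfolding half_line_scale(1) [OF c, of ?f] by (rule Gamma_half_line(1) [OF \<alpha>])
  have fi': "set_integrable lborel {0<..} (\<lambda>r. l powr (\<alpha> - 1) * ?g r)"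
  proof -
    have "set_integrable lborel {0<..} (\<lambda>r. ?f (r / (1 / l)))
        \<longleftrightarrow> set_integrable lborel {0<..} (\<lambda>r. l powr (\<alpha> - 1) * ?g r)"
      by (rule set_integrable_cong [OF refl refl fg])
    then show ?thesis using fi by blast
  qed
  have gi: "set_integrable lborel {0<..} ?g"
    using set_integrable_mult_right [OF fi', of "1 / l powr (\<alpha> - 1)"] l by simp
  have "(LINT r:{0<..}|lborel. l powr (\<alpha> - 1) * ?g r) = (LINT r:{0<..}|lborel. ?f (r / (1 / l)))"
    by (rule set_lebesgue_integral_cong) (use fg in auto)
  also have "\<dots> = (1 / l) * Gamma \<alpha>"
    unfolding half_line_scale(2) [OF c, of ?f] Gamma_half_line(2) [OF \<alpha>] ..
  finally have "l powr (\<alpha> - 1) * (LINT r:{0<..}|lborel. ?g r) = Gamma \<alpha> / l" by simp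
  then have gv: "(LINT r:{0<..}|lborel. ?g r) = Gamma \<alpha> * l powr (- \<alpha>)"
    using l by (simp add: powr_diff powr_minus field_simps)
  have eq: "indicator {0<..<X} T *\<^sub>R ((X - T) powr (\<alpha> - 1) * exp (- (l * (X - T))))
      = (indicator {0<..<X} (X + (- 1) * T) *\<^sub>R ?g (X + (- 1) * T))" for T
    by (auto simp: indicator_def)
  have giX: "integrable lborel (\<lambda>r. indicator {0<..<X} r *\<^sub>R ?g r)"
  proof -
    have "set_integrable lborel {0<..<X} ?g"
      by (rule set_integrable_subset [OF gi]) auto
    then show ?thesis by (simp only: set_integrable_def)
  qed
  show "set_integrable lborel {0<..<X} (\<lambda>T. (X - T) powr (\<alpha> - 1) * exp (- (l * (X - T))))"
    unfolding set_integrable_def eq by (rule lborel_integrable_real_affine [OF giX]) simp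
  have "(LINT T:{0<..<X}|lborel. (X - T) powr (\<alpha> - 1) * exp (- (l * (X - T))))
      = (LINT r|lborel. indicator {0<..<X} r *\<^sub>R ?g r)"
    unfolding set_lebesgue_integral_def eq
    using lborel_integral_real_affine [of "- 1" "\<lambda>r. indicator {0<..<X} r *\<^sub>R ?g r" X] by simp
  also have "\<dots> \<le> (LINT r|lborel. indicator {0<..} r *\<^sub>R ?g r)"
    using gi giX unfolding set_integrable_def
    by (intro integral_mono) (auto simp: indicator_def)
  also have "\<dots> = Gamma \<alpha> * l powr (- \<alpha>)" using gv by (simp add: set_lebesgue_integral_def)
  finally show "(LINT T:{0<..<X}|lborel. (X - T) powr (\<alpha> - 1) * exp (- (l * (X - T)))) \<le> Gamma \<alpha> * l powr (- \<alpha>)" .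
qed

text \<open>
Let \<open>N\<close> be the supremum of \<open>exp (- l X) \<bar>F X\<bar>\<close> over \<open>0 < X \<le> R\<close>.  The equation gives
\<open>N \<le> (\<alpha> + \<nu> \<Gamma>(\<alpha>) l\<^bsup>-\<alpha>\<^esup>) N\<close>.  The first term cannot be made small, since the equation is singular at \<open>0\<close>,
but \<open>\<alpha> < 1\<close> leaves room for the second one when \<open>l\<close> is large, and \<open>N = 0\<close> follows.
\<close>
lemma volterra_unique_zero:
  fixes F :: "real \<Rightarrow> complex"
  assumes \<alpha>: "0 < \<alpha>" "\<alpha> < 1" and \<nu>: "0 \<le> \<nu>"
    and cont: "continuous_on {0<..} F" and lim: "(F \<longlongrightarrow> 0) (at_right 0)"
    and eq: "\<And>X. 0 < X \<Longrightarrow> X *\<^sub>R F X = \<alpha> *\<^sub>R (LINT y:{0<..<X}|lborel. F y) - \<nu> *\<^sub>R abel_integral \<alpha> (\<lambda>T. T *\<^sub>R F T) X"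
    and R: "0 < R"
  shows "F R = 0"
proof -
  obtain B where B: "0 \<le> B" "\<And>y. 0 < y \<Longrightarrow> y \<le> R \<Longrightarrow> norm (F y) \<le> B"
    using bounded_of_tendsto_zero [OF cont lim] by blast
  define g where "g = \<nu> * Gamma \<alpha>"
  have g: "0 \<le> g" using \<nu> Gamma_real_pos [OF \<alpha>(1)] by (simp add: g_def)
  \<comment> \<open>chosen so that \<open>g / l\<^sup>\<alpha>\<close> stays below the gap \<open>1 - \<alpha>\<close>\<close>
  define l where "l = (2 * g / (1 - \<alpha>) + 1) powr (1 / \<alpha>)"
  have gl: "0 < 2 * g / (1 - \<alpha>) + 1" using g \<alpha> by (intro add_nonneg_pos) auto
  have l: "0 < l" using gl by (simp add: l_def)
  have "l powr (- \<alpha>) = 1 / (2 * g / (1 - \<alpha>) + 1)"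
    using \<alpha> gl by (simp add: l_def powr_powr powr_minus_divide)
  then have "g * l powr (- \<alpha>) = g / (2 * g / (1 - \<alpha>) + 1)" by simp
  also have "\<dots> < 1 - \<alpha>"
  proof -
    have "(1 - \<alpha>) * (2 * g / (1 - \<alpha>) + 1) = 2 * g + (1 - \<alpha>)"
      using \<alpha> by (simp add: field_simps)
    then show ?thesis using g \<alpha> by (simp only: pos_divide_less_eq [OF gl])
  qed
  finally have \<theta>: "\<alpha> + g * l powr (- \<alpha>) < 1" by simp
  define W where "W = (\<lambda>y. exp (- (l * y)) * norm (F y))"
  define N where "N = (SUP y\<in>{0<..R}. W y)"
  have bdd: "bdd_above (W ` {0<..R})"
  proof (rule bdd_aboveI2)
    fix y assume y: "y \<in> {0<..R}"
    then have "exp (- (l * y)) * norm (F y) \<le> 1 * B"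
      using B l by (intro mult_mono) auto
    then show "W y \<le> B" by (simp add: W_def)
  qed
  have WN: "W y \<le> N" if "0 < y" "y \<le> R" for y
    unfolding N_def by (rule cSUP_upper [OF _ bdd]) (use that in auto)
  have N0: "0 \<le> N" using WN [OF R order_refl] by (simp add: W_def order_trans [rotated])
  have FN: "norm (F y) \<le> N * exp (l * y)" if "0 < y" "y \<le> R" for y
  proof -
    have "exp (l * y) * W y \<le> exp (l * y) * N" using WN [OF that] by (intro mult_left_mono) auto
    moreover have "exp (l * y) * W y = norm (F y)" by (simp add: W_def exp_minus)
    ultimately show ?thesis by (metis mult.commute)
  qed
  have step: "W X \<le> (\<alpha> + g * l powr (- \<alpha>)) * N" if X: "0 < X" "X \<le> R" for X
  proof -
    let ?E = "N * exp (l * X)"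
    have i1: "set_integrable lborel {0<..<X} F"
      using bounded_continuous_abel_integrable [OF cont lim _ X(1), of 1]
      by (simp add: abel_integrable_one)
    have i2: "set_integrable lborel {0<..<X} (\<lambda>T. (X - T) powr (\<alpha> - 1) *\<^sub>R (T *\<^sub>R F T))"
      using bounded_continuous_abel_integrable [OF _ _ \<alpha>(1) X(1), of "\<lambda>T. T *\<^sub>R F T"]
        tendsto_scaleR [OF tendsto_ident_at lim]
      by (simp add: abel_integrable_def continuous_on_scaleR cont)
    have ci: "set_integrable lborel {0<..<X} (\<lambda>y. c)" for c :: real
      unfolding set_integrable_def using X(1)
      by (auto intro!: integrable_real_indicator simp: emeasure_lborel_Ioo)
    have "norm (LINT y:{0<..<X}|lborel. F y) \<le> (LINT y:{0<..<X}|lborel. norm (F y))"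
      by (rule set_integral_norm_bound [OF i1])
    also have "\<dots> \<le> (LINT y:{0<..<X}|lborel. ?E)"
    proof (rule set_integral_mono [OF set_integrable_norm [OF i1] ci])
      fix y assume y: "y \<in> {0<..<X}"
      then have "norm (F y) \<le> N * exp (l * y)" using FN [of y] X by auto
      also have "\<dots> \<le> ?E" using y l N0 by (intro mult_left_mono) auto
      finally show "norm (F y) \<le> ?E" .
    qed
    also have "\<dots> = X * ?E" using X by (simp add: set_lebesgue_integral_def)
    finally have b1: "norm (LINT y:{0<..<X}|lborel. F y) \<le> X * ?E" .
    note ew = exp_weighted_kernel_bound [OF \<alpha>(1) l X(1)]
    have "norm (abel_integral \<alpha> (\<lambda>T. T *\<^sub>R F T) X) \<le> (LINT T:{0<..<X}|lborel. norm ((X - T) powr (\<alpha> - 1) *\<^sub>R (T *\<^sub>R F T)))"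
      unfolding abel_integral_def by (rule set_integral_norm_bound [OF i2])
    also have "\<dots> \<le> (LINT T:{0<..<X}|lborel. (X * ?E) * ((X - T) powr (\<alpha> - 1) * exp (- (l * (X - T)))))"
    proof (rule set_integral_mono [OF set_integrable_norm [OF i2] set_integrable_mult_right])
      fix T assume T: "T \<in> {0<..<X}"
      have "T * norm (F T) \<le> X * (N * exp (l * T))"
        using T X FN [of T] N0 by (intro mult_mono) auto
      also have "N * exp (l * T) = ?E * exp (- (l * (X - T)))"
        by (simp add: mult.assoc exp_add [symmetric] algebra_simps)
      finally have "(X - T) powr (\<alpha> - 1) * (T * norm (F T)) \<le> (X - T) powr (\<alpha> - 1) * (X * (?E * exp (- (l * (X - T)))))"
        by (intro mult_left_mono) auto
      then show "norm ((X - T) powr (\<alpha> - 1) *\<^sub>R (T *\<^sub>R F T)) \<le> (X * ?E) * ((X - T) powr (\<alpha> - 1) * exp (- (l * (X - T))))"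
        using T by (simp add: abs_mult mult_ac)
    qed (use ew in simp)
    also have "\<dots> = (X * ?E) * (LINT T:{0<..<X}|lborel. (X - T) powr (\<alpha> - 1) * exp (- (l * (X - T))))"
      by (rule set_integral_mult_right)
    also have "\<dots> \<le> (X * ?E) * (Gamma \<alpha> * l powr (- \<alpha>))"
      using ew(2) X N0 by (intro mult_left_mono) auto
    finally have b2: "norm (abel_integral \<alpha> (\<lambda>T. T *\<^sub>R F T) X) \<le> (X * ?E) * (Gamma \<alpha> * l powr (- \<alpha>))" .
    have "X * norm (F X) = norm (X *\<^sub>R F X)" using X by simp
    also have "\<dots> \<le> \<alpha> * norm (LINT y:{0<..<X}|lborel. F y) + \<nu> * norm (abel_integral \<alpha> (\<lambda>T. T *\<^sub>R F T) X)"
      unfolding eq [OF X(1)] using norm_triangle_ineq4 [of "\<alpha> *\<^sub>R (LINT y:{0<..<X}|lborel. F y)"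
        "\<nu> *\<^sub>R abel_integral \<alpha> (\<lambda>T. T *\<^sub>R F T) X"] \<alpha> \<nu> by simp
    also have "\<dots> \<le> \<alpha> * (X * ?E) + \<nu> * ((X * ?E) * (Gamma \<alpha> * l powr (- \<alpha>)))"
      using b1 b2 \<alpha> \<nu> by (intro add_mono mult_left_mono) auto
    also have "\<dots> = X * ((\<alpha> + g * l powr (- \<alpha>)) * ?E)"
      by (simp add: g_def algebra_simps)
    finally have "norm (F X) \<le> (\<alpha> + g * l powr (- \<alpha>)) * ?E" using X by simp
    then have "exp (- (l * X)) * norm (F X) \<le> exp (- (l * X)) * ((\<alpha> + g * l powr (- \<alpha>)) * ?E)"
      by (intro mult_left_mono) auto
    also have "\<dots> = (\<alpha> + g * l powr (- \<alpha>)) * N * (exp (- (l * X)) * exp (l * X))"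
      by (simp only: mult_ac)
    also have "exp (- (l * X)) * exp (l * X) = 1" by (simp add: exp_add [symmetric])
    finally show ?thesis by (simp add: W_def)
  qed
  have "N \<le> (\<alpha> + g * l powr (- \<alpha>)) * N"
  proof -
    have "(SUP y\<in>{0<..R}. W y) \<le> (\<alpha> + g * l powr (- \<alpha>)) * N"
      by (rule cSUP_least) (use R step in auto)
    then show ?thesis by (simp only: N_def)
  qed
  then have "N * (1 - (\<alpha> + g * l powr (- \<alpha>))) \<le> 0" by (simp add: algebra_simps)
  then have "N \<le> 0" using \<theta> by (simp add: mult_le_0_iff)
  then have "norm (F R) \<le> 0" using FN [OF R order_refl] N0 by simp
  then show ?thesis by simp
qed

text \<open>
Integration by parts in the form \<open>(y G)' = G + y G'\<close>.  The derivative need not be continuous, so the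
fundamental theorem is used for the gauge integral, which agrees with the Lebesgue integral because
the integrand is known to be integrable.
\<close>
lemma integral_log_derivative:
  fixes G D :: "real \<Rightarrow> complex"
  assumes cont: "continuous_on {0<..} G" and lim: "(G \<longlongrightarrow> 0) (at_right 0)"
    and der: "\<And>y. 0 < y \<Longrightarrow> \<exists>g. (G has_vector_derivative g) (at y) \<and> D y = y *\<^sub>R g"
    and X: "0 < X" and D: "set_integrable lborel {0<..<X} D"
  shows "(LINT y:{0<..<X}|lborel. D y) = X *\<^sub>R G X - (LINT y:{0<..<X}|lborel. G y)"
proof -
  let ?P = "\<lambda>y. y *\<^sub>R G y"
  have G: "set_integrable lborel {0<..<X} G"
    using bounded_continuous_abel_integrable [OF cont lim _ X, of 1] by (simp add: abel_integrable_one)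
  obtain B where B: "0 \<le> B" "\<And>y. 0 < y \<Longrightarrow> y \<le> X \<Longrightarrow> norm (G y) \<le> B"
    using bounded_of_tendsto_zero [OF cont lim] by blast
  have "((\<lambda>y. G y + D y) has_integral (?P X - ?P 0)) {0..X}"
  proof (rule fundamental_theorem_of_calculus_interior)
    show "continuous_on {0..X} ?P"
      unfolding continuous_on_eq_continuous_within
    proof
      fix y assume y: "y \<in> {0..X}"
      show "continuous (at y within {0..X}) ?P"
      proof (cases "y = 0")
        case False
        then have "isCont G y" using y cont by (simp add: continuous_on_eq_continuous_at)
        then have "isCont ?P y" by (intro continuous_intros)
        then show ?thesis by (rule continuous_at_imp_continuous_at_within)
      next
        case True
        have "(?P \<longlongrightarrow> 0) (at 0 within {0..X})"
        proof (rule Lim_null_comparison)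
          show "\<forall>\<^sub>F y in at 0 within {0..X}. norm (?P y) \<le> \<bar>y\<bar> * B"
            using B by (auto simp: eventually_at_filter intro!: always_eventually mult_left_mono)
          have "((\<lambda>y. \<bar>y\<bar> * B) \<longlongrightarrow> \<bar>0\<bar> * B) (at 0 within {0..X})" by (intro tendsto_intros)
          then show "((\<lambda>y. \<bar>y\<bar> * B) \<longlongrightarrow> 0) (at 0 within {0..X})" by simp
        qed
        then show ?thesis using True by (simp add: continuous_within)
      qed
    qed
    fix y assume y: "y \<in> {0<..<X}"
    then obtain g where g: "(G has_vector_derivative g) (at y)" "D y = y *\<^sub>R g" using der by auto
    have "(?P has_vector_derivative (y *\<^sub>R g + 1 *\<^sub>R G y)) (at y)"
      by (rule has_vector_derivative_scaleR [OF _ g(1)]) (auto intro: derivative_intros)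
    then show "(?P has_vector_derivative (G y + D y)) (at y)" using g(2) by (simp add: add.commute)
  qed (use X in simp)
  then have "((\<lambda>y. G y + D y) has_integral (X *\<^sub>R G X)) {0<..<X}"
    by (simp add: has_integral_Icc_iff_Ioo)
  then have "X *\<^sub>R G X = integral {0<..<X} (\<lambda>y. G y + D y)" by (simp add: integral_unique)
  also have "\<dots> = (LINT y:{0<..<X}|lborel. G y + D y)"
    using set_borel_integral_eq_integral(2) [OF set_integral_add(1) [OF G D]] by simp
  also have "\<dots> = (LINT y:{0<..<X}|lborel. G y) + (LINT y:{0<..<X}|lborel. D y)"
    by (rule set_integral_add(2) [OF G D])
  finally show ?thesis by simp
qed

section \<open>The Cauchy problem\<close>

lemma caputo_power_exists_differentiable:
  assumes "caputo_power_exists H \<alpha> v t" "0 < \<alpha>" "\<alpha> < 1" "0 < s" "s < t"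
  shows "v differentiable (at s)"
proof -
  have "EK_exists (2 * H) 0 (- \<alpha>) (regularize v) t"
    using assms(1) by (simp add: caputo_power_exists_def)
  then have "regularize v differentiable (at s)"
    using assms by (subst (asm) EK_exists.simps) simp
  then have "(\<lambda>x. regularize v x + Lim (at_right 0) v) differentiable (at s)"
    by (intro differentiable_add) simp_all
  then show ?thesis by (simp add: regularize_def)
qed

text \<open>
Abel inversion removes the fractional kernel and integration by parts removes the derivative; the
result involves no regularity of the solution beyond continuity and its limit at \<open>0\<close>, so differences
of solutions can be handled by a contraction argument.
\<close>
lemma caputo_solution_volterra:
  fixes v :: "real \<Rightarrow> complex"
  assumes H: "0 < H" and \<alpha>: "0 < \<alpha>" "\<alpha> < 1"
    and lim: "(v \<longlongrightarrow> 1) (at_right 0)"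
    and ex: "\<And>t. 0 < t \<Longrightarrow> caputo_power_exists H \<alpha> v t"
    and eq: "\<And>t. 0 < t \<Longrightarrow> caputo_power H \<alpha> v t = - of_real \<kappa> * v t"
  defines "G \<equiv> \<lambda>y. v (y powr (1 / (2 * H))) - 1"
  shows "continuous_on {0<..} G" and "(G \<longlongrightarrow> 0) (at_right 0)"
    and "\<And>X. 0 < X \<Longrightarrow> X *\<^sub>R G X = \<alpha> *\<^sub>R (LINT y:{0<..<X}|lborel. G y)
      - (\<kappa> * Gamma (1 - \<alpha>) / (2 * H) powr \<alpha> / Beta \<alpha> (1 - \<alpha>)) *\<^sub>R
        abel_integral \<alpha> (\<lambda>T. T *\<^sub>R (G T + 1)) X"
proof -
  have m: "0 < 2 * H" using H by simp
  have diff: "v differentiable (at s)" if "0 < s" for s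
    using caputo_power_exists_differentiable [OF ex \<alpha> that, of "s + 1"] that by simp
  define D where "D = log_derivative (2 * H) v"
  have der: "\<exists>g. (G has_vector_derivative g) (at y) \<and> D y = y *\<^sub>R g" if y: "0 < y" for y
  proof -
    let ?s = "y powr (1 / (2 * H))"
    have s: "0 < ?s" using y by simp
    have 1: "((\<lambda>y. y powr (1 / (2 * H))) has_vector_derivative (1 / (2 * H) * y powr (1 / (2 * H) - 1))) (at y)"
      unfolding has_real_derivative_iff_has_vector_derivative [symmetric]
      using y by (auto intro!: derivative_eq_intros simp: powr_diff)
    have 2: "(v has_vector_derivative vector_derivative v (at ?s)) (at ?s)"
      using diff [OF s] by (simp add: vector_derivative_works)
    have "((\<lambda>y. v (y powr (1 / (2 * H)))) has_vector_derivative
        (1 / (2 * H) * y powr (1 / (2 * H) - 1)) *\<^sub>R vector_derivative v (at ?s)) (at y)"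
      using vector_diff_chain_at [OF 1 2] by (simp add: o_def)
    then have "(G has_vector_derivative (1 / (2 * H) * y powr (1 / (2 * H) - 1)) *\<^sub>R vector_derivative v (at ?s) - 0) (at y)"
      unfolding G_def by (intro derivative_intros)
    moreover have "y * y powr (1 / (2 * H) - 1) = y powr (1 / (2 * H))"
      using y by (simp add: powr_mult_base)
    then have "D y = y *\<^sub>R ((1 / (2 * H) * y powr (1 / (2 * H) - 1)) *\<^sub>R vector_derivative v (at ?s) - 0)"
      by (simp add: D_def log_derivative_def mult_ac)
    ultimately show ?thesis by blast
  qed
  show cont: "continuous_on {0<..} G"
    using der by (intro continuous_at_imp_continuous_on ballI) (auto dest: has_vector_derivative_continuous)
  show limG: "(G \<longlongrightarrow> 0) (at_right 0)"
  proof -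
    have "((\<lambda>y. y powr (1 / (2 * H))) \<longlongrightarrow> 0 powr (1 / (2 * H))) (at_right 0)"
      using m by (intro tendsto_powr2 tendsto_intros) (auto simp: eventually_at_filter)
    then have "filterlim (\<lambda>y. y powr (1 / (2 * H))) (at_right 0) (at_right 0)"
      by (auto simp: filterlim_at eventually_at_filter)
    from filterlim_compose [OF lim this] have "(G \<longlongrightarrow> 1 - 1) (at_right 0)"
      unfolding G_def by (intro tendsto_intros)
    then show ?thesis by simp
  qed
  define \<mu> where "\<mu> = \<kappa> * Gamma (1 - \<alpha>) / (2 * H) powr \<alpha>"
  have G0: "Gamma (1 - \<alpha>) > 0" using \<alpha> by (intro Gamma_real_pos) simp
  have int: "abel_integrable (1 - \<alpha>) G T" "abel_integrable (1 - \<alpha>) D T"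
    and abel: "(1 - \<alpha>) *\<^sub>R abel_integral (1 - \<alpha>) G T + abel_integral (1 - \<alpha>) D T = - (\<mu> *\<^sub>R (T *\<^sub>R (G T + 1)))"
    if T: "0 < T" for T
  proof -
    define t where "t = T powr (1 / (2 * H))"
    have t: "0 < t" and tT: "t powr (2 * H) = T" using T m by (simp_all add: t_def powr_powr)
    have "caputo_power_exists H \<alpha> v t \<longleftrightarrow> abel_integrable (1 - \<alpha>) G T \<and> abel_integrable (1 - \<alpha>) D T"
      using caputo_power_abel(1) [OF H \<alpha> t diff lim] unfolding tT G_def D_def .
    then show "abel_integrable (1 - \<alpha>) G T" "abel_integrable (1 - \<alpha>) D T" using ex [OF t] by auto
    let ?S = "(1 - \<alpha>) *\<^sub>R abel_integral (1 - \<alpha>) G T + abel_integral (1 - \<alpha>) D T"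
    have "caputo_power H \<alpha> v t = ((2 * H) powr \<alpha> / (T * Gamma (1 - \<alpha>))) *\<^sub>R ?S"
      using caputo_power_abel(2) [OF H \<alpha> t diff lim] unfolding tT G_def D_def .
    moreover have "v t = G T + 1" by (simp add: G_def t_def)
    ultimately have "((2 * H) powr \<alpha> / (T * Gamma (1 - \<alpha>))) *\<^sub>R ?S = - (\<kappa> *\<^sub>R (G T + 1))"
      using eq [OF t] by (simp add: scaleR_conv_of_real)
    then have "(T * Gamma (1 - \<alpha>) / (2 * H) powr \<alpha>) *\<^sub>R ((2 * H) powr \<alpha> / (T * Gamma (1 - \<alpha>))) *\<^sub>R ?S
       = (T * Gamma (1 - \<alpha>) / (2 * H) powr \<alpha>) *\<^sub>R (- (\<kappa> *\<^sub>R (G T + 1)))" by (simp only:)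
    moreover have "(T * Gamma (1 - \<alpha>) / (2 * H) powr \<alpha>) * ((2 * H) powr \<alpha> / (T * Gamma (1 - \<alpha>))) = 1"
      using T G0 m by simp
    ultimately have "?S = (T * Gamma (1 - \<alpha>) / (2 * H) powr \<alpha>) *\<^sub>R (- (\<kappa> *\<^sub>R (G T + 1)))"
      by (simp only: scaleR_scaleR scaleR_one)
    also have "\<dots> = - (\<mu> *\<^sub>R (T *\<^sub>R (G T + 1)))" by (simp add: \<mu>_def mult_ac)
    finally show "?S = \<dots>" .
  qed
  fix X :: real assume X: "0 < X"
  let ?B = "Beta \<alpha> (1 - \<alpha>)"
  have B: "?B > 0" using \<alpha> by (simp add: Beta_def Gamma_real_pos)
  have Gi: "set_integrable lborel {0<..<X} G" and Di: "set_integrable lborel {0<..<X} D"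
    using abel_integrable_imp_integrable [OF int(1) [OF X] \<alpha>(1)]
      abel_integrable_imp_integrable [OF int(2) [OF X] \<alpha>(1)] by auto
  have Gi': "set_integrable lborel {0<..<X} (\<lambda>y. (1 - \<alpha>) *\<^sub>R G y)"
    using Gi by (rule set_integrable_scaleR_right)
  let ?\<phi> = "\<lambda>y. (1 - \<alpha>) *\<^sub>R G y + D y"
  have \<phi>: "set_integrable lborel {0<..<X} ?\<phi>" by (rule set_integral_add(1) [OF Gi' Di])
  have ne: "1 - \<alpha> \<noteq> 0" using \<alpha> by simp
  have K: "abel_integral (1 - \<alpha>) ?\<phi> T = - \<mu> *\<^sub>R (T *\<^sub>R (G T + 1))" if T: "0 < T" for T
  proof -
    have "abel_integrable (1 - \<alpha>) (\<lambda>y. (1 - \<alpha>) *\<^sub>R G y) T"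
      unfolding abel_scaleR(1) [OF ne] by (rule int(1) [OF T])
    then show ?thesis
      using abel [OF T] int(2) [OF T] by (simp add: abel_add abel_scaleR(2) [OF ne])
  qed
  have "?B *\<^sub>R (LINT y:{0<..<X}|lborel. ?\<phi> y) = abel_integral \<alpha> (abel_integral (1 - \<alpha>) ?\<phi>) X"
    by (rule abel_inversion [OF \<alpha> \<phi>, symmetric])
  also have "\<dots> = abel_integral \<alpha> (\<lambda>T. - \<mu> *\<^sub>R (T *\<^sub>R (G T + 1))) X"
    by (rule abel_cong(2)) (use K in auto)
  also have "\<dots> = - \<mu> *\<^sub>R abel_integral \<alpha> (\<lambda>T. T *\<^sub>R (G T + 1)) X"
  proof (cases "\<mu> = 0")
    case True
    then show ?thesis by (simp add: abel_integral_def set_lebesgue_integral_def)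
  next
    case False
    then show ?thesis by (intro abel_scaleR(2)) simp
  qed
  finally have 1: "?B *\<^sub>R (LINT y:{0<..<X}|lborel. ?\<phi> y) = - \<mu> *\<^sub>R abel_integral \<alpha> (\<lambda>T. T *\<^sub>R (G T + 1)) X" .
  have "(LINT y:{0<..<X}|lborel. ?\<phi> y) = (1 - \<alpha>) *\<^sub>R (LINT y:{0<..<X}|lborel. G y) + (LINT y:{0<..<X}|lborel. D y)"
    by (simp only: set_integral_add(2) [OF Gi' Di] set_integral_scaleR_right)
  also have "(LINT y:{0<..<X}|lborel. D y) = X *\<^sub>R G X - (LINT y:{0<..<X}|lborel. G y)"
    by (rule integral_log_derivative [OF cont limG der X Di])
  also have "(1 - \<alpha>) *\<^sub>R (LINT y:{0<..<X}|lborel. G y) + \<dots> = X *\<^sub>R G X - \<alpha> *\<^sub>R (LINT y:{0<..<X}|lborel. G y)"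
    by (simp add: scaleR_diff_left)
  finally have 2: "(LINT y:{0<..<X}|lborel. ?\<phi> y) = X *\<^sub>R G X - \<alpha> *\<^sub>R (LINT y:{0<..<X}|lborel. G y)" .
  have "(1 / ?B) *\<^sub>R (?B *\<^sub>R (X *\<^sub>R G X - \<alpha> *\<^sub>R (LINT y:{0<..<X}|lborel. G y)))
     = (1 / ?B) *\<^sub>R (- \<mu> *\<^sub>R abel_integral \<alpha> (\<lambda>T. T *\<^sub>R (G T + 1)) X)"
    using 1 unfolding 2 by (simp only:)
  then have "X *\<^sub>R G X - \<alpha> *\<^sub>R (LINT y:{0<..<X}|lborel. G y) = - ((\<mu> / ?B) *\<^sub>R abel_integral \<alpha> (\<lambda>T. T *\<^sub>R (G T + 1)) X)"
    using B by simp
  then show "X *\<^sub>R G X = \<alpha> *\<^sub>R (LINT y:{0<..<X}|lborel. G y)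
      - (\<kappa> * Gamma (1 - \<alpha>) / (2 * H) powr \<alpha> / ?B) *\<^sub>R abel_integral \<alpha> (\<lambda>T. T *\<^sub>R (G T + 1)) X"
    unfolding \<mu>_def by (simp add: algebra_simps)
qed

text \<open>
The inhomogeneous parts of the Volterra equations of the two solutions cancel.
\<close>
theorem caputo_solution_unique:
  fixes v w :: "real \<Rightarrow> complex"
  assumes H: "0 < H" and \<alpha>: "0 < \<alpha>" "\<alpha> < 1" and \<kappa>: "0 \<le> \<kappa>"
    and v: "(v \<longlongrightarrow> 1) (at_right 0)" "\<And>t. 0 < t \<Longrightarrow> caputo_power_exists H \<alpha> v t"
      "\<And>t. 0 < t \<Longrightarrow> caputo_power H \<alpha> v t = - of_real \<kappa> * v t"
    and w: "(w \<longlongrightarrow> 1) (at_right 0)" "\<And>t. 0 < t \<Longrightarrow> caputo_power_exists H \<alpha> w t"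
      "\<And>t. 0 < t \<Longrightarrow> caputo_power H \<alpha> w t = - of_real \<kappa> * w t"
    and t: "0 < t"
  shows "v t = w t"
proof -
  define F where "F = (\<lambda>y. (v (y powr (1 / (2 * H))) - 1))"
  define G where "G = (\<lambda>y. (w (y powr (1 / (2 * H))) - 1))"
  define \<nu> where "\<nu> = \<kappa> * Gamma (1 - \<alpha>) / (2 * H) powr \<alpha> / Beta \<alpha> (1 - \<alpha>)"
  have V: "continuous_on {0<..} F" "(F \<longlongrightarrow> 0) (at_right 0)"
    unfolding F_def by (rule caputo_solution_volterra [OF H \<alpha> v]; assumption)+
  have W: "continuous_on {0<..} G" "(G \<longlongrightarrow> 0) (at_right 0)"
    unfolding G_def by (rule caputo_solution_volterra [OF H \<alpha> w]; assumption)+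
  let ?d = "\<lambda>y. F y - G y"
  have cont: "continuous_on {0<..} ?d" by (intro continuous_intros V(1) W(1))
  have lim: "(?d \<longlongrightarrow> 0) (at_right 0)" using tendsto_diff [OF V(2) W(2)] by simp
  have \<nu>: "0 \<le> \<nu>"
    using \<kappa> \<alpha> by (auto simp: \<nu>_def Beta_def Gamma_real_pos less_imp_le intro!: divide_nonneg_nonneg mult_nonneg_nonneg)
  have T1: "abel_integrable \<alpha> (\<lambda>T. T *\<^sub>R (g T + 1)) X"
    if "continuous_on {0<..} g" "(g \<longlongrightarrow> 0) (at_right 0)" "0 < X" for g :: "real \<Rightarrow> complex" and X
  proof (rule bounded_continuous_abel_integrable [OF _ _ \<alpha>(1) that(3)])
    show "continuous_on {0<..} (\<lambda>T. T *\<^sub>R (g T + 1))" by (intro continuous_intros that(1))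
    have "((\<lambda>T. T *\<^sub>R (g T + 1)) \<longlongrightarrow> 0 *\<^sub>R (0 + 1)) (at_right 0)" by (intro tendsto_intros that(2))
    then show "((\<lambda>T. T *\<^sub>R (g T + 1)) \<longlongrightarrow> 0) (at_right 0)" by simp
  qed
  have "?d (t powr (2 * H)) = 0"
  proof (rule volterra_unique_zero [OF \<alpha> \<nu> cont lim])
    fix X :: real assume X: "0 < X"
    have F1: "abel_integrable \<alpha> (\<lambda>T. T *\<^sub>R (F T + 1)) X" and G1: "abel_integrable \<alpha> (\<lambda>T. T *\<^sub>R (G T + 1)) X"
      using T1 [OF V(1,2) X] T1 [OF W(1,2) X] by blast+
    have Fi: "set_integrable lborel {0<..<X} F" and Gi: "set_integrable lborel {0<..<X} G"
      using bounded_continuous_abel_integrable [OF V(1,2) _ X, of 1]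
        bounded_continuous_abel_integrable [OF W(1,2) _ X, of 1] by (simp_all add: abel_integrable_one)
    have I: "(LINT y:{0<..<X}|lborel. ?d y) = (LINT y:{0<..<X}|lborel. F y) - (LINT y:{0<..<X}|lborel. G y)"
      by (rule set_integral_diff(2) [OF Fi Gi])
    have "T *\<^sub>R ?d T = T *\<^sub>R (F T + 1) - T *\<^sub>R (G T + 1)" for T
      by (simp add: scaleR_diff_right scaleR_add_right)
    then have J: "abel_integral \<alpha> (\<lambda>T. T *\<^sub>R ?d T) X = abel_integral \<alpha> (\<lambda>T. T *\<^sub>R (F T + 1)) X - abel_integral \<alpha> (\<lambda>T. T *\<^sub>R (G T + 1)) X"
      by (simp only: abel_diff [OF F1 G1])
    have V3: "X *\<^sub>R F X = \<alpha> *\<^sub>R (LINT y:{0<..<X}|lborel. F y) - \<nu> *\<^sub>R abel_integral \<alpha> (\<lambda>T. T *\<^sub>R (F T + 1)) X"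
      unfolding F_def \<nu>_def by (rule caputo_solution_volterra(3) [OF H \<alpha> v X])
    have W3: "X *\<^sub>R G X = \<alpha> *\<^sub>R (LINT y:{0<..<X}|lborel. G y) - \<nu> *\<^sub>R abel_integral \<alpha> (\<lambda>T. T *\<^sub>R (G T + 1)) X"
      unfolding G_def \<nu>_def by (rule caputo_solution_volterra(3) [OF H \<alpha> w X])
    show "X *\<^sub>R ?d X = \<alpha> *\<^sub>R (LINT y:{0<..<X}|lborel. ?d y) - \<nu> *\<^sub>R abel_integral \<alpha> (\<lambda>T. T *\<^sub>R ?d T) X"
      unfolding I J by (simp only: scaleR_diff_right V3 W3) simp
  qed (use t in simp)
  then show ?thesis using t H by (simp add: F_def G_def powr_powr)
qed

lemma caputo_const_identity:
  fixes H \<alpha> b :: real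
  assumes "0 < H"
  shows "(2 * H) powr \<alpha> * (b\<^sup>2 / 2 powr \<alpha>) = H powr \<alpha> * b\<^sup>2"
  using assms by (simp add: powr_mult)

theorem theorem3p1:
  fixes H \<alpha> :: real and u :: "real \<Rightarrow> real \<Rightarrow> real"
  assumes "0 < H" "H < 1" and "0 < \<alpha>" "\<alpha> < 1"
    and "\<And>x t. t > 0 \<Longrightarrow> u x t =
           1 / (2 powr (1 - \<alpha> / 2) * t powr (H * \<alpha>)) *
           wright (- \<alpha> / 2) (1 - \<alpha> / 2) (- (2 powr (\<alpha> / 2) * \<bar>x\<bar> / t powr (H * \<alpha>)))"
  shows "solves_cauchy_problem H \<alpha> u \<and>
         (\<forall>v. solves_cauchy_problem H \<alpha> v \<longrightarrow> (\<forall>t>0. AE x in lborel. v x t = u x t))"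
proof -
  note H = assms(1) and \<alpha> = assms(3,4)
  \<comment> \<open>the width of the solution at time \<open>t\<close>\<close>
  define c where "c = (\<lambda>t. t powr (H * \<alpha>) / 2 powr (\<alpha> / 2))"
  have c: "0 < c t" if "0 < t" for t using that by (simp add: c_def)
  have u: "(\<lambda>x. u x t) = (\<lambda>x. 1 / (2 * c t) * mainardi \<alpha> (\<bar>x\<bar> / c t))" if t: "0 < t" for t
  proof
    fix x
    have "2 powr (1 - \<alpha> / 2) = 2 / 2 powr (\<alpha> / 2)" by (simp add: powr_diff)
    then have "2 powr (1 - \<alpha> / 2) * t powr (H * \<alpha>) = 2 * c t" by (simp add: c_def)
    moreover have "2 powr (\<alpha> / 2) * \<bar>x\<bar> / t powr (H * \<alpha>) = \<bar>x\<bar> / c t" by (simp add: c_def)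
    ultimately show "u x t = 1 / (2 * c t) * mainardi \<alpha> (\<bar>x\<bar> / c t)"
      unfolding assms(5) [OF t] mainardi_def by (simp only:)
  qed
  have u_int: "integrable lborel (\<lambda>x. u x t)" if "0 < t" for t
    unfolding u [OF that] by (rule mainardi_fourier(1) [OF \<alpha> c [OF that]])
  define \<phi> where "\<phi> = (\<lambda>b t. fourier (\<lambda>x. u x t) b)"
  have \<phi>: "\<phi> b t = of_real (mittag_leffler \<alpha> (- (b\<^sup>2 / 2 powr \<alpha> * t powr (2 * H * \<alpha>))))" if t: "0 < t" for b t
  proof -
    have "(t powr (H * \<alpha>))\<^sup>2 = t powr (2 * H * \<alpha>)" "(2 powr (\<alpha> / 2))\<^sup>2 = (2::real) powr \<alpha>"
      using t by (simp_all add: power2_eq_square powr_add [symmetric] mult.assoc)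
    then have "(b * c t)\<^sup>2 = b\<^sup>2 / 2 powr \<alpha> * t powr (2 * H * \<alpha>)"
      by (simp add: c_def power_mult_distrib power_divide)
    then show ?thesis
      unfolding \<phi>_def u [OF t] using mainardi_fourier(2) [OF \<alpha> c [OF t], of b] by simp
  qed
  note sol = caputo_mittag_leffler [OF H \<alpha> \<phi>, unfolded caputo_const_identity [OF H]]
  have 1: "solves_cauchy_problem H \<alpha> u"
    unfolding solves_cauchy_problem_def Let_def
    using u_int sol(1,3,4) unfolding \<phi>_def by blast
  have "AE x in lborel. v x t = u x t" if v: "solves_cauchy_problem H \<alpha> v" and t: "0 < t" for v t
  proof (rule fourier_unique)
    show "integrable lborel (\<lambda>x. v x t)" using v t by (simp add: solves_cauchy_problem_def)
    show "integrable lborel (\<lambda>x. u x t)" by (rule u_int [OF t])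
    fix b
    let ?v = "\<lambda>t. fourier (\<lambda>x. v x t) b"
    have "?v t = \<phi> b t"
    proof (rule caputo_solution_unique [OF H \<alpha> _ _ _ _ sol(1) sol(3) sol(4) t])
      show "(?v \<longlongrightarrow> 1) (at_right 0)"
        and "\<And>t. 0 < t \<Longrightarrow> caputo_power_exists H \<alpha> ?v t"
        and "\<And>t. 0 < t \<Longrightarrow> caputo_power H \<alpha> ?v t = - of_real (H powr \<alpha> * b\<^sup>2) * ?v t"
        using v unfolding solves_cauchy_problem_def Let_def by blast+
    qed simp_all
    then show "fourier (\<lambda>x. v x t) b = fourier (\<lambda>x. u x t) b" by (simp add: \<phi>_def)
  qed
  with 1 show ?thesis by blast
qed

end
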